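(* Assume, in the standing setting, that $\mathbf A^{\sharp}\mathbf A\in\mathrm M(n,\mathbb H)$ and $\mathbf B\mathbf B^{\sharp}\in\mathrm M(p,\mathbb H)$ are both Hermitian. Put $\widetilde{\mathbf D}=\mathbf A^{\sharp}\mathbf D\mathbf B^{\sharp}=(\widetilde d_{kl})\in\mathbb H^{n\times p}$, with rows $\widetilde{\mathbf d}_{k.}$ and columns $\widetilde{\mathbf d}_{.l}$. Then for all $i=1,\dots,n$, $j=1,\dots,p$ the entries of $\mathbf X=\mathbf A^{\dagger}_{M,N}\mathbf D\mathbf B^{\dagger}_{P,Q}$ satisfy: (i) If $r_1<n$ and $r_2<p$: let $\mathbf d^{\mathbf B}_{.j}\in\mathbb H^{n\times1}$ have $k$-th entry $\sum_{\alpha\in I_{r_2,p}\{j\}}\operatorname{rdet}_j\big((\mathbf B\mathbf B^{\sharp})_{j.}(\widetilde{\mathbf d}_{k.})\big)^{\alpha}_{\alpha}$ and $\mathbf d^{\mathbf A}_{i.}\in\mathbb H^{1\times p}$ have $l$-th entry $\sum_{\beta\in J_{r_1,n}\{i\}}\operatorname{cdet}_i\big((\mathbf A^{\sharp}\mathbf A)_{.i}(\widetilde{\mathbf d}_{.l})\big)^{\beta}_{\beta}$. With $\Delta=\sum_{\beta\in J_{r_1,n}}\det\big((\mathbf A^{\sharp}\mathbf A)^{\beta}_{\beta}\big)\cdot\sum_{\alpha\in I_{r_2,p}}\det\big((\mathbf B\mathbf B^{\sharp})^{\alpha}_{\alpha}\big)$, $$x_{ij}=\frac{\sum_{\beta\in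 J_{r_1,n}\{i\}}\operatorname{cdet}_i\big((\mathbf A^{\sharp}\mathbf A)_{.i}(\mathbf d^{\mathbf B}_{.j})\big)^{\beta}_{\beta}}{\Delta}=\frac{\sum_{\alpha\in I_{r_2,p}\{j\}}\operatorname{rdet}_j\big((\mathbf B\mathbf B^{\sharp})_{j.}(\mathbf d^{\mathbf A}_{i.})\big)^{\alpha}_{\alpha}}{\Delta}.$$ (ii) If $r_1=n$ and $r_2=p$: let $\mathbf d^{\mathbf B}_{.j}$ have $k$-th entry $\operatorname{rdet}_j(\mathbf B\mathbf B^{\sharp})_{j.}(\widetilde{\mathbf d}_{k.})$ and $\mathbf d^{\mathbf A}_{i.}$ have $l$-th entry $\operatorname{cdet}_i(\mathbf A^{\sharp}\mathbf A)_{.i}(\widetilde{\mathbf d}_{.l})$. Then $$x_{ij}=\frac{\operatorname{cdet}_i(\mathbf A^{\sharp}\mathbf A)_{.i}(\mathbf d^{\mathbf B}_{.j})}{\det(\mathbf A^{\sharp}\mathbf A)\det(\mathbf B\mathbf B^{\sharp})}=\frac{\operatorname{rdet}_j(\mathbf B\mathbf B^{\sharp})_{j.}(\mathbf d^{\mathbf A}_{i.})}{\det(\mathbf A^{\sharp}\mathbf A)\det(\mathbf B\mathbf B^{\sharp})}.$$ (iii) If $r_1=n$ and $r_2<p$: with $\mathbf d^{\mathbf B}_{.j}$ defined as in (i) and $\mathbf d^{\mathbf A}_{i.}$ defined as in (ii), $$x_{ij}=\frac{\operatorname{cdet}_i(\mathbf A^{\sharp}\mathbf A)_{.i}(\mathbf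 d^{\mathbf B}_{.j})}{\det(\mathbf A^{\sharp}\mathbf A)\sum_{\alpha\in I_{r_2,p}}\det((\mathbf B\mathbf B^{\sharp})^{\alpha}_{\alpha})}=\frac{\sum_{\alpha\in I_{r_2,p}\{j\}}\operatorname{rdet}_j\big((\mathbf B\mathbf B^{\sharp})_{j.}(\mathbf d^{\mathbf A}_{i.})\big)^{\alpha}_{\alpha}}{\det(\mathbf A^{\sharp}\mathbf A)\sum_{\alpha\in I_{r_2,p}}\det((\mathbf B\mathbf B^{\sharp})^{\alpha}_{\alpha})}.$$ (iv) If $r_1<n$ and $r_2=p$: with $\mathbf d^{\mathbf B}_{.j}$ defined as in (ii) and $\mathbf d^{\mathbf A}_{i.}$ defined as in (i), $$x_{ij}=\frac{\operatorname{rdet}_j(\mathbf B\mathbf B^{\sharp})_{j.}(\mathbf d^{\mathbf A}_{i.})}{\sum_{\beta\in J_{r_1,n}}\det((\mathbf A^{\sharp}\mathbf A)^{\beta}_{\beta})\det(\mathbf B\mathbf B^{\sharp})}=\frac{\sum_{\beta\in J_{r_1,n}\{i\}}\operatorname{cdet}_i\big((\mathbf A^{\sharp}\mathbf A)_{.i}(\mathbf d^{\mathbf B}_{.j})\big)^{\beta}_{\beta}}{\sum_{\beta\in J_{r_1,n}}\det((\mathbf A^{\sharp}\mathbf A)^{\beta}_{\beta})\det(\mathbf B\mathbf B^{\sharp})}.$$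
   Context: $\mathbb H$ is the real quaternion skew field; $\mathbb H^{m\times n}$ the $m\times n$ quaternion matrices; $\mathrm M(n,\mathbb H)=\mathbb H^{n\times n}$; $\mathbf C^*$ the conjugate transpose; rank is the maximal number of right-linearly independent columns. A square $\mathbf H$ is Hermitian if $\mathbf H^*=\mathbf H$, positive definite if also $\mathbf x^*\mathbf H\mathbf x>0$ for all nonzero $\mathbf x$. For Hermitian positive definite $\mathbf H$, $\mathbf H^{1/2}$ is its unique Hermitian positive definite square root and $\mathbf H^{-1/2}=(\mathbf H^{1/2})^{-1}$. Row and column determinants of $\mathbf C=(c_{ij})\in\mathrm M(n,\mathbb H)$: for $i\in\{1,\dots,n\}$, write each $\sigma\in S_n$ as a product of $r$ disjoint cycles (fixed points included) as $\sigma=(i\,i_{k_1}\,i_{k_1+1}\dots i_{k_1+l_1})(i_{k_2}\dots i_{k_2+l_2})\cdots(i_{k_r}\dots i_{k_r+l_r})$, where the first cycle contains $i$ and starts with $i$, every other cycle starts with its smallest element, and $i_{k_2}<\dots<i_{k_r}$; then $\operatorname{rdet}_i\mathbf C=\sum_{\sigma\in S_n}(-1)^{n-r}(c_{i\,i_{k_1}}c_{i_{k_1}i_{k_1+1}}\cdots c_{i_{k_1+l_1}\,i})\cdots(c_{i_{k_r}i_{k_r+1}}\cdots c_{i_{k_r+l_r}i_{k_r}})$. For $j\in\{1,\dots,n\}$, write each $\tau\in S_n$ as $\tau=(j_{k_r+l_r}\dots j_{k_r+1}j_{k_r})\cdots(j_{k_2+l_2}\dots j_{k_2})(j_{k_1+l_1}\dots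 j_{k_1+1}j_{k_1}\,j)$, where the last cycle contains $j$ and ends with $j$, every other cycle ends with its smallest element, and $j_{k_2}<\dots<j_{k_r}$; then $\operatorname{cdet}_j\mathbf C=\sum_{\tau\in S_n}(-1)^{n-r}(c_{j_{k_r}j_{k_r+l_r}}\cdots c_{j_{k_r+1}j_{k_r}})\cdots(c_{j\,j_{k_1+l_1}}\cdots c_{j_{k_1+1}j_{k_1}}c_{j_{k_1}j})$. For Hermitian $\mathbf C$ all $\operatorname{rdet}_i\mathbf C$ and $\operatorname{cdet}_j\mathbf C$ coincide and are real; this common value is $\det\mathbf C$. Notation: $\mathbf c_{.j}$, $\mathbf c_{i.}$ are the $j$-th column and $i$-th row of $\mathbf C$; $\mathbf C_{.j}(\mathbf b)$ (resp. $\mathbf C_{i.}(\mathbf b)$) is $\mathbf C$ with its $j$-th column (resp. $i$-th row) replaced by $\mathbf b$. $\mathbf C^{\alpha}_{\beta}$ is the submatrix with rows indexed by $\alpha$ and columns by $\beta$. $L_{k,n}$ is the set of strictly increasing sequences of $k$ integers from $\{1,\dots,n\}$; $I_{r,m}\{i\}=\{\alpha\in L_{r,m}: i\in\alpha\}$, $J_{r,n}\{j\}=\{\beta\in L_{r,n}: j\in\beta\}$, and $I_{r,m}=L_{r,m}$, $J_{r,n}=L_{r,n}$. For $i\in\beta$, $\operatorname{cdet}_i(\mathbf C_{.i}(\mathbf b))^{\beta}_{\beta}$ is the column determinant of the square matrix $(\mathbf C_{.i}(\mathbf b))^{\beta}_{\beta}$ with respect to its column corresponding to index $i$; similarly $\operatorname{rdet}_j(\mathbf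 C_{j.}(\mathbf b))^{\alpha}_{\alpha}$ for $j\in\alpha$ with respect to the row corresponding to $j$. Weighted Moore–Penrose inverse: for $\mathbf A\in\mathbb H^{m\times n}$ and Hermitian positive definite $\mathbf M$ (order $m$), $\mathbf N$ (order $n$), $\mathbf A^{\dagger}_{M,N}$ is the unique $\mathbf Y\in\mathbb H^{n\times m}$ with $\mathbf A\mathbf Y\mathbf A=\mathbf A$, $\mathbf Y\mathbf A\mathbf Y=\mathbf Y$, $(\mathbf M\mathbf A\mathbf Y)^*=\mathbf M\mathbf A\mathbf Y$, $(\mathbf N\mathbf Y\mathbf A)^*=\mathbf N\mathbf Y\mathbf A$. Standing setting: $\mathbf A\in\mathbb H^{m\times n}$ of rank $r_1\ge1$, $\mathbf B\in\mathbb H^{p\times q}$ of rank $r_2\ge1$, $\mathbf D\in\mathbb H^{m\times q}$; $\mathbf M,\mathbf N,\mathbf P,\mathbf Q$ Hermitian positive definite of orders $m,n,p,q$. $\mathbf A^{\sharp}=\mathbf N^{-1}\mathbf A^*\mathbf M$, $\mathbf B^{\sharp}=\mathbf Q^{-1}\mathbf B^*\mathbf P$, $\widetilde{\mathbf A}=\mathbf M^{1/2}\mathbf A\mathbf N^{-1/2}$, $\widetilde{\mathbf B}=\mathbf P^{1/2}\mathbf B\mathbf Q^{-1/2}$; $n^{(-1/2)}_{ik}$ are the entries of $\mathbf N^{-1/2}$ and $p^{(1/2)}_{lj}$ those of $\mathbf P^{1/2}$. $\mathbf X=(x_{ij}):=\mathbf A^{\dagger}_{M,N}\mathbf D\mathbf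 B^{\dagger}_{P,Q}\in\mathbb H^{n\times p}$ (this is the unique solution of $\mathbf A\mathbf X\mathbf B=\mathbf D$ under the paper's range restrictions). *)

theory Defs
  imports "Jordan_Normal_Form.Matrix" "HOL-Combinatorics.Permutations"
begin

datatype quat = Quat (qre: real) (qi: real) (qj: real) (qk: real)

lemma quat_eqI: "qre a = qre b \<Longrightarrow> qi a = qi b \<Longrightarrow> qj a = qj b \<Longrightarrow> qk a = qk b \<Longrightarrow> a = b"
  by (cases a; cases b) auto

lemma quat_eq_iff: "a = b \<longleftrightarrow> qre a = qre b \<and> qi a = qi b \<and> qj a = qj b \<and> qk a = qk b"
  by (auto intro: quat_eqI)

instantiation quat :: "{zero, one, plus, minus, uminus, times, inverse}"
begin
definition "0 = Quat 0 0 0 0"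
definition "1 = Quat 1 0 0 0"
definition "a + b = Quat (qre a + qre b) (qi a + qi b) (qj a + qj b) (qk a + qk b)"
definition "a - b = Quat (qre a - qre b) (qi a - qi b) (qj a - qj b) (qk a - qk b)"
definition "- a = Quat (- qre a) (- qi a) (- qj a) (- qk a)"
definition "a * b = Quat
   (qre a * qre b - qi a * qi b - qj a * qj b - qk a * qk b)
   (qre a * qi b + qi a * qre b + qj a * qk b - qk a * qj b)
   (qre a * qj b - qi a * qk b + qj a * qre b + qk a * qi b)
   (qre a * qk b + qi a * qj b - qj a * qi b + qk a * qre b)"
definition "inverse a = (let s = (qre a)\<^sup>2 + (qi a)\<^sup>2 + (qj a)\<^sup>2 + (qk a)\<^sup>2 in
   Quat (qre a / s) (- qi a / s) (- qj a / s) (- qk a / s))"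
definition "divide a b = a * inverse (b::quat)"
instance ..
end

lemmas quat_defs = zero_quat_def one_quat_def plus_quat_def minus_quat_def uminus_quat_def
  times_quat_def inverse_quat_def divide_quat_def

lemma quat_sq_sum_pos: "a \<noteq> 0 \<Longrightarrow> (qre a)\<^sup>2 + (qi a)\<^sup>2 + (qj a)\<^sup>2 + (qk a)\<^sup>2 > 0"
proof -
  assume "a \<noteq> 0"
  then have "qre a \<noteq> 0 \<or> qi a \<noteq> 0 \<or> qj a \<noteq> 0 \<or> qk a \<noteq> 0"
    by (auto simp: quat_eq_iff zero_quat_def)
  then show ?thesis
    by (smt (verit) not_sum_power2_lt_zero power2_less_eq_zero_iff)
qed

instance quat :: division_ring
proof
  fix a b c :: quat
  show "a + b + c = a + (b + c)" by (simp add: quat_defs)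
  show "a + b = b + a" by (simp add: quat_defs)
  show "0 + a = a" by (simp add: quat_defs)
  show "- a + a = 0" by (simp add: quat_defs)
  show "a - b = a + - b" by (simp add: quat_defs)
  show "a * b * c = a * (b * c)" by (simp add: quat_defs algebra_simps)
  show "1 * a = a" by (simp add: quat_defs)
  show "a * 1 = a" by (simp add: quat_defs)
  show "(a + b) * c = a * c + b * c" by (simp add: quat_defs algebra_simps)
  show "a * (b + c) = a * b + a * c" by (simp add: quat_defs algebra_simps)
  show "(0::quat) \<noteq> 1" by (simp add: quat_defs)
  show "inverse (0::quat) = 0" by (simp add: quat_defs Let_def)
  show "a / b = a * inverse b" by (simp add: quat_defs)
next
  fix a :: quat
  assume a: "a \<noteq> 0"
  define s where "s = (qre a)\<^sup>2 + (qi a)\<^sup>2 + (qj a)\<^sup>2 + (qk a)\<^sup>2"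
  have s: "s \<noteq> 0" using quat_sq_sum_pos[OF a] s_def by simp
  obtain w x y z where a_eq: "a = Quat w x y z" by (cases a)
  have s': "s = w*w + x*x + y*y + z*z" by (simp add: s_def a_eq power2_eq_square)
  have s'': "w * w + (x * x + (y * y + z * z)) \<noteq> 0" using s s' by (simp add: add.assoc)
  have inv: "inverse a = Quat (w / s) (- x / s) (- y / s) (- z / s)"
    by (simp add: inverse_quat_def Let_def s_def a_eq)
  show "inverse a * a = 1"
    unfolding inv by (simp add: a_eq times_quat_def one_quat_def s s' algebra_simps) (simp add: s'' add_divide_distrib[symmetric])
  show "a * inverse a = 1"
    unfolding inv by (simp add: a_eq times_quat_def one_quat_def s s' algebra_simps) (simp add: s'' add_divide_distrib[symmetric])
qed

definition qcnj :: "quat \<Rightarrow> quat" where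
  "qcnj a = Quat (qre a) (- qi a) (- qj a) (- qk a)"

definition qreal :: "real \<Rightarrow> quat" where
  "qreal r = Quat r 0 0 0"

definition ctrans :: "quat mat \<Rightarrow> quat mat" where
  "ctrans A = mat (dim_col A) (dim_row A) (\<lambda>(i,j). qcnj (A $$ (j,i)))"

definition hermitian :: "quat mat \<Rightarrow> bool" where
  "hermitian H \<longleftrightarrow> square_mat H \<and> ctrans H = H"

definition hpd :: "nat \<Rightarrow> quat mat \<Rightarrow> bool" where
  "hpd n H \<longleftrightarrow> H \<in> carrier_mat n n \<and> hermitian H \<and>
     (\<forall>x \<in> carrier_mat n 1. x \<noteq> 0\<^sub>m n 1 \<longrightarrow>
        (\<exists>r > 0. ctrans x * H * x = mat 1 1 (\<lambda>_. qreal r)))"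

definition right_indep_cols :: "quat mat \<Rightarrow> nat set \<Rightarrow> bool" where
  "right_indep_cols A S \<longleftrightarrow>
     (\<forall>c :: nat \<Rightarrow> quat. (\<forall>i < dim_row A. (\<Sum>k\<in>S. A $$ (i,k) * c k) = 0) \<longrightarrow> (\<forall>k\<in>S. c k = 0))"

definition qrank :: "quat mat \<Rightarrow> nat" where
  "qrank A = Max {card S | S. S \<subseteq> {0..<dim_col A} \<and> right_indep_cols A S}"

definition qinv :: "nat \<Rightarrow> quat mat \<Rightarrow> quat mat" where
  "qinv n A = (THE Y. Y \<in> carrier_mat n n \<and> A * Y = 1\<^sub>m n \<and> Y * A = 1\<^sub>m n)"

definition wmpi :: "quat mat \<Rightarrow> quat mat \<Rightarrow> quat mat \<Rightarrow> quat mat" where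
  "wmpi A M N = (THE Y. Y \<in> carrier_mat (dim_col A) (dim_row A) \<and>
     A * Y * A = A \<and> Y * A * Y = Y \<and>
     ctrans (M * A * Y) = M * A * Y \<and> ctrans (N * Y * A) = N * Y * A)"

text \<open>Determinants are taken of principal submatrices C^S_S (S a finite set of indices,
  listed increasingly). The matrix is given by its entry function c; permutations of S
  act on the indices themselves, which is an order-preserving relabelling of the
  submatrix, so "smallest element of a cycle" is the same notion.\<close>

definition cyc_len :: "(nat \<Rightarrow> nat) \<Rightarrow> nat \<Rightarrow> nat" where
  "cyc_len \<sigma> x = (LEAST k. 0 < k \<and> (\<sigma> ^^ k) x = x)"

definition orbit_set :: "(nat \<Rightarrow> nat) \<Rightarrow> nat \<Rightarrow> nat set" where
  "orbit_set \<sigma> x = {(\<sigma> ^^ t) x | t. True}"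

definition cyc_prod :: "(nat \<Rightarrow> nat \<Rightarrow> quat) \<Rightarrow> (nat \<Rightarrow> nat) \<Rightarrow> nat \<Rightarrow> quat" where
  "cyc_prod c \<sigma> x = prod_list (map (\<lambda>t. c ((\<sigma> ^^ t) x) ((\<sigma> ^^ Suc t) x)) [0..<cyc_len \<sigma> x])"

definition cyc_leaders :: "nat set \<Rightarrow> (nat \<Rightarrow> nat) \<Rightarrow> nat set" where
  "cyc_leaders S \<sigma> = {s \<in> S. s = Min (orbit_set \<sigma> s)}"

definition rdet_on :: "nat set \<Rightarrow> (nat \<Rightarrow> nat \<Rightarrow> quat) \<Rightarrow> nat \<Rightarrow> quat" where
  "rdet_on S c i = (\<Sum>\<sigma> \<in> {\<sigma>. \<sigma> permutes S}.
     (- 1) ^ (card S - card (cyc_leaders S \<sigma>)) *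
     (cyc_prod c \<sigma> i *
      prod_list (map (cyc_prod c \<sigma>)
        (sorted_list_of_set {s \<in> cyc_leaders S \<sigma>. i \<notin> orbit_set \<sigma> s}))))"

definition cdet_on :: "nat set \<Rightarrow> (nat \<Rightarrow> nat \<Rightarrow> quat) \<Rightarrow> nat \<Rightarrow> quat" where
  "cdet_on S c j = (\<Sum>\<tau> \<in> {\<tau>. \<tau> permutes S}.
     (- 1) ^ (card S - card (cyc_leaders S \<tau>)) *
     (prod_list (map (cyc_prod c \<tau>)
        (rev (sorted_list_of_set {s \<in> cyc_leaders S \<tau>. j \<notin> orbit_set \<tau> s}))) *
      cyc_prod c \<tau> j))"

text \<open>Determinant of a Hermitian (principal sub)matrix: the common value of all
  row/column determinants; we take the row determinant w.r.t. the first index.\<close>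
definition hdet_on :: "nat set \<Rightarrow> (nat \<Rightarrow> nat \<Rightarrow> quat) \<Rightarrow> quat" where
  "hdet_on S c = rdet_on S c (Min S)"

definition ent :: "quat mat \<Rightarrow> nat \<Rightarrow> nat \<Rightarrow> quat" where
  "ent C r s = C $$ (r,s)"

definition row_repl :: "quat mat \<Rightarrow> nat \<Rightarrow> (nat \<Rightarrow> quat) \<Rightarrow> nat \<Rightarrow> nat \<Rightarrow> quat" where
  "row_repl C j b r s = (if r = j then b s else C $$ (r,s))"

definition col_repl :: "quat mat \<Rightarrow> nat \<Rightarrow> (nat \<Rightarrow> quat) \<Rightarrow> nat \<Rightarrow> nat \<Rightarrow> quat" where
  "col_repl C i b r s = (if s = i then b r else C $$ (r,s))"

definition idx_sets :: "nat \<Rightarrow> nat \<Rightarrow> nat set set" where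
  "idx_sets r n = {\<beta>. \<beta> \<subseteq> {0..<n} \<and> card \<beta> = r}"

definition idx_sets_with :: "nat \<Rightarrow> nat \<Rightarrow> nat \<Rightarrow> nat set set" where
  "idx_sets_with r n i = {\<beta>. \<beta> \<subseteq> {0..<n} \<and> card \<beta> = r \<and> i \<in> \<beta>}"

end

theory Submission
  imports Defs "HOL-Combinatorics.Cycles"
begin

text \<open>
  For a Hermitian matrix H, reversing a cycle of a permutation conjugates its cycle product. Hence
  in a column determinant along column i every cycle avoiding i may be replaced by its real part,
  and the order of the cycles becomes irrelevant. Joining and splitting cycles by a transposition
  then gives the column expansion of a principal minor. Summed over all principal minors of order s
  it reads K (s + 1) + K s H = d s I, where d s is the sum of the principal minors of order s and
  K s collects their cofactors, embedded in order n; moreover K s H has trace s d s.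

  Let r be the largest index with d r nonzero. As H is Hermitian, the recursion forces
  K (r + 1) H = 0, so K r H / d r is the orthogonal projection onto the range of H, and comparing
  traces identifies r with the rank. With H = A\<sharp>A (respectively BB\<sharp>) the matrix
  K r A\<sharp> / d r (respectively B\<sharp> K r / d r) satisfies the equations of the weighted
  Moore-Penrose inverse, and the entries of the product with D are the stated quotients.
\<close>

subsection \<open>Quaternions\<close>

text \<open>The obstacle is that no multiplicative determinant is at hand: a column determinant
  depends on the order of its cycles and on the points where they are cut open. What can be saved,
  when H is Hermitian and its column i is replaced by an arbitrary vector, are three facts about
  that column: right linearity, vanishing when it equals another column, and the expansion of a unit
  column. They suffice for the recursion, whose shape comes from the commutative case. There K s is
  the coefficient of t^(n-s) in the adjugate of tI + H and d s that of t^(n-s) in its determinant;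
  comparing coefficients in adj(tI + H) (tI + H) = det(tI + H) I is the Faddeev-LeVerrier scheme.
  The recursion makes every K s a polynomial in H with real coefficients. This is why an ordinary
  orthogonal projection can serve two weighted inner products: A\<sharp>A is Hermitian, and so is N
  A\<sharp>A = A* M A, hence N commutes with A\<sharp>A and with every K s. The same holds for P and
  BB\<sharp>.\<close>

lemma qreal_simps [simp]:
  "qreal 0 = 0" "qreal 1 = 1" "qreal (a + b) = qreal a + qreal b"
  "qreal (a - b) = qreal a - qreal b" "qreal (- a) = - qreal a"
  "qreal (a * b) = qreal a * qreal b"
  by (auto simp: qreal_def quat_defs)

lemma qreal_commute: "x * qreal a = qreal a * x"
  by (auto simp: qreal_def quat_defs mult.commute)

lemma qreal_eq_0_iff [simp]: "qreal a = 0 \<longleftrightarrow> a = 0"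
  by (auto simp: qreal_def quat_defs)

lemma inverse_qreal: "inverse (qreal a) = qreal (inverse a)"
  by (cases "a = 0") (auto simp: qreal_def inverse_quat_def Let_def power2_eq_square divide_simps zero_quat_def)

lemma qreal_sum: "qreal (sum f A) = (\<Sum>x\<in>A. qreal (f x))"
  by (induction A rule: infinite_finite_induct) auto

lemma qreal_power: "qreal (a ^ n) = qreal a ^ n"
  by (induction n) auto

lemma qcnj_simps [simp]:
  "qcnj 0 = 0" "qcnj 1 = 1" "qcnj (x + y) = qcnj x + qcnj y" "qcnj (x - y) = qcnj x - qcnj y"
  "qcnj (- x) = - qcnj x" "qcnj (x * y) = qcnj y * qcnj x" "qcnj (qcnj x) = x"
  "qcnj (qreal a) = qreal a"
  by (auto simp: qcnj_def qreal_def quat_defs algebra_simps)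

lemma qcnj_eq_iff [simp]: "qcnj x = qcnj y \<longleftrightarrow> x = y"
  by (metis qcnj_simps(7))

lemma qcnj_sum: "qcnj (sum f A) = (\<Sum>x\<in>A. qcnj (f x))"
  by (induction A rule: infinite_finite_induct) auto

lemma qcnj_power: "qcnj (x ^ n) = qcnj x ^ n"
  by (induction n) (auto simp: power_commutes)

lemma qcnj_prod_list: "qcnj (prod_list xs) = prod_list (map qcnj (rev xs))"
  by (induction xs) auto

lemma qre_simps [simp]:
  "qre 0 = 0" "qre 1 = 1" "qre (x + y) = qre x + qre y" "qre (x - y) = qre x - qre y"
  "qre (- x) = - qre x" "qre (qreal a) = a" "qre (qreal a * x) = a * qre x" "qre (qcnj x) = qre x"
  by (auto simp: qcnj_def qreal_def quat_defs)

lemma qre_sum: "qre (sum f A) = (\<Sum>x\<in>A. qre (f x))"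
  by (induction A rule: infinite_finite_induct) auto

text \<open>This trace property is the substitute for commutativity. It makes the real part of a
  cycle product independent of the starting point, and the real part of a matrix trace invariant
  under cyclic exchange.\<close>

lemma qre_mult_commute: "qre (x * y) = qre (y * x)"
  by (auto simp: quat_defs)

lemma qre_cnj_mult_nonneg: "qre (qcnj x * x) \<ge> 0"
  by (auto simp: qcnj_def quat_defs)

lemma qre_cnj_mult_eq_0_iff: "qre (qcnj x * x) = 0 \<longleftrightarrow> x = 0"
  using quat_sq_sum_pos[of x]
  by (cases "x = 0") (auto simp: qcnj_def times_quat_def power2_eq_square zero_quat_def)

text \<open>The right-hand side is left as two equal terms, to match a pair of permutations each of
  which is to receive the real part.\<close>

lemma add_qcnj: "x + qcnj x = qreal (qre x) + qreal (qre x)"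
  by (auto simp: qcnj_def qreal_def quat_defs)

subsection \<open>Cycles as lists\<close>

text \<open>A cycle cut open: \<open>z\<close> is the target of the last edge and stays outside the
  list. A closed cycle is the case \<open>z = hd xs\<close>, and joining two cycles becomes
  appending their lists with exchanged end points.\<close>

fun is_path :: "(nat \<Rightarrow> nat) \<Rightarrow> nat list \<Rightarrow> nat \<Rightarrow> bool" where
  "is_path f [] z = True"
| "is_path f [x] z = (f x = z)"
| "is_path f (x # y # xs) z = (f x = y \<and> is_path f (y # xs) z)"

fun path_prod :: "(nat \<Rightarrow> nat \<Rightarrow> quat) \<Rightarrow> nat list \<Rightarrow> nat \<Rightarrow> quat" where
  "path_prod c [] z = 1"
| "path_prod c [x] z = c x z"
| "path_prod c (x # y # xs) z = c x y * path_prod c (y # xs) z"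

definition cyc_list :: "(nat \<Rightarrow> nat) \<Rightarrow> nat \<Rightarrow> nat list" where
  "cyc_list f x = map (\<lambda>t. (f ^^ t) x) [0..<cyc_len f x]"

lemma is_path_append:
  "ys \<noteq> [] \<Longrightarrow> is_path f (xs @ ys) z \<longleftrightarrow> is_path f xs (hd ys) \<and> is_path f ys z"
  by (induction f xs z rule: is_path.induct) (auto simp: neq_Nil_conv)

lemma path_prod_append:
  "ys \<noteq> [] \<Longrightarrow> path_prod c (xs @ ys) z = path_prod c xs (hd ys) * path_prod c ys z"
  by (induction c xs z rule: path_prod.induct) (auto simp: neq_Nil_conv mult.assoc)

lemma is_path_cong:
  assumes "is_path f xs z" "\<And>x. x \<in> set xs \<Longrightarrow> f x = g x"
  shows "is_path g xs z"
  using assms by (induction f xs z rule: is_path.induct) auto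

lemma path_prod_cong:
  assumes "\<And>x y. x \<in> set xs \<Longrightarrow> y \<in> insert z (set xs) \<Longrightarrow> c x y = c' x y"
  shows "path_prod c xs z = path_prod c' xs z"
  using assms by (induction c xs z rule: path_prod.induct) auto

text \<open>The end point and the head exchange roles. On a closed path, where \<open>z = x\<close>,
  the cycle is run backwards from the same starting point.\<close>

lemma is_path_rev:
  assumes "is_path f (x # xs) z" "\<And>x. g (f x) = x"
  shows "is_path g (z # rev xs) x"
  using assms by (induction f "x # xs" z arbitrary: x xs rule: is_path.induct)
    (auto simp: is_path_append simp flip: append_Cons)

lemma path_prod_rev:
  "qcnj (path_prod c (x # xs) z) = path_prod (\<lambda>a b. qcnj (c b a)) (z # rev xs) x"
  by (induction c "x # xs" z arbitrary: x xs rule: path_prod.induct)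
    (auto simp: path_prod_append simp flip: append_Cons)

lemma is_path_map_funpow:
  "is_path f (map (\<lambda>t. (f ^^ t) x) [a..<b]) ((f ^^ b) x)"
proof (induction "b - a" arbitrary: a)
  case (Suc k)
  show ?case
  proof (cases "Suc a < b")
    case True
    then have "[a..<b] = a # Suc a # [Suc (Suc a)..<b]" by (simp add: upt_conv_Cons)
    moreover have "[Suc a..<b] = Suc a # [Suc (Suc a)..<b]" using True by (simp add: upt_conv_Cons)
    ultimately show ?thesis using Suc(1)[of "Suc a"] Suc(2) by simp
  next
    case False
    then have "b = Suc a" using Suc(2) by simp
    then show ?thesis by simp
  qed
qed simp

lemma path_prod_map_funpow:
  "path_prod c (map (\<lambda>t. (f ^^ t) x) [a..<b]) ((f ^^ b) x)
     = prod_list (map (\<lambda>t. c ((f ^^ t) x) ((f ^^ Suc t) x)) [a..<b])"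
proof (induction "b - a" arbitrary: a)
  case (Suc k)
  show ?case
  proof (cases "Suc a < b")
    case True
    then have "[a..<b] = a # Suc a # [Suc (Suc a)..<b]" by (simp add: upt_conv_Cons)
    moreover have "[Suc a..<b] = Suc a # [Suc (Suc a)..<b]" using True by (simp add: upt_conv_Cons)
    ultimately show ?thesis using Suc(1)[of "Suc a"] Suc(2) by simp
  next
    case False
    then have "b = Suc a" using Suc(2) by simp
    then show ?thesis by simp
  qed
qed simp

lemma is_path_funpow:
  assumes "is_path f xs z"
  shows "t < length xs \<Longrightarrow> xs ! t = (f ^^ t) (hd xs)"
    and "xs \<noteq> [] \<Longrightarrow> (f ^^ length xs) (hd xs) = z"
proof -
  show "t < length xs \<Longrightarrow> xs ! t = (f ^^ t) (hd xs)"
    using assms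
    by (induction f xs z arbitrary: t rule: is_path.induct)
      (auto simp: nth_Cons funpow_swap1 split: nat.splits)
  show "xs \<noteq> [] \<Longrightarrow> (f ^^ length xs) (hd xs) = z"
    using assms by (induction f xs z rule: is_path.induct) (auto simp: funpow_swap1)
qed

text \<open>The cycles of a modified permutation are computed below by exhibiting a closed path
  without repetitions, so that least periods need not be discussed again.\<close>

lemma cyc_listI:
  assumes "is_path f xs (hd xs)" "distinct xs" "xs \<noteq> []"
  shows "cyc_list f (hd xs) = xs"
proof -
  note fp = is_path_funpow[OF assms(1)]
  have "cyc_len f (hd xs) = length xs"
    unfolding cyc_len_def
  proof (rule Least_equality)
    fix k assume k: "0 < k \<and> (f ^^ k) (hd xs) = hd xs"
    show "length xs \<le> k"
    proof (rule ccontr)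
      assume kl: "\<not> length xs \<le> k"
      then have "xs ! k = xs ! 0" using k fp(1)[of k] assms(3) by (simp add: hd_conv_nth)
      then show False using kl k assms(2,3) by (simp add: nth_eq_iff_index_eq)
    qed
  qed (use fp(2) assms(3) in auto)
  then show ?thesis
    unfolding cyc_list_def using fp(1) by (auto intro: nth_equalityI)
qed

lemma self_in_orbit_set [simp]: "x \<in> orbit_set f x"
  unfolding orbit_set_def by (auto intro: exI[of _ 0])

context
  fixes S :: "nat set" and f :: "nat \<Rightarrow> nat"
  assumes fin: "finite S" and per: "f permutes S"
begin

text \<open>Some positive power of a finite permutation is the identity, so the \<open>LEAST\<close>
  in \<open>cyc_len\<close> is attained.\<close>

lemma cyc_len_props: "0 < cyc_len f x \<and> (f ^^ cyc_len f x) x = x"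
proof -
  have "permutation f" using per fin permutation_permutes by blast
  then obtain k where "f ^^ k = id" "k > 0" by (rule permutation_is_nilpotent)
  then show ?thesis 
    unfolding cyc_len_def using LeastI[of "\<lambda>k. 0 < k \<and> (f ^^ k) x = x" k] by simp
qed

lemma cyc_list_ne [simp]: "cyc_list f x \<noteq> []"
  using cyc_len_props by (simp add: cyc_list_def)

lemma hd_cyc_list [simp]: "hd (cyc_list f x) = x"
  using cyc_len_props[of x] by (simp add: cyc_list_def hd_conv_nth)

lemma is_path_cyc_list: "is_path f (cyc_list f x) x"
  using is_path_map_funpow[of f x 0 "cyc_len f x"] cyc_len_props[of x]
  by (simp add: cyc_list_def)

lemma cyc_prod_path: "cyc_prod c f x = path_prod c (cyc_list f x) x"
  using path_prod_map_funpow[of c f x 0 "cyc_len f x"] cyc_len_props[of x]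
  by (simp add: cyc_list_def cyc_prod_def)

lemma inj_funpow: "inj (f ^^ t)"
  using per permutes_inj by (metis inj_fn)

lemma distinct_cyc_list: "distinct (cyc_list f x)"
proof -
  have "False" if "s < t" "t < cyc_len f x" "(f ^^ s) x = (f ^^ t) x" for s t
  proof -
    have "(f ^^ s) x = (f ^^ s) ((f ^^ (t - s)) x)"
      using that by (metis funpow_add comp_apply le_add_diff_inverse less_imp_le)
    then have "(f ^^ (t - s)) x = x" using inj_funpow[of s] by (metis injD)
    then have "cyc_len f x \<le> t - s" unfolding cyc_len_def using that by (intro Least_le) auto
    then show False using that by simp
  qed
  then have "inj_on (\<lambda>t. (f ^^ t) x) {0..<cyc_len f x}"
    by (intro linorder_inj_onI') (metis atLeastLessThan_iff)
  then show ?thesis by (simp add: cyc_list_def distinct_map)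
qed

lemma orbit_set_cyc_list: "orbit_set f x = set (cyc_list f x)"
proof -
  have "(f ^^ t) x \<in> set (cyc_list f x)" for t
  proof -
    have "(f ^^ t) x = (f ^^ (t mod cyc_len f x)) x"
      using cyc_len_props by (metis funpow_mod_eq)
    then show ?thesis using cyc_len_props[of x] by (auto simp: cyc_list_def)
  qed
  then show ?thesis by (auto simp: orbit_set_def cyc_list_def)
qed

lemma finite_orbit_set [simp]: "finite (orbit_set f x)"
  by (simp add: orbit_set_cyc_list)

lemma cyc_list_rotate:
  assumes "cyc_list f x = xs @ ys" "ys \<noteq> []"
  shows "cyc_list f (hd ys) = ys @ xs"
proof (cases "xs = []")
  case True
  then show ?thesis using assms by (metis append_Nil append_Nil2 hd_cyc_list)
next
  case False
  then have hx: "hd xs = x" using assms by (metis hd_append2 hd_cyc_list)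
  have "is_path f (ys @ xs) (hd ys)"
    using is_path_cyc_list[of x] assms False hx by (simp add: is_path_append)
  moreover have "distinct (ys @ xs)" using distinct_cyc_list[of x] assms by auto
  ultimately show ?thesis using cyc_listI[of f "ys @ xs"] assms by simp
qed

text \<open>Cutting a cycle open at another point exchanges two factors of its product. This may
  change the value, but not the real part.\<close>

lemma orbit_set_eqI:
  assumes "y \<in> orbit_set f x"
  shows "orbit_set f y = orbit_set f x"
    and "qre (cyc_prod c f y) = qre (cyc_prod c f x)"
proof -
  obtain xs ys where s: "cyc_list f x = xs @ y # ys"
    using assms unfolding orbit_set_cyc_list by (meson split_list)
  have r: "cyc_list f y = y # ys @ xs" using cyc_list_rotate[OF s] by simp
  show "orbit_set f y = orbit_set f x" unfolding orbit_set_cyc_list s r by auto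
  show "qre (cyc_prod c f y) = qre (cyc_prod c f x)"
  proof (cases "xs = []")
    case True
    then show ?thesis using s by (metis append_Nil hd_cyc_list list.sel(1))
  next
    case False
    then have hx: "hd xs = x" using s by (metis hd_append2 hd_cyc_list)
    have "cyc_prod c f y = path_prod c (y # ys) x * path_prod c xs y"
      unfolding cyc_prod_path r using path_prod_append[OF False, of c "y # ys"] hx by simp
    moreover have "cyc_prod c f x = path_prod c xs y * path_prod c (y # ys) x"
      unfolding cyc_prod_path s by (simp add: path_prod_append)
    ultimately show ?thesis by (simp add: qre_mult_commute)
  qed
qed

lemma orbit_set_subset: "x \<in> S \<Longrightarrow> orbit_set f x \<subseteq> S"
  unfolding orbit_set_def using permutes_in_funpow_image[OF per] by blast

lemma image_in_orbit_set: "f y \<in> orbit_set f x \<longleftrightarrow> y \<in> orbit_set f x"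
proof -
  have "f y \<in> orbit_set f y" unfolding orbit_set_def by (auto intro: exI[of _ 1])
  then show ?thesis using orbit_set_eqI(1)[of "f y" y] orbit_set_eqI(1)[of y x] orbit_set_eqI(1)[of "f y" x]
    self_in_orbit_set by metis
qed

end

subsection \<open>Reversing cycles\<close>

text \<open>Meant for sets \<open>T\<close> that are unions of cycles of \<open>f\<close>: the
  cycles inside \<open>T\<close> are reversed, the others kept. A single orbit reverses one cycle,
  and \<open>UNIV\<close> gives the inverse permutation.\<close>

definition rev_on :: "(nat \<Rightarrow> nat) \<Rightarrow> nat set \<Rightarrow> nat \<Rightarrow> nat" where
  "rev_on f T y = (if y \<in> T then Hilbert_Choice.inv f y else f y)"

definition herm_on :: "nat set \<Rightarrow> (nat \<Rightarrow> nat \<Rightarrow> quat) \<Rightarrow> bool" where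
  "herm_on T c \<longleftrightarrow> (\<forall>a\<in>T. \<forall>b\<in>T. c a b = qcnj (c b a))"

text \<open>Orbits take the place of cycle leaders: once cycle products are replaced by real parts,
  neither the starting points nor the order of the cycles matters.\<close>

definition orbs :: "nat set \<Rightarrow> (nat \<Rightarrow> nat) \<Rightarrow> nat set set" where
  "orbs S f = orbit_set f ` S"

definition osign :: "nat set \<Rightarrow> (nat \<Rightarrow> nat) \<Rightarrow> real" where
  "osign S f = (- 1) ^ (card S - card (orbs S f))"

definition oval :: "(nat \<Rightarrow> nat \<Rightarrow> quat) \<Rightarrow> (nat \<Rightarrow> nat) \<Rightarrow> nat set \<Rightarrow> real" where
  "oval c f T = qre (cyc_prod c f (Min T))"

lemma cyc_prod_cong:
  assumes "finite S" "f permutes S"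
    and "\<And>a b. a \<in> orbit_set f x \<Longrightarrow> b \<in> orbit_set f x \<Longrightarrow> c a b = c' a b"
  shows "cyc_prod c f x = cyc_prod c' f x"
  unfolding cyc_prod_path[OF assms(1,2)]
proof (rule path_prod_cong)
  fix a b assume "a \<in> set (cyc_list f x)" "b \<in> insert x (set (cyc_list f x))"
  then show "c a b = c' a b"
    using assms(3)[of a b] self_in_orbit_set[of x f] orbit_set_cyc_list[OF assms(1,2), of x] by auto
qed

context
  fixes S :: "nat set" and f :: "nat \<Rightarrow> nat" and T :: "nat set"
  assumes fin: "finite S" and per: "f permutes S"
    and inva: "\<And>y. f y \<in> T \<longleftrightarrow> y \<in> T"
begin

lemma inv_in_invariant: "Hilbert_Choice.inv f y \<in> T \<longleftrightarrow> y \<in> T"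
  using inva[of "Hilbert_Choice.inv f y"] permutes_inverses[OF per] by simp

lemma orbit_set_in_invariant: "y \<in> orbit_set f x \<Longrightarrow> y \<in> T \<longleftrightarrow> x \<in> T"
proof -
  have "(f ^^ t) x \<in> T \<longleftrightarrow> x \<in> T" for t by (induction t) (auto simp: inva)
  then show "y \<in> orbit_set f x \<Longrightarrow> y \<in> T \<longleftrightarrow> x \<in> T" by (auto simp: orbit_set_def)
qed

lemma rev_on_inverse:
  "rev_on f T (if y \<in> T then f y else Hilbert_Choice.inv f y) = y"
  "(if rev_on f T y \<in> T then f (rev_on f T y) else Hilbert_Choice.inv f (rev_on f T y)) = y"
  using inv_in_invariant[of y] inva[of y] permutes_inverses[OF per] by (auto simp: rev_on_def)

lemma rev_on_permutes: "rev_on f T permutes S"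
  unfolding permutes_def
proof (intro conjI allI impI)
  fix x assume "x \<notin> S"
  then show "rev_on f T x = x"
    by (simp add: rev_on_def permutes_not_in[OF per] permutes_not_in[OF permutes_inv[OF per]])
next
  fix y
  show "\<exists>!x. rev_on f T x = y"
  proof (rule ex1I[of _ "if y \<in> T then f y else Hilbert_Choice.inv f y"], rule rev_on_inverse(1))
    fix x assume eq: "rev_on f T x = y"
    show "x = (if y \<in> T then f y else Hilbert_Choice.inv f y)"
      using rev_on_inverse(2)[of x] unfolding eq by (rule sym)
  qed
qed

lemma rev_on_rev_on: "rev_on (rev_on f T) T = f"
proof
  fix y
  have "Hilbert_Choice.inv (rev_on f T) y = f y" if "y \<in> T"
    using that rev_on_inverse(1)[of y] by (simp add: permutes_inv_eq[OF rev_on_permutes])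
  then show "rev_on (rev_on f T) T y = f y" by (simp add: rev_on_def)
qed

lemma cyc_list_rev_on:
  "cyc_list (rev_on f T) x = (if x \<in> T then x # rev (tl (cyc_list f x)) else cyc_list f x)"
proof -
  obtain xs where xs: "cyc_list f x = x # xs"
    using cyc_list_ne[OF fin per] hd_cyc_list[OF fin per] by (metis list.exhaust_sel)
  have p: "is_path f (x # xs) x" using is_path_cyc_list[OF fin per, of x] xs by simp
  have d: "distinct (x # xs)" using distinct_cyc_list[OF fin per, of x] xs by simp
  have o: "y \<in> T \<longleftrightarrow> x \<in> T" if "y \<in> set (x # xs)" for y
    using that orbit_set_in_invariant[of y x] orbit_set_cyc_list[OF fin per, of x] xs by simp
  show ?thesis
  proof (cases "x \<in> T")
    case True
    have "is_path (Hilbert_Choice.inv f) (x # rev xs) x" by (rule is_path_rev[OF p]) (simp add: permutes_inverses[OF per])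
    then have "is_path (rev_on f T) (x # rev xs) x"
      by (rule is_path_cong) (use o True in \<open>auto simp: rev_on_def\<close>)
    then show ?thesis using cyc_listI[of "rev_on f T" "x # rev xs"] d True xs by simp
  next
    case False
    have "is_path (rev_on f T) (x # xs) x"
      by (rule is_path_cong[OF p]) (use o False in \<open>auto simp: rev_on_def\<close>)
    then show ?thesis using cyc_listI[of "rev_on f T" "x # xs"] d False xs by simp
  qed
qed

lemma orbit_set_rev_on [simp]: "orbit_set (rev_on f T) x = orbit_set f x"
proof -
  have "set (cyc_list f x) = insert x (set (tl (cyc_list f x)))"
    using cyc_list_ne[OF fin per] hd_cyc_list[OF fin per] by (metis list.exhaust_sel list.simps(15))
  then show ?thesis
    by (simp add: orbit_set_cyc_list[OF fin per] orbit_set_cyc_list[OF fin rev_on_permutes] cyc_list_rev_on)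
qed

text \<open>Stated with conjugate transposed entries so as to serve twice: for Hermitian entries
  reversal is conjugation of the cycle product, and for \<open>T = UNIV\<close> it relates row and
  column determinants.\<close>

lemma cyc_prod_rev_on:
  "cyc_prod c (rev_on f T) x =
     (if x \<in> T then qcnj (cyc_prod (\<lambda>a b. qcnj (c b a)) f x) else cyc_prod c f x)"
proof -
  obtain xs where xs: "cyc_list f x = x # xs"
    using cyc_list_ne[OF fin per] hd_cyc_list[OF fin per] by (metis list.exhaust_sel)
  show ?thesis
    using path_prod_rev[of "\<lambda>a b. qcnj (c b a)" x xs x]
    by (simp add: cyc_prod_path[OF fin per] cyc_prod_path[OF fin rev_on_permutes] cyc_list_rev_on xs)
qed

end

lemma rev_on_UNIV: "rev_on f UNIV = Hilbert_Choice.inv f"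
  by (auto simp: rev_on_def)

text \<open>The averaging principle. Reindexing along \<open>h\<close> doubles both sums, fixed
  points of \<open>h\<close> included, and halving is done in each real coordinate.\<close>

lemma sum_eq_by_involution:
  fixes u v :: "'a \<Rightarrow> quat"
  assumes "\<And>x. x \<in> A \<Longrightarrow> h x \<in> A" "\<And>x. x \<in> A \<Longrightarrow> h (h x) = x"
    and eq: "\<And>x. x \<in> A \<Longrightarrow> u x + u (h x) = v x + v (h x)"
  shows "sum u A = sum v A"
proof -
  have h: "(\<Sum>x\<in>A. w (h x)) = sum w A" for w :: "'a \<Rightarrow> quat"
    by (rule sum.reindex_bij_witness[of _ h h]) (use assms in auto)
  have "sum u A + sum u A = (\<Sum>x\<in>A. u x + u (h x))" by (simp add: sum.distrib h)
  also have "\<dots> = (\<Sum>x\<in>A. v x + v (h x))" using eq by (rule sum.cong[OF refl])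
  also have "\<dots> = sum v A + sum v A" by (simp add: sum.distrib h)
  finally show ?thesis by (auto simp: quat_eq_iff plus_quat_def)
qed

lemma prod_list_qreal: "prod_list (map (\<lambda>x. qreal (h x)) xs) = qreal (prod_list (map h xs))"
  by (induction xs) auto

context
  fixes S :: "nat set" and f :: "nat \<Rightarrow> nat"
  assumes fin: "finite S" and per: "f permutes S"
begin

lemma bij_betw_leaders_orbs: "bij_betw (orbit_set f) (cyc_leaders S f) (orbs S f)"
proof (rule bij_betwI')
  fix x y assume "x \<in> cyc_leaders S f" "y \<in> cyc_leaders S f"
  then show "orbit_set f x = orbit_set f y \<longleftrightarrow> x = y" by (auto simp: cyc_leaders_def)
next
  fix T assume "T \<in> orbs S f"
  then obtain x where x: "x \<in> S" "T = orbit_set f x" by (auto simp: orbs_def)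
  have m: "Min T \<in> orbit_set f x"
    using x finite_orbit_set[OF fin per] self_in_orbit_set by (metis Min_in empty_iff)
  then have "orbit_set f (Min T) = T" using orbit_set_eqI(1)[OF fin per] x by simp
  moreover have "Min T \<in> S" using m orbit_set_subset[OF fin per] x by blast
  ultimately show "\<exists>x\<in>cyc_leaders S f. T = orbit_set f x"
    by (auto simp: cyc_leaders_def intro!: bexI[of _ "Min T"])
qed (auto simp: cyc_leaders_def orbs_def)

lemma card_leaders: "card (cyc_leaders S f) = card (orbs S f)"
  using bij_betw_leaders_orbs by (rule bij_betw_same_card)

lemma oval_eq: "T \<in> orbs S f \<Longrightarrow> x \<in> T \<Longrightarrow> oval c f T = qre (cyc_prod c f x)"
proof -
  assume "T \<in> orbs S f" "x \<in> T"
  then have T: "T = orbit_set f x" using orbit_set_eqI(1)[OF fin per] by (auto simp: orbs_def)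
  have "Min T \<in> orbit_set f x"
    using T finite_orbit_set[OF fin per] self_in_orbit_set by (metis Min_in empty_iff)
  then show ?thesis unfolding oval_def by (rule orbit_set_eqI(2)[OF fin per])
qed

lemma prod_leaders:
  "(\<Prod>s\<in>{s \<in> cyc_leaders S f. i \<notin> orbit_set f s}. qre (cyc_prod c f s))
     = (\<Prod>T\<in>{T \<in> orbs S f. i \<notin> T}. oval c f T)"
proof -
  have "bij_betw (orbit_set f) {s \<in> cyc_leaders S f. i \<notin> orbit_set f s} {T \<in> orbs S f. i \<notin> T}"
  proof (rule bij_betw_imageI)
    show "inj_on (orbit_set f) {s \<in> cyc_leaders S f. i \<notin> orbit_set f s}"
      using bij_betw_leaders_orbs by (auto simp: bij_betw_def intro: inj_on_subset)
    have "orbs S f = orbit_set f ` cyc_leaders S f"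
      using bij_betw_leaders_orbs by (simp add: bij_betw_def)
    then show "orbit_set f ` {s \<in> cyc_leaders S f. i \<notin> orbit_set f s} = {T \<in> orbs S f. i \<notin> T}"
      by blast
  qed
  then have "(\<Prod>T\<in>{T \<in> orbs S f. i \<notin> T}. oval c f T)
      = (\<Prod>s\<in>{s \<in> cyc_leaders S f. i \<notin> orbit_set f s}. oval c f (orbit_set f s))"
    by (rule prod.reindex_bij_betw[symmetric])
  also have "\<dots> = (\<Prod>s\<in>{s \<in> cyc_leaders S f. i \<notin> orbit_set f s}. qre (cyc_prod c f s))"
    by (rule prod.cong[OF refl]) (simp add: oval_def cyc_leaders_def)
  finally show ?thesis by (rule sym)
qed

end

text \<open>Reversing a cycle conjugates its product, so averaging over the reversals replaces the
  product of every cycle that avoids the index i by its real part.\<close>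

lemma cdet_on_real_parts_leaders:
  assumes fin: "finite S" and i: "i \<in> S" and herm: "herm_on (S - {i}) c"
  shows "cdet_on S c i = (\<Sum>f | f permutes S. qreal ((- 1) ^ (card S - card (cyc_leaders S f)) *
      (\<Prod>s\<in>{s \<in> cyc_leaders S f. i \<notin> orbit_set f s}. qre (cyc_prod c f s))) * cyc_prod c f i)"
proof -
  define L where "L f = {s \<in> cyc_leaders S f. i \<notin> orbit_set f s}" for f
  \<comment> \<open>The cycles are treated one at a time: \<open>g m\<close> takes real parts at
    leaders below \<open>m\<close>, so passing from \<open>m\<close> to \<open>Suc m\<close> affects
    only the cycle led by \<open>m\<close>.\<close>
  define g where "g m f s = (if s < m then qreal (qre (cyc_prod c f s)) else cyc_prod c f s)"
    for m :: nat and f s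
  define e :: "(nat \<Rightarrow> nat) \<Rightarrow> quat" where "e f = (- 1) ^ (card S - card (cyc_leaders S f))" for f
  define F where "F m f = e f * (prod_list (map (g m f) (rev (sorted_list_of_set (L f)))) * cyc_prod c f i)"
    for m f
  have finL: "finite (L f)" for f using fin by (auto simp: L_def cyc_leaders_def)
  have step: "(\<Sum>f | f permutes S. F m f) = (\<Sum>f | f permutes S. F (Suc m) f)" for m
  proof (rule sum_eq_by_involution)
    fix f assume "f \<in> {f. f permutes S}"
    then have per: "f permutes S" by simp
    define h where "h f = (if m \<in> L f then rev_on f (orbit_set f m) else f)" for f
    note inva = image_in_orbit_set[OF fin per, of _ m]
    have per': "h f permutes S" using rev_on_permutes[OF fin per inva] per by (simp add: h_def)
    then show "h f \<in> {f. f permutes S}" by simp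
    have orb: "orbit_set (h f) = orbit_set f"
      using orbit_set_rev_on[OF fin per inva] by (auto simp: h_def)
    then have lead: "cyc_leaders S (h f) = cyc_leaders S f" by (simp add: cyc_leaders_def)
    have Lh: "L (h f) = L f" by (simp add: L_def lead orb)
    show "h (h f) = f"
      using rev_on_rev_on[OF fin per inva] orb Lh by (auto simp: h_def split: if_splits)
    show "F m f + F m (h f) = F (Suc m) f + F (Suc m) (h f)"
    proof (cases "m \<in> L f")
      case False
      have "map (g m f) (rev (sorted_list_of_set (L f))) = map (g (Suc m) f) (rev (sorted_list_of_set (L f)))"
        using False finL by (auto simp: g_def less_Suc_eq)
      then have "F m f = F (Suc m) f" unfolding F_def by (rule arg_cong)
      then show ?thesis using False by (simp add: h_def)
    next
      case True
      then have hf: "h f = rev_on f (orbit_set f m)" by (simp add: h_def)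
      have mS: "m \<in> S" "i \<notin> orbit_set f m" using True by (auto simp: L_def cyc_leaders_def)
      obtain ys zs where l: "rev (sorted_list_of_set (L f)) = ys @ m # zs"
        using True finL split_list[of m "rev (sorted_list_of_set (L f))"] by auto
      have dl: "distinct (ys @ m # zs)" unfolding l[symmetric] by simp
      have sl: "set (ys @ m # zs) = L f" unfolding l[symmetric] using finL by simp
      have cp: "cyc_prod c (h f) s = cyc_prod c f s" if "s \<notin> orbit_set f m" for s
        unfolding hf using that by (simp add: cyc_prod_rev_on[OF fin per inva])
      have "s \<notin> orbit_set f m" if "s \<in> L f" "s \<noteq> m" for s
      proof
        assume "s \<in> orbit_set f m"
        then have "orbit_set f s = orbit_set f m" by (rule orbit_set_eqI(1)[OF fin per])
        moreover have "s = Min (orbit_set f s)" "m = Min (orbit_set f m)"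
          using that True by (auto simp: L_def cyc_leaders_def)
        ultimately show False using that by simp
      qed
      then have cpL: "cyc_prod c (h f) s = cyc_prod c f s" if "s \<in> L f" "s \<noteq> m" for s
        using that cp by blast
      have gL: "g m (h f) s = g m f s" "g (Suc m) f s = g m f s" "g (Suc m) (h f) s = g m f s"
        if "s \<in> L f" "s \<noteq> m" for s
        using that cpL by (auto simp: g_def)
      have ind: "map (g m (h f)) xs = map (g m f) xs" "map (g (Suc m) f) xs = map (g m f) xs"
        "map (g (Suc m) (h f)) xs = map (g m f) xs" if "set xs \<subseteq> L f - {m}" for xs
        using that gL by (auto simp: subset_iff)
      have sub: "set ys \<subseteq> L f - {m}" "set zs \<subseteq> L f - {m}" using dl sl by auto
      have herm': "a \<in> orbit_set f m \<Longrightarrow> b \<in> orbit_set f m \<Longrightarrow> qcnj (c b a) = c a b" for a b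
      proof -
        assume "a \<in> orbit_set f m" "b \<in> orbit_set f m"
        then have "a \<in> S - {i}" "b \<in> S - {i}" using mS orbit_set_subset[OF fin per, of m] by auto
        then have "c a b = qcnj (c b a)" using herm unfolding herm_on_def by blast
        then show ?thesis by (rule sym)
      qed
      have cm: "cyc_prod c (h f) m = qcnj (cyc_prod c f m)"
      proof -
        have "cyc_prod (\<lambda>a b. qcnj (c b a)) f m = cyc_prod c f m"
          by (rule cyc_prod_cong[OF fin per herm'])
        then show ?thesis unfolding hf by (simp add: cyc_prod_rev_on[OF fin per inva])
      qed
      have gm: "g m f m = cyc_prod c f m" "g m (h f) m = qcnj (cyc_prod c f m)"
        "g (Suc m) f m = qreal (qre (cyc_prod c f m))" "g (Suc m) (h f) m = qreal (qre (cyc_prod c f m))"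
        using cm by (auto simp: g_def)
      have eh: "e (h f) = e f" by (simp add: e_def lead)
      \<comment> \<open>The cycle led by \<open>m\<close> stands between the factors
        \<open>Y\<close> and \<open>Z\<close>, which its reversal leaves alone. Only the middle
        factor is averaged, so nothing has to commute.\<close>
      define Y where "Y = prod_list (map (g m f) ys)"
      define Z where "Z = prod_list (map (g m f) zs)"
      have "F m f + F m (h f) = e f * (Y * (cyc_prod c f m + qcnj (cyc_prod c f m)) * Z * cyc_prod c f i)"
        using cp[of i] mS by (simp add: F_def Lh l eh ind[OF sub(1)] ind[OF sub(2)] gm Y_def Z_def algebra_simps)
      also have "\<dots> = F (Suc m) f + F (Suc m) (h f)"
        unfolding add_qcnj
        using cp[of i] mS by (simp add: F_def Lh l eh ind[OF sub(1)] ind[OF sub(2)] gm Y_def Z_def algebra_simps)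
      finally show ?thesis .
    qed
  qed
  have g0: "g 0 = cyc_prod c" by (simp add: g_def fun_eq_iff)
  have "cdet_on S c i = (\<Sum>f | f permutes S. F 0 f)"
    unfolding cdet_on_def F_def e_def L_def g0 ..
  \<comment> \<open>All leaders lie in \<open>S\<close>, hence below \<open>Suc (Max S)\<close>, and
    by then every factor is real.\<close>
  also have "\<dots> = (\<Sum>f | f permutes S. F (Suc (Max S)) f)"
  proof -
    have "(\<Sum>f | f permutes S. F 0 f) = (\<Sum>f | f permutes S. F m f)" for m
    proof (induction m)
      case (Suc m)
      then show ?case using step[of m] by (rule trans)
    qed (rule refl)
    then show ?thesis .
  qed
  also have "\<dots> = (\<Sum>f | f permutes S. qreal ((- 1) ^ (card S - card (cyc_leaders S f)) *
      (\<Prod>s\<in>L f. qre (cyc_prod c f s))) * cyc_prod c f i)"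
  proof (rule sum.cong[OF refl])
    fix f
    have "s < Suc (Max S)" if "s \<in> L f" for s
      using that fin by (auto simp: L_def cyc_leaders_def less_Suc_eq_le)
    then have mg: "map (g (Suc (Max S)) f) (rev (sorted_list_of_set (L f)))
      = map (\<lambda>s. qreal (qre (cyc_prod c f s))) (rev (sorted_list_of_set (L f)))"
      using finL by (auto simp: g_def)
    have "prod_list (map (\<lambda>s. qre (cyc_prod c f s)) (rev (sorted_list_of_set (L f))))
      = (\<Prod>s\<in>L f. qre (cyc_prod c f s))"
      using prod.distinct_set_conv_list[of "rev (sorted_list_of_set (L f))" "\<lambda>s. qre (cyc_prod c f s)"] finL
      by simp
    then show "F (Suc (Max S)) f = qreal ((- 1) ^ (card S - card (cyc_leaders S f)) *
      (\<Prod>s\<in>L f. qre (cyc_prod c f s))) * cyc_prod c f i"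
      unfolding F_def mg by (simp add: e_def prod_list_qreal qreal_power mult.assoc)
  qed
  finally show ?thesis unfolding L_def .
qed

lemma cdet_on_real_parts:
  assumes fin: "finite S" and i: "i \<in> S" and herm: "herm_on (S - {i}) c"
  shows "cdet_on S c i = (\<Sum>f | f permutes S.
      qreal (osign S f * (\<Prod>T\<in>{T \<in> orbs S f. i \<notin> T}. oval c f T)) * cyc_prod c f i)"
  unfolding cdet_on_real_parts_leaders[OF assms]
  by (rule sum.cong[OF refl]) (simp only: osign_def card_leaders[OF fin] prod_leaders[OF fin] mem_Collect_eq)

definition herm_det :: "nat set \<Rightarrow> (nat \<Rightarrow> nat \<Rightarrow> quat) \<Rightarrow> real" where
  "herm_det S c = (\<Sum>f | f permutes S. osign S f * (\<Prod>T\<in>orbs S f. oval c f T))"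

text \<open>\<open>X\<close> lists the indices whose cycles are kept aside as quaternion factors;
  the rest is a real, hence central, coefficient. \<open>{i}\<close> belongs to the column
  determinant along \<open>i\<close>, \<open>{i, k}\<close> to a pair of cycles about to be joined,
  \<open>{}\<close> to the full Hermitian determinant.\<close>

definition wgt :: "nat set \<Rightarrow> (nat \<Rightarrow> nat \<Rightarrow> quat) \<Rightarrow> nat set \<Rightarrow> (nat \<Rightarrow> nat) \<Rightarrow> real" where
  "wgt S c X f = osign S f * (\<Prod>T\<in>{T \<in> orbs S f. T \<inter> X = {}}. oval c f T)"

lemma herm_det_wgt: "herm_det S c = (\<Sum>f | f permutes S. wgt S c {} f)"
  by (simp add: herm_det_def wgt_def)

lemma cdet_on_wgt:
  assumes "finite S" "i \<in> S" "herm_on (S - {i}) c"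
  shows "cdet_on S c i = (\<Sum>f | f permutes S. qreal (wgt S c {i} f) * cyc_prod c f i)"
  unfolding cdet_on_real_parts[OF assms] wgt_def by simp

lemma wgt_cong:
  assumes fin: "finite S" and per: "f permutes S"
    and "\<And>a b. a \<in> S - X \<Longrightarrow> b \<in> S - X \<Longrightarrow> c a b = c' a b"
  shows "wgt S c X f = wgt S c' X f"
proof -
  have "oval c f T = oval c' f T" if T: "T \<in> orbs S f" "T \<inter> X = {}" for T
  proof -
    obtain x where x: "x \<in> S" "T = orbit_set f x" using T by (auto simp: orbs_def)
    then have sub: "T \<subseteq> S - X" using orbit_set_subset[OF fin per, of x] T by auto
    have "x \<in> T" using x by simp
    have "cyc_prod c f x = cyc_prod c' f x"
      by (rule cyc_prod_cong[OF fin per]) (use assms(3) sub x in blast)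
    then show ?thesis using oval_eq[OF fin per T(1) \<open>x \<in> T\<close>] by simp
  qed
  then show ?thesis unfolding wgt_def by (intro arg_cong2[where f = "(*)"] prod.cong refl) auto
qed

lemma orbs_eq_orbit_set:
  assumes "finite S" "f permutes S" "T \<in> orbs S f" "x \<in> T"
  shows "T = orbit_set f x"
proof -
  obtain z where z: "T = orbit_set f z" using assms(3) by (auto simp: orbs_def)
  then have "orbit_set f x = orbit_set f z" using assms(4) orbit_set_eqI(1)[OF assms(1,2)] by blast
  then show ?thesis using z by simp
qed

lemma wgt_insert:
  assumes fin: "finite S" and per: "f permutes S" and k: "k \<in> S" "orbit_set f k \<inter> X = {}"
  shows "wgt S c X f = wgt S c (insert k X) f * qre (cyc_prod c f k)"
proof -
  have "T = orbit_set f k" if "T \<in> orbs S f" "k \<in> T" for T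
    using orbs_eq_orbit_set[OF fin per that] .
  then have "{T \<in> orbs S f. T \<inter> X = {}} = insert (orbit_set f k) {T \<in> orbs S f. T \<inter> insert k X = {}}"
    using k by (auto simp: orbs_def)
  moreover have "finite {T \<in> orbs S f. T \<inter> insert k X = {}}" using fin by (simp add: orbs_def)
  moreover have "orbit_set f k \<notin> {T \<in> orbs S f. T \<inter> insert k X = {}}" using self_in_orbit_set[of k f] by blast
  moreover have "oval c f (orbit_set f k) = qre (cyc_prod c f k)"
    by (rule oval_eq[OF fin per]) (use k in \<open>auto simp: orbs_def\<close>)
  ultimately show ?thesis by (simp add: wgt_def)
qed

lemma wgt_rev_on:
  assumes fin: "finite S" and per: "f permutes S" and k: "k \<in> X"
  shows "wgt S c X (rev_on f (orbit_set f k)) = wgt S c X f"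
proof -
  note inva = image_in_orbit_set[OF fin per, of _ k]
  have o: "orbs S (rev_on f (orbit_set f k)) = orbs S f"
    unfolding orbs_def using orbit_set_rev_on[OF fin per inva] by simp
  have "oval c (rev_on f (orbit_set f k)) T = oval c f T" if T: "T \<in> orbs S f" "T \<inter> X = {}" for T
  proof -
    obtain x where x: "T = orbit_set f x" using T by (auto simp: orbs_def)
    then have m: "Min T \<in> T" using finite_orbit_set[OF fin per, of x] self_in_orbit_set[of x f]
      by (metis Min_in empty_iff)
    have "Min T \<notin> orbit_set f k"
    proof
      assume "Min T \<in> orbit_set f k"
      then have "orbit_set f (Min T) = orbit_set f k" by (rule orbit_set_eqI(1)[OF fin per])
      moreover have "orbit_set f (Min T) = T" using m orbit_set_eqI(1)[OF fin per, of "Min T" x] x by simp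
      ultimately have "orbit_set f k = T" by simp
      then show False using T k self_in_orbit_set[of k f] by auto
    qed
    then show ?thesis unfolding oval_def by (simp add: cyc_prod_rev_on[OF fin per inva])
  qed
  then show ?thesis unfolding wgt_def osign_def o by (intro arg_cong2[where f = "(*)"] prod.cong refl) auto
qed

lemma cyc_prod_rev_on_self:
  assumes fin: "finite S" and per: "f permutes S" and "herm_on (orbit_set f k) c"
  shows "cyc_prod c (rev_on f (orbit_set f k)) k = qcnj (cyc_prod c f k)"
proof -
  have "qcnj (c b a) = c a b" if "a \<in> orbit_set f k" "b \<in> orbit_set f k" for a b
    using assms(3) that unfolding herm_on_def by metis
  then have "cyc_prod (\<lambda>a b. qcnj (c b a)) f k = cyc_prod c f k"
    by (intro cyc_prod_cong[OF fin per])
  then show ?thesis by (simp add: cyc_prod_rev_on[OF fin per image_in_orbit_set[OF fin per, of _ k]])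
qed

lemma herm_on_subset: "herm_on T c \<Longrightarrow> U \<subseteq> T \<Longrightarrow> herm_on U c"
  unfolding herm_on_def by blast

text \<open>With column \<open>i\<close> Hermitian as well, the cycle through \<open>i\<close> can
  also be averaged with its reverse. All factors become real and the dependence on \<open>i\<close>
  disappears.\<close>

lemma cdet_on_hermitian:
  assumes fin: "finite S" and i: "i \<in> S" and herm: "herm_on S c"
  shows "cdet_on S c i = qreal (herm_det S c)"
proof -
  have "cdet_on S c i = (\<Sum>f | f permutes S. qreal (wgt S c {i} f) * cyc_prod c f i)"
    by (rule cdet_on_wgt[OF fin i]) (use herm herm_on_subset in blast)
  also have "\<dots> = (\<Sum>f | f permutes S. qreal (wgt S c {i} f) * qreal (qre (cyc_prod c f i)))"
  proof (rule sum_eq_by_involution)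
    fix f assume "f \<in> {f. f permutes S}"
    then have per: "f permutes S" by simp
    note inva = image_in_orbit_set[OF fin per, of _ i]
    let ?h = "\<lambda>f. rev_on f (orbit_set f i)"
    show "?h f \<in> {f. f permutes S}" using rev_on_permutes[OF fin per inva] by simp
    show "?h (?h f) = f"
      using rev_on_rev_on[OF fin per inva] orbit_set_rev_on[OF fin per inva] by simp
    have cp: "cyc_prod c (?h f) i = qcnj (cyc_prod c f i)"
      by (rule cyc_prod_rev_on_self[OF fin per])
        (use herm herm_on_subset orbit_set_subset[OF fin per i] in blast)
    have w: "wgt S c {i} (?h f) = wgt S c {i} f" by (rule wgt_rev_on[OF fin per]) simp
    show "qreal (wgt S c {i} f) * cyc_prod c f i + qreal (wgt S c {i} (?h f)) * cyc_prod c (?h f) i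
      = qreal (wgt S c {i} f) * qreal (qre (cyc_prod c f i))
        + qreal (wgt S c {i} (?h f)) * qreal (qre (cyc_prod c (?h f) i))"
      unfolding cp w using add_qcnj[of "cyc_prod c f i"] by (simp flip: distrib_left)
  qed
  also have "\<dots> = (\<Sum>f | f permutes S. qreal (wgt S c {} f))"
    by (rule sum.cong[OF refl]) (use i in \<open>simp add: wgt_insert[OF fin _ i, of _ "{}"]\<close>)
  finally show ?thesis by (simp add: herm_det_wgt qreal_sum)
qed

subsection \<open>Joining and splitting cycles\<close>

text \<open>Composing with \<open>g\<close> afterwards redirects the edges whose targets
  \<open>g\<close> moves. If \<open>g\<close> fixes the inner vertices, only the last edge
  changes.\<close>

lemma is_path_comp:
  assumes "is_path f xs z" "\<And>y. y \<in> set (tl xs) \<Longrightarrow> g y = y"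
  shows "is_path (g \<circ> f) xs (g z)"
  using assms by (induction f xs z rule: is_path.induct) auto

lemma is_path_last: "is_path f xs z \<Longrightarrow> xs \<noteq> [] \<Longrightarrow> f (last xs) = z"
  by (induction f xs z rule: is_path.induct) auto

text \<open>The end point is read only by the last factor, so a change in its column acts by right
  multiplication. It is used with \<open>w = 1\<close> to exchange end points, with
  \<open>w = 0\<close> for vanishing, and with a column entry as \<open>w\<close> for
  linearity.\<close>

lemma path_prod_scale_end:
  assumes "xs \<noteq> []" "\<And>a b. a \<in> set xs \<Longrightarrow> b \<in> set (tl xs) \<Longrightarrow> c a b = c' a b"
    and "c (last xs) z = c' (last xs) z' * w"
  shows "path_prod c xs z = path_prod c' xs z' * w"
  using assms
proof (induction c xs z rule: path_prod.induct)
  case (3 c x y xs z)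
  have "path_prod c (y # xs) z = path_prod c' (y # xs) z' * w"
    by (rule 3(1)) (use 3(3,4) in auto)
  moreover have "c x y = c' x y" using 3(3)[of x y] by simp
  ultimately show ?case by (simp add: mult.assoc)
qed auto

lemma distinct_hd_notin_tl: "distinct xs \<Longrightarrow> hd xs \<notin> set (tl xs) \<or> xs = []"
  by (cases xs) auto

context
  fixes S :: "nat set" and f :: "nat \<Rightarrow> nat" and i k :: nat
  assumes fin: "finite S" and per: "f permutes S" and i: "i \<in> S" and k: "k \<in> S"
begin

text \<open>The edges into \<open>i\<close> and into \<open>k\<close> exchange their targets: two
  different cycles through \<open>i\<close> and \<open>k\<close> merge, a common cycle
  splits.\<close>

abbreviation "joined \<equiv> transpose i k \<circ> f"

lemma joined_permutes: "joined permutes S"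
  by (rule permutes_compose[OF per]) (rule permutes_swap_id[OF i k])

lemma cyc_list_joined_other:
  assumes "i \<notin> orbit_set f x" "k \<notin> orbit_set f x"
  shows "cyc_list joined x = cyc_list f x"
proof -
  have "x \<noteq> i" "x \<noteq> k" using assms self_in_orbit_set by auto
  moreover have "is_path joined (cyc_list f x) (transpose i k x)"
    by (rule is_path_comp[OF is_path_cyc_list[OF fin per]])
      (use assms in \<open>metis list.set_sel(2) orbit_set_cyc_list[OF fin per] tl_Nil transpose_apply_other list.set(1) empty_iff\<close>)
  ultimately show ?thesis
    using cyc_listI[of joined "cyc_list f x"] distinct_cyc_list[OF fin per, of x]
      hd_cyc_list[OF fin per, of x] cyc_list_ne[OF fin per, of x] by simp
qed

text \<open>Reading the cycle of \<open>i\<close> up to the predecessor of \<open>k\<close>: that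
  vertex now points back to \<open>i\<close>, so the initial segment closes up without
  \<open>k\<close>.\<close>

lemma joined_split:
  assumes "k \<in> orbit_set f i" "i \<noteq> k"
  shows "k \<notin> orbit_set joined i"
proof -
  obtain xs ys where l: "cyc_list f i = xs @ k # ys"
    using assms(1) unfolding orbit_set_cyc_list[OF fin per] by (meson split_list)
  have h: "hd (xs @ k # ys) = i" using hd_cyc_list[OF fin per, of i] l by simp
  then have ne: "xs \<noteq> []" using assms(2) by auto
  then have h: "hd xs = i" using h by simp
  have d: "distinct (xs @ k # ys)" using distinct_cyc_list[OF fin per, of i] l by simp
  have "is_path f xs k" using is_path_cyc_list[OF fin per, of i] l by (simp add: is_path_append)
  then have "is_path joined xs (transpose i k k)"
  proof (rule is_path_comp)
    fix y assume y: "y \<in> set (tl xs)"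
    then have "y \<noteq> i" using distinct_hd_notin_tl[of xs] d h ne by auto
    moreover have "y \<noteq> k" using y d list.set_sel(2)[OF ne y] by auto
    ultimately show "transpose i k y = y" by simp
  qed
  then have "cyc_list joined i = xs" using cyc_listI[of joined xs] d h ne by simp
  then show ?thesis using d by (simp add: orbit_set_cyc_list[OF fin joined_permutes])
qed

context
  assumes sep: "k \<notin> orbit_set f i"
begin

lemma sep_disjoint: "orbit_set f i \<inter> orbit_set f k = {}"
  using sep orbit_set_eqI(1)[OF fin per] self_in_orbit_set by (metis disjoint_iff)

text \<open>The last vertex of the cycle of \<open>i\<close> now leads to \<open>k\<close>, and that
  of the cycle of \<open>k\<close> back to \<open>i\<close>. The order of the two lists fixes the
  order of the factors in the joined product.\<close>

lemma cyc_list_joined: "cyc_list joined i = cyc_list f i @ cyc_list f k"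
proof -
  have other: "transpose i k y = y" if "y \<in> set (tl (cyc_list f x))" "x = i \<or> x = k" for x y
  proof -
    have "y \<in> orbit_set f x" using that(1) list.set_sel(2)[OF cyc_list_ne[OF fin per]]
      by (simp add: orbit_set_cyc_list[OF fin per])
    moreover have "y \<noteq> x"
      using that(1) distinct_hd_notin_tl[OF distinct_cyc_list[OF fin per, of x]] cyc_list_ne[OF fin per]
        hd_cyc_list[OF fin per] by metis
    ultimately have "y \<noteq> i \<and> y \<noteq> k"
      using that(2) sep_disjoint self_in_orbit_set[of i f] self_in_orbit_set[of k f] by blast
    then show ?thesis by simp
  qed
  have "is_path joined (cyc_list f i) (transpose i k i)"
    by (rule is_path_comp[OF is_path_cyc_list[OF fin per]]) (use other in blast)
  moreover have "is_path joined (cyc_list f k) (transpose i k k)"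
    by (rule is_path_comp[OF is_path_cyc_list[OF fin per]]) (use other in blast)
  ultimately have "is_path joined (cyc_list f i @ cyc_list f k) i"
    by (simp add: is_path_append cyc_list_ne[OF fin per] hd_cyc_list[OF fin per])
  moreover have "distinct (cyc_list f i @ cyc_list f k)"
    using sep_disjoint distinct_cyc_list[OF fin per] by (simp add: orbit_set_cyc_list[OF fin per])
  ultimately show ?thesis
    using cyc_listI[of joined "cyc_list f i @ cyc_list f k"]
    by (simp add: cyc_list_ne[OF fin per] hd_cyc_list[OF fin per])
qed

lemma orbit_set_joined: "orbit_set joined i = orbit_set f i \<union> orbit_set f k"
  by (simp add: orbit_set_cyc_list[OF fin joined_permutes] orbit_set_cyc_list[OF fin per] cyc_list_joined)

lemma orbit_set_joined_other:
  "x \<notin> orbit_set f i \<union> orbit_set f k \<Longrightarrow> i \<notin> orbit_set f x \<and> k \<notin> orbit_set f x \<and> orbit_set joined x = orbit_set f x"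
proof -
  assume x: "x \<notin> orbit_set f i \<union> orbit_set f k"
  then have "i \<notin> orbit_set f x" "k \<notin> orbit_set f x"
    using orbit_set_eqI(1)[OF fin per, of i x] orbit_set_eqI(1)[OF fin per, of k x]
      self_in_orbit_set[of x f] by blast+
  then show ?thesis
    using cyc_list_joined_other by (simp add: orbit_set_cyc_list[OF fin joined_permutes] orbit_set_cyc_list[OF fin per])
qed

lemma orbs_separate:
  "orbs S f = insert (orbit_set f i) (insert (orbit_set f k) {T \<in> orbs S f. T \<inter> {i, k} = {}})" (is ?g1)
  "orbs S joined = insert (orbit_set f i \<union> orbit_set f k) {T \<in> orbs S f. T \<inter> {i, k} = {}}" (is ?g2)
proof -
  show ?g1
  proof (intro equalityI subsetI)
    fix T assume T: "T \<in> orbs S f"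
    show "T \<in> insert (orbit_set f i) (insert (orbit_set f k) {T \<in> orbs S f. T \<inter> {i, k} = {}})"
      using T orbs_eq_orbit_set[OF fin per T, of i] orbs_eq_orbit_set[OF fin per T, of k] by blast
  qed (use i k in \<open>auto simp: orbs_def\<close>)
  show ?g2
  proof (intro equalityI subsetI)
    fix T assume "T \<in> orbs S joined"
    then obtain x where x: "x \<in> S" "T = orbit_set joined x" by (auto simp: orbs_def)
    show "T \<in> insert (orbit_set f i \<union> orbit_set f k) {T \<in> orbs S f. T \<inter> {i, k} = {}}"
    proof (cases "x \<in> orbit_set f i \<union> orbit_set f k")
      case True
      then have "x \<in> orbit_set joined i" using orbit_set_joined by simp
      then have "orbit_set joined x = orbit_set joined i" by (rule orbit_set_eqI(1)[OF fin joined_permutes])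
      then show ?thesis using x orbit_set_joined by simp
    next
      case False
      then have "T = orbit_set f x" "i \<notin> T" "k \<notin> T" using orbit_set_joined_other x(2) by auto
      then show ?thesis using x(1) unfolding orbs_def by blast
    qed
  next
    fix T assume "T \<in> insert (orbit_set f i \<union> orbit_set f k) {T \<in> orbs S f. T \<inter> {i, k} = {}}"
    then show "T \<in> orbs S joined"
    proof
      assume "T = orbit_set f i \<union> orbit_set f k"
      then have "T = orbit_set joined i" using orbit_set_joined by simp
      then show ?thesis using i unfolding orbs_def by blast
    next
      assume "T \<in> {T \<in> orbs S f. T \<inter> {i, k} = {}}"
      then obtain x where x: "x \<in> S" "T = orbit_set f x" "i \<notin> orbit_set f x" "k \<notin> orbit_set f x"
        by (auto simp: orbs_def)
      have "x \<notin> orbit_set f i \<union> orbit_set f k"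
        using x(3,4) orbit_set_eqI(1)[OF fin per, of x i] orbit_set_eqI(1)[OF fin per, of x k]
          self_in_orbit_set[of i f] self_in_orbit_set[of k f] by blast
      then have "orbit_set joined x = T" using orbit_set_joined_other x(2) by blast
      then show ?thesis using x(1) unfolding orbs_def by blast
    qed
  qed
qed

lemma osign_joined: "osign S joined = - osign S f"
proof -
  let ?R = "{T \<in> orbs S f. T \<inter> {i, k} = {}}"
  have finR: "finite ?R" using fin by (simp add: orbs_def)
  have a: "orbit_set f i \<noteq> orbit_set f k" using sep self_in_orbit_set by blast
  have b: "orbit_set f i \<notin> ?R" "orbit_set f k \<notin> ?R" "orbit_set f i \<union> orbit_set f k \<notin> ?R"
    using self_in_orbit_set[of i f] self_in_orbit_set[of k f] by auto
  have "card (orbs S f) = card ?R + 2"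
    by (subst orbs_separate(1)) (use a b finR in simp)
  moreover have "card (orbs S joined) = card ?R + 1"
    by (subst orbs_separate(2)) (use b finR in simp)
  \<comment> \<open>This bound is needed because the exponent in \<open>osign\<close> is a truncated
    difference of natural numbers.\<close>
  moreover have "card (orbs S f) \<le> card S" unfolding orbs_def by (rule card_image_le[OF fin])
  ultimately have "card S - card (orbs S joined) = Suc (card S - card (orbs S f))" by simp
  then show ?thesis by (simp add: osign_def)
qed

text \<open>The joined cycle contains \<open>i\<close> and is left out of the weight; the remaining
  cycles are those of \<open>f\<close> that avoid both \<open>i\<close> and \<open>k\<close>, and
  the cycle count has dropped by one.\<close>

lemma wgt_joined: "wgt S c {i} joined = - wgt S c {i, k} f"
proof -
  have "{T \<in> orbs S joined. T \<inter> {i} = {}} = {T \<in> orbs S f. T \<inter> {i, k} = {}}"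
    unfolding orbs_separate(2) using self_in_orbit_set[of i f] by auto
  moreover have "oval c joined T = oval c f T" if T: "T \<in> orbs S f" "T \<inter> {i, k} = {}" for T
  proof -
    obtain x where x: "T = orbit_set f x" using T(1) by (auto simp: orbs_def)
    then have m: "Min T \<in> T" using finite_orbit_set[OF fin per, of x] self_in_orbit_set[of x f]
      by (metis Min_in empty_iff)
    then have "orbit_set f (Min T) = T" using x orbit_set_eqI(1)[OF fin per, of "Min T" x] by simp
    then have "cyc_list joined (Min T) = cyc_list f (Min T)"
      using T(2) by (intro cyc_list_joined_other) auto
    then show ?thesis
      by (simp add: oval_def cyc_prod_path[OF fin per] cyc_prod_path[OF fin joined_permutes])
  qed
  ultimately have "(\<Prod>T\<in>{T \<in> orbs S joined. T \<inter> {i} = {}}. oval c joined T)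
      = (\<Prod>T\<in>{T \<in> orbs S f. T \<inter> {i, k} = {}}. oval c f T)"
    by (intro prod.cong) auto
  then show ?thesis unfolding wgt_def osign_joined by simp
qed

lemma cyc_prod_joined:
  "cyc_prod c joined i = path_prod c (cyc_list f i) k * path_prod c (cyc_list f k) i"
  unfolding cyc_prod_path[OF fin joined_permutes] cyc_list_joined
  by (simp add: path_prod_append cyc_list_ne[OF fin per] hd_cyc_list[OF fin per])

end

end

lemma permutes_finite_set [simp]: "finite S \<Longrightarrow> finite {f. f permutes S}"
  by (rule finite_permutations)

subsection \<open>Column determinants of Hermitian matrices\<close>

text \<open>The permutations in which k lies on the cycle of i are exactly the products of (i k) with
  those in which it does not; with equal columns i and k the two families cancel once the cycle
  of k is averaged with its reverse.\<close>

lemma cdet_on_equal_columns: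
  assumes fin: "finite S" and i: "i \<in> S" and k: "k \<in> S" and ik: "i \<noteq> k"
    and herm: "herm_on (S - {i}) c" and eq: "\<And>a. a \<in> S \<Longrightarrow> c a i = c a k"
  shows "cdet_on S c i = 0"
proof -
  define P where "P = {f. f permutes S \<and> k \<notin> orbit_set f i}"
  define Q where "Q = {f. f permutes S \<and> k \<in> orbit_set f i}"
  define t where "t f = qreal (wgt S c {i} f) * cyc_prod c f i" for f
  define w where "w f = qreal (wgt S c {i, k} f)" for f
  have split: "{f. f permutes S} = P \<union> Q" "P \<inter> Q = {}" by (auto simp: P_def Q_def)
  have finPQ: "finite P" "finite Q" using permutes_finite_set[OF fin] by (auto simp: split)
  \<comment> \<open>The last factor lies in column \<open>i\<close> or \<open>k\<close>, so with
    equal columns the two open paths of a joined cycle can be closed: its product becomes the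
    product of the two separate cycles.\<close>
  have end_eq: "path_prod c (cyc_list f x) i = path_prod c (cyc_list f x) k" if "f permutes S" "x \<in> S" for f x
  proof -
    have "last (cyc_list f x) \<in> S"
      using that orbit_set_subset[OF fin] orbit_set_cyc_list[OF fin that(1)] last_in_set[OF cyc_list_ne[OF fin that(1)]]
      by blast
    then show ?thesis
      using path_prod_scale_end[of "cyc_list f x" c c i k 1] eq cyc_list_ne[OF fin that(1)] by simp
  qed
  have "(\<Sum>f\<in>Q. t f) = (\<Sum>f\<in>P. t (transpose i k \<circ> f))"
  proof (rule sum.reindex_bij_witness[of _ "\<lambda>f. transpose i k \<circ> f" "\<lambda>f. transpose i k \<circ> f"])
    fix f assume f: "f \<in> Q"
    show "transpose i k \<circ> f \<in> P"
      using f joined_permutes[OF fin _ i k] joined_split[OF fin _ i k _ ik] by (auto simp: P_def Q_def)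
  next
    fix f assume f: "f \<in> P"
    then have "k \<in> orbit_set (transpose i k \<circ> f) i"
      using orbit_set_joined[OF fin _ i k, of f] self_in_orbit_set[of k f] by (auto simp: P_def)
    then show "transpose i k \<circ> f \<in> Q"
      using f joined_permutes[OF fin _ i k] by (auto simp: P_def Q_def)
  qed (auto simp: comp_assoc[symmetric])
  also have "\<dots> = (\<Sum>f\<in>P. - (w f * (cyc_prod c f i * cyc_prod c f k)))"
  proof (rule sum.cong[OF refl])
    fix f assume "f \<in> P"
    then have per: "f permutes S" and sep: "k \<notin> orbit_set f i" by (auto simp: P_def)
    show "t (transpose i k \<circ> f) = - (w f * (cyc_prod c f i * cyc_prod c f k))"
      unfolding t_def w_def wgt_joined[OF fin per i k sep] cyc_prod_joined[OF fin per i k sep]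
        cyc_prod_path[OF fin per]
      using end_eq[OF per i] end_eq[OF per k] by simp
  qed
  also have "\<dots> = - (\<Sum>f\<in>P. w f * (cyc_prod c f i * cyc_prod c f k))" by (rule sum_negf)
  also have "(\<Sum>f\<in>P. w f * (cyc_prod c f i * cyc_prod c f k))
      = (\<Sum>f\<in>P. w f * (cyc_prod c f i * qreal (qre (cyc_prod c f k))))"
  proof (rule sum_eq_by_involution)
    fix f assume "f \<in> P"
    then have per: "f permutes S" and sep: "k \<notin> orbit_set f i" by (auto simp: P_def)
    note inva = image_in_orbit_set[OF fin per, of _ k]
    let ?h = "\<lambda>f. rev_on f (orbit_set f k)"
    have orb: "orbit_set (?h f) x = orbit_set f x" for x by (rule orbit_set_rev_on[OF fin per inva])
    show "?h f \<in> P" using rev_on_permutes[OF fin per inva] orb sep by (simp add: P_def)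
    show "?h (?h f) = f" using rev_on_rev_on[OF fin per inva] orb by simp
    \<comment> \<open>The cycle of \<open>k\<close> avoids \<open>i\<close>, the index at which
      Hermitian symmetry may fail, so reversing it conjugates its product.\<close>
    have ni: "i \<notin> orbit_set f k"
      using sep_disjoint[OF fin per i k sep] self_in_orbit_set[of i f] by blast
    have cpk: "cyc_prod c (?h f) k = qcnj (cyc_prod c f k)"
      by (rule cyc_prod_rev_on_self[OF fin per], rule herm_on_subset[OF herm])
        (use orbit_set_subset[OF fin per k] ni in blast)
    have cpi: "cyc_prod c (?h f) i = cyc_prod c f i"
      using ni by (simp add: cyc_prod_rev_on[OF fin per inva])
    have wh: "w (?h f) = w f" unfolding w_def by (subst wgt_rev_on[OF fin per]) auto
    show "w f * (cyc_prod c f i * cyc_prod c f k) + w (?h f) * (cyc_prod c (?h f) i * cyc_prod c (?h f) k)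
      = w f * (cyc_prod c f i * qreal (qre (cyc_prod c f k)))
        + w (?h f) * (cyc_prod c (?h f) i * qreal (qre (cyc_prod c (?h f) k)))"
      unfolding cpk cpi wh using add_qcnj[of "cyc_prod c f k"] by (simp flip: distrib_left)
  qed
  also have "\<dots> = (\<Sum>f\<in>P. t f)"
  proof (rule sum.cong[OF refl])
    fix f assume "f \<in> P"
    then have per: "f permutes S" and sep: "k \<notin> orbit_set f i" by (auto simp: P_def)
    have "i \<notin> orbit_set f k"
      using sep_disjoint[OF fin per i k sep] self_in_orbit_set[of i f] by blast
    then have "wgt S c {i} f = wgt S c {i, k} f * qre (cyc_prod c f k)"
      using wgt_insert[OF fin per k, of "{i}" c] by (simp add: insert_commute)
    then show "w f * (cyc_prod c f i * qreal (qre (cyc_prod c f k))) = t f"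
      by (simp add: t_def w_def qreal_commute[of "cyc_prod c f i"] mult.assoc)
  qed
  finally have "(\<Sum>f\<in>Q. t f) = - (\<Sum>f\<in>P. t f)" .
  moreover have "cdet_on S c i = (\<Sum>f\<in>P. t f) + (\<Sum>f\<in>Q. t f)"
    unfolding cdet_on_wgt[OF fin i herm] t_def[symmetric] unfolding split(1)
    by (rule sum.union_disjoint) (use finPQ split in auto)
  ultimately show ?thesis by simp
qed

text \<open>Deleting a fixed point lowers the number of indices and the number of cycles by one
  each, which leaves the sign unchanged.\<close>

lemma orbs_fixed_point:
  assumes fin: "finite S" and k: "k \<in> S" and per: "f permutes S - {k}"
  shows "orbit_set f k = {k}" "orbs S f = insert {k} (orbs (S - {k}) f)"
    "osign S f = osign (S - {k}) f" "cyc_list f k = [k]"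
    "wgt S c (insert k X) f = wgt (S - {k}) c X f"
proof -
  have perS: "f permutes S" using per by (rule permutes_subset) auto
  have fk: "f k = k" using per by (simp add: permutes_not_in)
  show cl: "cyc_list f k = [k]" using cyc_listI[of f "[k]"] fk by simp
  show ok: "orbit_set f k = {k}" unfolding orbit_set_cyc_list[OF fin perS] cl by simp
  show o: "orbs S f = insert {k} (orbs (S - {k}) f)"
  proof -
    have "orbs S f = orbit_set f ` insert k (S - {k})" using k by (simp only: orbs_def insert_Diff)
    then show ?thesis by (simp only: image_insert ok orbs_def)
  qed
  have sub: "T \<subseteq> S - {k}" if T: "T \<in> orbs (S - {k}) f" for T
  proof -
    obtain x where "x \<in> S - {k}" "T = orbit_set f x" using T by (auto simp: orbs_def)
    then show ?thesis using orbit_set_subset[OF finite_Diff[OF fin] per, of x] by simp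
  qed
  have nk: "{k} \<notin> orbs (S - {k}) f" using sub by blast
  have "finite (orbs (S - {k}) f)" using fin by (simp add: orbs_def)
  then have "card (orbs S f) = Suc (card (orbs (S - {k}) f))" using o nk by simp
  moreover have "card S = Suc (card (S - {k}))" using card_Suc_Diff1[OF fin k] by simp
  ultimately show s: "osign S f = osign (S - {k}) f" by (simp add: osign_def)
  have "{T \<in> orbs S f. T \<inter> insert k X = {}} = {T \<in> orbs (S - {k}) f. T \<inter> X = {}}"
    unfolding o using sub by auto
  then show "wgt S c (insert k X) f = wgt (S - {k}) c X f" by (simp add: wgt_def s)
qed

lemma cyc_prod_eq_0:
  assumes fin: "finite S" and per: "f permutes S" and x: "x \<in> S"
    and "\<And>a. a \<in> S \<Longrightarrow> f a = x \<Longrightarrow> c a x = 0"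
  shows "cyc_prod c f x = 0"
proof -
  have "last (cyc_list f x) \<in> S"
    using x orbit_set_subset[OF fin per] orbit_set_cyc_list[OF fin per] last_in_set[OF cyc_list_ne[OF fin per]]
    by blast
  moreover have "f (last (cyc_list f x)) = x"
    using is_path_last[OF is_path_cyc_list[OF fin per]] cyc_list_ne[OF fin per] by blast
  ultimately have "c (last (cyc_list f x)) x = c (last (cyc_list f x)) x * 0" using assms(4) by simp
  then show ?thesis
    unfolding cyc_prod_path[OF fin per]
    using path_prod_scale_end[of "cyc_list f x" c c x x 0] cyc_list_ne[OF fin per] by simp
qed

text \<open>The edge into \<open>i\<close> must carry a nonzero entry of column \<open>i\<close>, so
  it is the loop at \<open>i\<close> and only permutations fixing \<open>i\<close>
  contribute.\<close>

lemma cdet_on_unit_column: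
  assumes fin: "finite S" and i: "i \<in> S" and herm: "herm_on (S - {i}) c"
    and unit: "\<And>a. a \<in> S \<Longrightarrow> c a i = (if a = i then 1 else 0)"
  shows "cdet_on S c i = qreal (herm_det (S - {i}) c)"
proof -
  have "cdet_on S c i = (\<Sum>f | f permutes S - {i}. qreal (wgt S c {i} f) * cyc_prod c f i)"
    unfolding cdet_on_wgt[OF fin i herm]
  proof (rule sum.mono_neutral_right)
    show "{f. f permutes S - {i}} \<subseteq> {f. f permutes S}" using permutes_subset[of _ "S - {i}" S] by blast
    show "\<forall>f\<in>{f. f permutes S} - {f. f permutes S - {i}}. qreal (wgt S c {i} f) * cyc_prod c f i = 0"
    proof
      fix f assume f: "f \<in> {f. f permutes S} - {f. f permutes S - {i}}"
      then have per: "f permutes S" by simp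
      have "f i \<noteq> i"
      proof
        assume "f i = i"
        then have "f permutes S - {i}" using per permutes_superset[OF per, of "S - {i}"] by auto
        then show False using f by simp
      qed
      then have "cyc_prod c f i = 0"
        by (intro cyc_prod_eq_0[OF fin per i]) (auto simp: unit)
      then show "qreal (wgt S c {i} f) * cyc_prod c f i = 0" by simp
    qed
  qed (use fin in simp)
  also have "\<dots> = (\<Sum>f | f permutes S - {i}. qreal (wgt (S - {i}) c {} f))"
  proof (rule sum.cong[OF refl])
    fix f assume "f \<in> {f. f permutes S - {i}}"
    then have per: "f permutes S - {i}" by simp
    then have perS: "f permutes S" by (rule permutes_subset) auto
    have "cyc_prod c f i = 1"
      unfolding cyc_prod_path[OF fin perS] orbs_fixed_point(4)[OF fin i per] using unit i by simp
    then show "qreal (wgt S c {i} f) * cyc_prod c f i = qreal (wgt (S - {i}) c {} f)"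
      using orbs_fixed_point(5)[OF fin i per, of c "{}"] by simp
  qed
  finally show ?thesis by (simp add: herm_det_wgt qreal_sum)
qed

text \<open>Here the edge into \<open>i\<close> must come from \<open>k\<close>. Composing with the
  transposition contracts it: \<open>k\<close> becomes a fixed point and its predecessor now points
  to \<open>i\<close>, still reading column \<open>k\<close>. So column \<open>k\<close> moves into
  place \<open>i\<close>, and splitting off a cycle costs the sign.\<close>

lemma cdet_on_off_unit_column:
  assumes fin: "finite S" and i: "i \<in> S" and k: "k \<in> S" and ik: "i \<noteq> k"
    and herm: "herm_on (S - {i}) c"
    and unit: "\<And>a. a \<in> S \<Longrightarrow> c a i = (if a = k then 1 else 0)"
  shows "cdet_on S c i = - cdet_on (S - {k}) (\<lambda>a b. if b = i then c a k else c a b) i"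
proof -
  define c' where "c' = (\<lambda>a b. if b = i then c a k else c a b)"
  have iS: "i \<in> S - {k}" using i ik by simp
  have herm': "herm_on (S - {k} - {i}) c'"
    unfolding herm_on_def
  proof (intro ballI)
    fix a b assume ab: "a \<in> S - {k} - {i}" "b \<in> S - {k} - {i}"
    then have "c a b = qcnj (c b a)" using herm unfolding herm_on_def by blast
    then show "c' a b = qcnj (c' b a)" using ab by (simp add: c'_def)
  qed
  have "cdet_on S c i = (\<Sum>f | f permutes S \<and> f k = i. qreal (wgt S c {i} f) * cyc_prod c f i)"
    unfolding cdet_on_wgt[OF fin i herm]
  proof (rule sum.mono_neutral_right)
    show "\<forall>f\<in>{f. f permutes S} - {f. f permutes S \<and> f k = i}. qreal (wgt S c {i} f) * cyc_prod c f i = 0"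
    proof
      fix f assume f: "f \<in> {f. f permutes S} - {f. f permutes S \<and> f k = i}"
      then have per: "f permutes S" and "f k \<noteq> i" by auto
      then have "cyc_prod c f i = 0"
        by (intro cyc_prod_eq_0[OF fin per i]) (auto simp: unit)
      then show "qreal (wgt S c {i} f) * cyc_prod c f i = 0" by simp
    qed
  qed (use fin in auto)
  also have "\<dots> = (\<Sum>f | f permutes S - {k}. qreal (wgt S c {i} (transpose i k \<circ> f)) * cyc_prod c (transpose i k \<circ> f) i)"
  proof (rule sum.reindex_bij_witness[of _ "\<lambda>f. transpose i k \<circ> f" "\<lambda>f. transpose i k \<circ> f"])
    fix f assume f: "f \<in> {f. f permutes S \<and> f k = i}"
    then have "transpose i k \<circ> f permutes S" using joined_permutes[OF fin _ i k] by blast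
    then have "transpose i k \<circ> f permutes S - {k}"
      by (rule permutes_superset) (use f in auto)
    then show "transpose i k \<circ> f \<in> {f. f permutes S - {k}}" by simp
  next
    fix f assume f: "f \<in> {f. f permutes S - {k}}"
    then have "f permutes S" using permutes_subset[of f "S - {k}" S] by blast
    then have "transpose i k \<circ> f permutes S" by (rule joined_permutes[OF fin _ i k])
    moreover have "f k = k" using f permutes_not_in[of f "S - {k}" k] by simp
    ultimately show "transpose i k \<circ> f \<in> {f. f permutes S \<and> f k = i}" by simp
  qed (auto simp: comp_assoc[symmetric])
  also have "\<dots> = (\<Sum>f | f permutes S - {k}. - (qreal (wgt (S - {k}) c' {i} f) * cyc_prod c' f i))"
  proof (rule sum.cong[OF refl])
    fix f assume "f \<in> {f. f permutes S - {k}}"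
    then have per: "f permutes S - {k}" by simp
    then have perS: "f permutes S" by (rule permutes_subset) auto
    have fin': "finite (S - {k})" using fin by simp
    have sep: "k \<notin> orbit_set f i" using orbit_set_subset[OF fin' per iS] by blast
    have "wgt S c {i, k} f = wgt (S - {k}) c {i} f"
      using orbs_fixed_point(5)[OF fin k per, of c "{i}"] by (simp add: insert_commute)
    also have "\<dots> = wgt (S - {k}) c' {i} f"
      by (rule wgt_cong[OF fin' per]) (auto simp: c'_def)
    finally have w: "wgt S c {i} (transpose i k \<circ> f) = - wgt (S - {k}) c' {i} f"
      using wgt_joined[OF fin perS i k sep] by simp
    have "i \<notin> set (tl (cyc_list f i))"
      using distinct_hd_notin_tl[OF distinct_cyc_list[OF fin perS]] cyc_list_ne[OF fin perS]
        hd_cyc_list[OF fin perS] by metis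
    then have "path_prod c (cyc_list f i) k = path_prod c' (cyc_list f i) i * 1"
      by (intro path_prod_scale_end[OF cyc_list_ne[OF fin perS]]) (auto simp: c'_def)
    then have "cyc_prod c (transpose i k \<circ> f) i = cyc_prod c' f i"
      unfolding cyc_prod_joined[OF fin perS i k sep] orbs_fixed_point(4)[OF fin k per]
        cyc_prod_path[OF fin perS] using unit[OF k] by simp
    then show "qreal (wgt S c {i} (transpose i k \<circ> f)) * cyc_prod c (transpose i k \<circ> f) i
      = - (qreal (wgt (S - {k}) c' {i} f) * cyc_prod c' f i)" using w by simp
  qed
  also have "\<dots> = - cdet_on (S - {k}) c' i"
    unfolding cdet_on_wgt[OF finite_Diff[OF fin] iS herm'] by (rule sum_negf)
  finally show ?thesis unfolding c'_def .
qed

lemma cdet_on_cong: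
  assumes fin: "finite S" and i: "i \<in> S"
    and "\<And>a b. a \<in> S \<Longrightarrow> b \<in> S \<Longrightarrow> c a b = c' a b"
  shows "cdet_on S c i = cdet_on S c' i"
proof -
  have cp: "cyc_prod c f x = cyc_prod c' f x" if "f permutes S" "x \<in> S" for f x
    by (rule cyc_prod_cong[OF fin that(1)]) (use assms(3) orbit_set_subset[OF fin that] in blast)
  have m: "map (cyc_prod c f) (rev (sorted_list_of_set {s \<in> cyc_leaders S f. i \<notin> orbit_set f s}))
      = map (cyc_prod c' f) (rev (sorted_list_of_set {s \<in> cyc_leaders S f. i \<notin> orbit_set f s}))"
    if "f permutes S" for f
    using that fin by (intro map_cong refl cp) (auto simp: cyc_leaders_def)
  show ?thesis
    unfolding cdet_on_def by (rule sum.cong[OF refl]) (simp only: m cp[OF _ i] mem_Collect_eq)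
qed

text \<open>Each term ends with the cycle through \<open>i\<close>, and that cycle ends with its
  edge into \<open>i\<close>. Column \<open>i\<close> is thus read exactly once, as the rightmost
  factor, which is why the scalars stand on the right.\<close>

lemma cdet_on_column_linear:
  assumes fin: "finite S" and i: "i \<in> S"
  shows "cdet_on S (\<lambda>x y. if y = i then b x else c x y) i
    = (\<Sum>k\<in>S. cdet_on S (\<lambda>x y. if y = i then (if x = k then 1 else 0) else c x y) i * b k)"
proof -
  define u where "u b = (\<lambda>x y. if y = i then b x else c x y)" for b
  define e where "e k = (\<lambda>x. if x = k then 1 else (0::quat))" for k :: nat
  define L where "L f = rev (sorted_list_of_set {s \<in> cyc_leaders S f. i \<notin> orbit_set f s})" for f
  have others: "map (cyc_prod (u b) f) (L f) = map (cyc_prod c f) (L f)" if per: "f permutes S" for f b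
  proof (intro map_cong refl)
    fix s assume "s \<in> set (L f)"
    then have "s \<in> S" "i \<notin> orbit_set f s" using fin by (auto simp: L_def cyc_leaders_def)
    then show "cyc_prod (u b) f s = cyc_prod c f s"
      by (intro cyc_prod_cong[OF fin per]) (auto simp: u_def)
  qed
  have main: "cyc_prod (u b) f i = (\<Sum>k\<in>S. cyc_prod (u (e k)) f i * b k)" if per: "f permutes S" for f b
  proof -
    have l: "last (cyc_list f i) \<in> S"
      using i orbit_set_subset[OF fin per] orbit_set_cyc_list[OF fin per] last_in_set[OF cyc_list_ne[OF fin per]]
      by blast
    have ni: "i \<notin> set (tl (cyc_list f i))"
      using distinct_hd_notin_tl[OF distinct_cyc_list[OF fin per]] cyc_list_ne[OF fin per]
        hd_cyc_list[OF fin per] by metis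
    \<comment> \<open>\<open>last (cyc_list f i)\<close> is the predecessor of \<open>i\<close>; its
      row supplies the only entry of column \<open>i\<close> in the product.\<close>
    have scale: "cyc_prod (u b) f i = cyc_prod (u (\<lambda>_. 1)) f i * b (last (cyc_list f i))" for b
      unfolding cyc_prod_path[OF fin per]
      by (rule path_prod_scale_end[OF cyc_list_ne[OF fin per]]) (use ni in \<open>auto simp: u_def\<close>)
    have "(\<Sum>k\<in>S. cyc_prod (u (e k)) f i * b k)
      = (\<Sum>k\<in>S. if k = last (cyc_list f i) then cyc_prod (u (\<lambda>_. 1)) f i * b k else 0)"
      by (rule sum.cong[OF refl]) (subst scale, auto simp: e_def)
    also have "\<dots> = cyc_prod (u b) f i" using l fin by (simp add: scale[of b])
    finally show ?thesis by simp
  qed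
  define W where "W f = (- 1) ^ (card S - card (cyc_leaders S f)) * prod_list (map (cyc_prod c f) (L f))" for f
  have cdet: "cdet_on S (u b) i = (\<Sum>f | f permutes S. W f * cyc_prod (u b) f i)" for b
    unfolding cdet_on_def W_def L_def[symmetric]
    by (rule sum.cong[OF refl]) (simp add: others mult.assoc)
  have "cdet_on S (u b) i = (\<Sum>f | f permutes S. \<Sum>k\<in>S. W f * cyc_prod (u (e k)) f i * b k)"
    unfolding cdet
  proof (rule sum.cong[OF refl])
    fix f assume "f \<in> {f. f permutes S}"
    then have per: "f permutes S" by simp
    show "W f * cyc_prod (u b) f i = (\<Sum>k\<in>S. W f * cyc_prod (u (e k)) f i * b k)"
      unfolding main[OF per, of b] by (simp add: sum_distrib_left mult.assoc)
  qed
  also have "\<dots> = (\<Sum>k\<in>S. cdet_on S (u (e k)) i * b k)"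
    unfolding cdet by (subst sum.swap) (simp add: sum_distrib_right)
  finally show ?thesis unfolding u_def e_def .
qed

text \<open>Conjugation reverses the factors, so the cycle of \<open>i\<close> moves from the front
  to the end and the leaders appear in descending order. Passing to the inverse permutation restores
  the direction of each cycle. Row statements are obtained from column statements in this
  way.\<close>

lemma qcnj_rdet_on:
  assumes fin: "finite S"
  shows "qcnj (rdet_on S c i) = cdet_on S (\<lambda>a b. qcnj (c b a)) i"
proof -
  define c' where "c' = (\<lambda>a b. qcnj (c b a))"
  have inv: "qcnj (cyc_prod c f x) = cyc_prod c' (Hilbert_Choice.inv f) x"
    "orbit_set (Hilbert_Choice.inv f) x = orbit_set f x" if "f permutes S" for f x
    using cyc_prod_rev_on[OF fin that, of UNIV c' x] orbit_set_rev_on[OF fin that, of UNIV x]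
    by (auto simp: rev_on_UNIV c'_def)
  have lead: "cyc_leaders S (Hilbert_Choice.inv f) = cyc_leaders S f" if "f permutes S" for f
    using inv(2)[OF that] by (simp add: cyc_leaders_def)
  have "qcnj (rdet_on S c i) = (\<Sum>f | f permutes S. (- 1) ^ (card S - card (cyc_leaders S f)) *
     (prod_list (map (cyc_prod c' (Hilbert_Choice.inv f))
        (rev (sorted_list_of_set {s \<in> cyc_leaders S f. i \<notin> orbit_set f s}))) *
      cyc_prod c' (Hilbert_Choice.inv f) i))"
    unfolding rdet_on_def qcnj_sum
  proof (rule sum.cong[OF refl])
    fix f assume "f \<in> {f. f permutes S}"
    then have per: "f permutes S" by simp
    have sgn: "x * (- 1) ^ m = (- 1) ^ m * (x :: quat)" for x m
      by (metis (no_types) minus_one_power_iff mult_1_left mult_1_right mult_minus_left mult_minus_right)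
    show "qcnj ((- 1) ^ (card S - card (cyc_leaders S f)) * (cyc_prod c f i *
        prod_list (map (cyc_prod c f) (sorted_list_of_set {s \<in> cyc_leaders S f. i \<notin> orbit_set f s}))))
      = (- 1) ^ (card S - card (cyc_leaders S f)) *
       (prod_list (map (cyc_prod c' (Hilbert_Choice.inv f))
          (rev (sorted_list_of_set {s \<in> cyc_leaders S f. i \<notin> orbit_set f s}))) *
        cyc_prod c' (Hilbert_Choice.inv f) i)"
      by (simp only: qcnj_simps qcnj_power qcnj_prod_list rev_map map_map comp_def inv(1)[OF per]) (rule sgn)
  qed
  also have "\<dots> = cdet_on S c' i"
    unfolding cdet_on_def
  proof (rule sum.reindex_bij_witness[of _ Hilbert_Choice.inv Hilbert_Choice.inv])
    fix f assume "f \<in> {f. f permutes S}"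
    then have per: "f permutes S" by simp
    show "Hilbert_Choice.inv f \<in> {f. f permutes S}" using permutes_inv[OF per] by simp
    show "Hilbert_Choice.inv (Hilbert_Choice.inv f) = f" by (rule permutes_inv_inv[OF per])
    show "(- 1) ^ (card S - card (cyc_leaders S (Hilbert_Choice.inv f))) *
       (prod_list (map (cyc_prod c' (Hilbert_Choice.inv f))
          (rev (sorted_list_of_set {s \<in> cyc_leaders S (Hilbert_Choice.inv f). i \<notin> orbit_set (Hilbert_Choice.inv f) s}))) *
        cyc_prod c' (Hilbert_Choice.inv f) i)
      = (- 1) ^ (card S - card (cyc_leaders S f)) *
       (prod_list (map (cyc_prod c' (Hilbert_Choice.inv f))
          (rev (sorted_list_of_set {s \<in> cyc_leaders S f. i \<notin> orbit_set f s}))) *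
        cyc_prod c' (Hilbert_Choice.inv f) i)"
      by (simp add: lead[OF per] inv(2)[OF per])
  qed (auto intro: permutes_inv permutes_inv_inv)
  finally show ?thesis unfolding c'_def .
qed

lemma hdet_on_hermitian:
  assumes fin: "finite S" and ne: "S \<noteq> {}" and herm: "herm_on S c"
  shows "hdet_on S c = qreal (herm_det S c)"
proof -
  have m: "Min S \<in> S" using fin ne by simp
  have "qcnj (hdet_on S c) = cdet_on S (\<lambda>a b. qcnj (c b a)) (Min S)"
    unfolding hdet_on_def by (rule qcnj_rdet_on[OF fin])
  also have "\<dots> = cdet_on S c (Min S)"
    by (rule cdet_on_cong[OF fin m]) (metis herm herm_on_def)
  also have "\<dots> = qcnj (qreal (herm_det S c))" using cdet_on_hermitian[OF fin m herm] by simp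
  finally show ?thesis by (simp only: qcnj_eq_iff)
qed

subsection \<open>Quaternion matrices\<close>

lemma mult_entry:
  assumes "A \<in> carrier_mat m n" "B \<in> carrier_mat n k" "i < m" "j < k"
  shows "(A * B) $$ (i, j) = (\<Sum>l<n. A $$ (i, l) * B $$ (l, j))"
  using assms by (auto simp: scalar_prod_def lessThan_atLeast0 intro!: sum.cong)

lemma ctrans_carrier [simp]: "A \<in> carrier_mat m n \<Longrightarrow> ctrans A \<in> carrier_mat n m"
  by (auto simp: ctrans_def)

lemma ctrans_ctrans [simp]: "ctrans (ctrans A) = A"
  by (rule eq_matI) (auto simp: ctrans_def)

lemma ctrans_zero [simp]: "ctrans (0\<^sub>m m n) = 0\<^sub>m n m"
  by (rule eq_matI) (auto simp: ctrans_def)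

lemma ctrans_one [simp]: "ctrans (1\<^sub>m n) = 1\<^sub>m n"
  by (rule eq_matI) (auto simp: ctrans_def)

lemma ctrans_minus:
  assumes "A \<in> carrier_mat m n" "B \<in> carrier_mat m n"
  shows "ctrans (A - B) = ctrans A - ctrans B"
  using assms by (intro eq_matI) (auto simp: ctrans_def)

lemma ctrans_smult [simp]: "ctrans (qreal a \<cdot>\<^sub>m A) = qreal a \<cdot>\<^sub>m ctrans A"
  by (rule eq_matI) (auto simp: ctrans_def qreal_commute)

lemma ctrans_mult:
  assumes "A \<in> carrier_mat m n" "B \<in> carrier_mat n k"
  shows "ctrans (A * B) = ctrans B * ctrans A"
proof (rule eq_matI)
  fix i j assume "i < dim_row (ctrans B * ctrans A)" "j < dim_col (ctrans B * ctrans A)"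
  then have ij: "i < k" "j < m" using assms by (auto simp: ctrans_def)
  then have "ctrans (A * B) $$ (i, j) = qcnj ((A * B) $$ (j, i))" using assms by (simp add: ctrans_def)
  also have "\<dots> = (\<Sum>l<n. qcnj (B $$ (l, i)) * qcnj (A $$ (j, l)))"
    using ij by (simp add: mult_entry[OF assms] qcnj_sum)
  also have "\<dots> = (\<Sum>l<n. ctrans B $$ (i, l) * ctrans A $$ (l, j))"
    using assms ij by (intro sum.cong) (auto simp: ctrans_def)
  also have "\<dots> = (ctrans B * ctrans A) $$ (i, j)"
    using ij assms by (intro mult_entry[symmetric]) auto
  finally show "ctrans (A * B) $$ (i, j) = (ctrans B * ctrans A) $$ (i, j)" .
qed (use assms in \<open>auto simp: ctrans_def\<close>)

lemma smult_mult_left: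
  assumes "A \<in> carrier_mat m n" "B \<in> carrier_mat n k"
  shows "(x \<cdot>\<^sub>m A) * B = x \<cdot>\<^sub>m (A * B)"
proof (rule eq_matI)
  fix i j assume "i < dim_row (x \<cdot>\<^sub>m (A * B))" "j < dim_col (x \<cdot>\<^sub>m (A * B))"
  then have ij: "i < m" "j < k" using assms by auto
  have "((x \<cdot>\<^sub>m A) * B) $$ (i, j) = (\<Sum>l<n. (x \<cdot>\<^sub>m A) $$ (i, l) * B $$ (l, j))"
    by (rule mult_entry) (use assms ij in auto)
  also have "\<dots> = x * (\<Sum>l<n. A $$ (i, l) * B $$ (l, j))"
    using assms ij by (auto simp: sum_distrib_left mult.assoc intro!: sum.cong)
  finally show "((x \<cdot>\<^sub>m A) * B) $$ (i, j) = (x \<cdot>\<^sub>m (A * B)) $$ (i, j)"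
    using assms ij by (simp add: mult_entry[OF assms] del: index_mult_mat(1))
qed (use assms in auto)

text \<open>Scalars act from the left; moving one past \<open>A\<close> requires it to be central,
  hence real.\<close>

lemma smult_mult_right:
  assumes "A \<in> carrier_mat m n" "B \<in> carrier_mat n k"
  shows "A * (qreal a \<cdot>\<^sub>m B) = qreal a \<cdot>\<^sub>m (A * B)"
proof (rule eq_matI)
  fix i j assume "i < dim_row (qreal a \<cdot>\<^sub>m (A * B))" "j < dim_col (qreal a \<cdot>\<^sub>m (A * B))"
  then have ij: "i < m" "j < k" using assms by auto
  have "(A * (qreal a \<cdot>\<^sub>m B)) $$ (i, j) = (\<Sum>l<n. A $$ (i, l) * (qreal a \<cdot>\<^sub>m B) $$ (l, j))"
    by (rule mult_entry) (use assms ij in auto)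
  also have "\<dots> = (\<Sum>l<n. qreal a * (A $$ (i, l) * B $$ (l, j)))"
    using assms ij by (intro sum.cong) (auto simp: mult.assoc[symmetric] qreal_commute)
  also have "\<dots> = qreal a * (\<Sum>l<n. A $$ (i, l) * B $$ (l, j))" by (simp add: sum_distrib_left)
  finally show "(A * (qreal a \<cdot>\<^sub>m B)) $$ (i, j) = (qreal a \<cdot>\<^sub>m (A * B)) $$ (i, j)"
    using assms ij by (simp add: mult_entry[OF assms] del: index_mult_mat(1))
qed (use assms in auto)

lemma smult_smult_qreal: "qreal a \<cdot>\<^sub>m (qreal b \<cdot>\<^sub>m A) = qreal (a * b) \<cdot>\<^sub>m A"
  by (rule eq_matI) (auto simp: mult.assoc)

lemma smult_one_qreal [simp]: "1 \<cdot>\<^sub>m (A :: quat mat) = A"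
  by (rule eq_matI) auto

lemma zero_smult_qreal: "A \<in> carrier_mat m n \<Longrightarrow> (0 :: quat) \<cdot>\<^sub>m A = 0\<^sub>m m n"
  by (rule eq_matI) auto

lemma minus_eq_zero_mat:
  fixes A B :: "quat mat"
  assumes "A \<in> carrier_mat m n" "B \<in> carrier_mat m n" "A - B = 0\<^sub>m m n"
  shows "A = B"
proof (rule eq_matI)
  fix i j assume "i < dim_row B" "j < dim_col B"
  then have "(A - B) $$ (i, j) = 0" "i < m" "j < n" using assms by auto
  then show "A $$ (i, j) = B $$ (i, j)" using assms(1,2) by simp
qed (use assms in auto)

text \<open>Each diagonal entry of the Gram matrix is the sum of the squared norms of the entries in
  one column.\<close>

lemma gram_eq_zero:
  assumes Z: "Z \<in> carrier_mat m k" and 0: "ctrans Z * Z = 0\<^sub>m k k"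
  shows "Z = 0\<^sub>m m k"
proof (rule eq_matI)
  fix i j assume "i < dim_row (0\<^sub>m m k)" "j < dim_col (0\<^sub>m m k)"
  then have ij: "i < m" "j < k" by auto
  have "(\<Sum>l<m. qre (qcnj (Z $$ (l, j)) * Z $$ (l, j))) = qre ((ctrans Z * Z) $$ (j, j))"
    using Z ij by (subst mult_entry[OF ctrans_carrier[OF Z] Z]) (auto simp: qre_sum ctrans_def intro!: sum.cong)
  also have "\<dots> = 0" using ij by (simp add: 0)
  finally have "\<forall>l\<in>{..<m}. qre (qcnj (Z $$ (l, j)) * Z $$ (l, j)) = 0"
    by (subst (asm) sum_nonneg_eq_0_iff) (auto simp: qre_cnj_mult_nonneg)
  then show "Z $$ (i, j) = 0\<^sub>m m k $$ (i, j)" using ij by (simp add: qre_cnj_mult_eq_0_iff)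
qed (use Z in auto)

text \<open>The real part is taken because the quaternion-valued trace is not invariant under
  exchanging two factors.\<close>

definition qtr :: "quat mat \<Rightarrow> real" where
  "qtr A = (\<Sum>i<dim_row A. qre (A $$ (i, i)))"

lemma qtr_mult_commute:
  assumes "A \<in> carrier_mat m n" "B \<in> carrier_mat n m"
  shows "qtr (A * B) = qtr (B * A)"
proof -
  have "qtr (A * B) = (\<Sum>i<m. \<Sum>l<n. qre (A $$ (i, l) * B $$ (l, i)))"
    using assms by (auto simp: qtr_def mult_entry[OF assms] qre_sum simp del: index_mult_mat(1) intro!: sum.cong)
  also have "\<dots> = (\<Sum>l<n. \<Sum>i<m. qre (B $$ (l, i) * A $$ (i, l)))"
    by (subst sum.swap) (simp add: qre_mult_commute)
  also have "\<dots> = qtr (B * A)"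
    using assms by (auto simp: qtr_def mult_entry[OF assms(2,1)] qre_sum simp del: index_mult_mat(1) intro!: sum.cong)
  finally show ?thesis .
qed

lemma qtr_smult: "A \<in> carrier_mat n n \<Longrightarrow> qtr (qreal a \<cdot>\<^sub>m A) = a * qtr A"
  by (auto simp: qtr_def sum_distrib_left intro!: sum.cong)

subsection \<open>The rank as the trace of a projection\<close>

text \<open>Adjoining a further column to a largest independent set creates a relation; the new
  column has a nonzero, hence invertible, coefficient there and can be solved for.
  \<open>v j\<close> holds the coordinates of column \<open>j\<close>.\<close>

lemma qrank_basis:
  assumes C: "C \<in> carrier_mat m n"
  obtains S v where "S \<subseteq> {..<n}" "card S = qrank C" "right_indep_cols C S"
    "\<And>i j. i < m \<Longrightarrow> j < n \<Longrightarrow> C $$ (i, j) = (\<Sum>k\<in>S. C $$ (i, k) * v j k)"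
proof -
  define R where "R = {card S | S. S \<subseteq> {0..<dim_col C} \<and> right_indep_cols C S}"
  have "R \<subseteq> card ` Pow {0..<dim_col C}" by (auto simp: R_def)
  then have finR: "finite R" by (rule finite_subset) simp
  have "right_indep_cols C {}" by (simp add: right_indep_cols_def)
  then have "0 \<in> R" by (force simp: R_def)
  then have "Max R \<in> R" using finR by (intro Max_in) auto
  then obtain S where S: "S \<subseteq> {0..<dim_col C}" "right_indep_cols C S" "card S = qrank C"
    by (auto simp: R_def qrank_def)
  have finS: "finite S" using S(1) by (rule finite_subset) simp
  have "\<exists>w. \<forall>i<m. C $$ (i, j) = (\<Sum>k\<in>S. C $$ (i, k) * w k)" if j: "j < n" for j
  proof (cases "j \<in> S")
    case True
    have "C $$ (i, j) = (\<Sum>k\<in>S. C $$ (i, k) * (if k = j then 1 else 0))" for i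
      using True finS by (simp add: if_distrib[of "\<lambda>x. _ * x"] cong: if_cong)
    then show ?thesis by (intro exI[of _ "\<lambda>k. if k = j then 1 else 0"] allI impI)
  next
    case False
    have "\<not> right_indep_cols C (insert j S)"
    proof
      assume "right_indep_cols C (insert j S)"
      moreover have "insert j S \<subseteq> {0..<dim_col C}" using j S(1) C by auto
      ultimately have "card (insert j S) \<in> R" unfolding R_def by blast
      then have "card (insert j S) \<le> Max R" using finR by simp
      then show False using False finS S(3) by (simp add: qrank_def R_def)
    qed
    then obtain c where c: "\<And>i. i < m \<Longrightarrow> (\<Sum>k\<in>insert j S. C $$ (i, k) * c k) = 0"
      "\<exists>k\<in>insert j S. c k \<noteq> 0"
      using C unfolding right_indep_cols_def by auto
    have c': "C $$ (i, j) * c j + (\<Sum>k\<in>S. C $$ (i, k) * c k) = 0" if "i < m" for i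
      using c(1)[OF that] False finS by simp
    have cj: "c j \<noteq> 0"
    proof
      assume 0: "c j = 0"
      then have "\<forall>i<dim_row C. (\<Sum>k\<in>S. C $$ (i, k) * c k) = 0" using c' C by simp
      then have "\<forall>k\<in>S. c k = 0" using S(2) unfolding right_indep_cols_def by blast
      then show False using c(2) 0 by auto
    qed
    have "C $$ (i, j) = (\<Sum>k\<in>S. C $$ (i, k) * (- c k * inverse (c j)))" if "i < m" for i
    proof -
      have "C $$ (i, j) * c j = - (\<Sum>k\<in>S. C $$ (i, k) * c k)"
        using c'[OF that] by (simp add: eq_neg_iff_add_eq_0)
      then have "C $$ (i, j) * c j * inverse (c j) = - (\<Sum>k\<in>S. C $$ (i, k) * c k) * inverse (c j)" by simp
      then show ?thesis using cj by (simp add: mult.assoc sum_distrib_right sum_negf)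
    qed
    then show ?thesis by (intro exI[of _ "\<lambda>k. - c k * inverse (c j)"] allI impI)
  qed
  then have "\<forall>j. \<exists>w. j < n \<longrightarrow> (\<forall>i<m. C $$ (i, j) = (\<Sum>k\<in>S. C $$ (i, k) * w k))" by blast
  then obtain v where v: "\<forall>j. j < n \<longrightarrow> (\<forall>i<m. C $$ (i, j) = (\<Sum>k\<in>S. C $$ (i, k) * v j k))"
    using choice[of "\<lambda>j w. j < n \<longrightarrow> (\<forall>i<m. C $$ (i, j) = (\<Sum>k\<in>S. C $$ (i, k) * w k))"] by blast
  show thesis
  proof (rule that[OF _ S(3) S(2)])
    show "S \<subseteq> {..<n}" using S(1) C by auto
    show "C $$ (i, j) = (\<Sum>k\<in>S. C $$ (i, k) * v j k)" if "i < m" "j < n" for i j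
      using v that by blast
  qed
qed

text \<open>Write C = C' V, with C' the independent columns, and put W = V G. Then C G = C' W, and C
  G C = C forces W C' = I by independence. The real trace of C' W equals that of W C', the number of
  independent columns.\<close>

lemma qrank_eq_trace:
  assumes C: "C \<in> carrier_mat m n" and G: "G \<in> carrier_mat n m" and CGC: "C * G * C = C"
  shows "qtr (C * G) = real (qrank C)"
proof -
  obtain S v where S: "S \<subseteq> {..<n}" "card S = qrank C" "right_indep_cols C S"
    and v: "\<And>i j. i < m \<Longrightarrow> j < n \<Longrightarrow> C $$ (i, j) = (\<Sum>k\<in>S. C $$ (i, k) * v j k)"
    by (rule qrank_basis[OF C]) blast
  have finS: "finite S" using S(1) by (rule finite_subset) simp
  define W where "W k i = (\<Sum>j<n. v j k * G $$ (j, i))" for k i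
  define T where "T k l = (\<Sum>i<m. W k i * C $$ (i, l))" for k l
  have CG: "(C * G) $$ (a, i) = (\<Sum>k\<in>S. C $$ (a, k) * W k i)" if "a < m" "i < m" for a i
  proof -
    have "(C * G) $$ (a, i) = (\<Sum>j<n. C $$ (a, j) * G $$ (j, i))" by (rule mult_entry[OF C G that])
    also have "\<dots> = (\<Sum>j<n. \<Sum>k\<in>S. C $$ (a, k) * (v j k * G $$ (j, i)))"
    proof (rule sum.cong[OF refl])
      fix j assume "j \<in> {..<n}"
      then have "C $$ (a, j) * G $$ (j, i) = (\<Sum>k\<in>S. C $$ (a, k) * v j k) * G $$ (j, i)"
        using v[OF that(1), of j] by simp
      then show "C $$ (a, j) * G $$ (j, i) = (\<Sum>k\<in>S. C $$ (a, k) * (v j k * G $$ (j, i)))"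
        by (simp add: sum_distrib_right mult.assoc)
    qed
    also have "\<dots> = (\<Sum>k\<in>S. C $$ (a, k) * W k i)"
      by (subst sum.swap) (simp add: W_def sum_distrib_left)
    finally show ?thesis .
  qed
  have T1: "T k l = (if k = l then 1 else 0)" if kl: "k \<in> S" "l \<in> S" for k l
  proof -
    have l: "l < n" using kl S by auto
    have "(\<Sum>k\<in>S. C $$ (a, k) * (T k l - (if k = l then 1 else 0))) = 0" if a: "a < dim_row C" for a
    proof -
      have a': "a < m" using a C by simp
      have "C $$ (a, l) = (\<Sum>i<m. (C * G) $$ (a, i) * C $$ (i, l))"
        using mult_entry[OF mult_carrier_mat[OF C G] C a' l] CGC by simp
      also have "\<dots> = (\<Sum>i<m. \<Sum>k\<in>S. C $$ (a, k) * (W k i * C $$ (i, l)))"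
        by (rule sum.cong[OF refl]) (simp add: CG[OF a'] sum_distrib_right mult.assoc del: index_mult_mat(1))
      also have "\<dots> = (\<Sum>k\<in>S. C $$ (a, k) * T k l)"
        by (subst sum.swap) (simp add: T_def sum_distrib_left)
      finally have "(\<Sum>k\<in>S. C $$ (a, k) * T k l) = C $$ (a, l)" by simp
      moreover have "(\<Sum>k\<in>S. C $$ (a, k) * (if k = l then 1 else 0)) = C $$ (a, l)"
        using kl finS by (simp add: if_distrib[of "\<lambda>x. _ * x"] cong: if_cong)
      ultimately show ?thesis by (simp only: right_diff_distrib sum_subtractf right_minus_eq)
    qed
    then have "\<forall>k\<in>S. T k l - (if k = l then 1 else 0) = 0"
      using S(3)[unfolded right_indep_cols_def, rule_format, of "\<lambda>k. T k l - (if k = l then 1 else 0)"] by blast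
    then have "T k l - (if k = l then 1 else 0) = 0" using kl(1) by (rule bspec)
    then show ?thesis by (simp only: right_minus_eq)
  qed
  have "qtr (C * G) = (\<Sum>i<m. \<Sum>k\<in>S. qre (C $$ (i, k) * W k i))"
    using C G by (auto simp: qtr_def CG qre_sum simp del: index_mult_mat(1) intro!: sum.cong)
  also have "\<dots> = (\<Sum>k\<in>S. \<Sum>i<m. qre (W k i * C $$ (i, k)))"
    by (subst sum.swap) (simp add: qre_mult_commute)
  also have "\<dots> = (\<Sum>k\<in>S. qre (T k k))" by (simp add: T_def qre_sum)
  also have "\<dots> = real (qrank C)" using T1 S(2) by simp
  finally show ?thesis .
qed

subsection \<open>Cofactor matrices of a Hermitian matrix\<close>

text \<open>Row \<open>i\<close> collects the coefficients of the vector \<open>b\<close> in the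
  numerator of the theorem that replaces column \<open>i\<close> by \<open>b\<close>; see
  \<open>cofmat_apply\<close>.\<close>

definition cofmat :: "nat \<Rightarrow> quat mat \<Rightarrow> nat \<Rightarrow> quat mat" where
  "cofmat n H s = mat n n (\<lambda>(i, k).
     \<Sum>\<beta>\<in>idx_sets_with s n i. cdet_on \<beta> (col_repl H i (\<lambda>r. if r = k then 1 else 0)) i)"

definition minor_sum :: "nat \<Rightarrow> quat mat \<Rightarrow> nat \<Rightarrow> real" where
  "minor_sum n H s = (\<Sum>\<beta>\<in>idx_sets s n. herm_det \<beta> (ent H))"

lemma cofmat_carrier [simp]: "cofmat n H s \<in> carrier_mat n n"
  by (simp add: cofmat_def)

lemma cofmat_dim [simp]: "dim_row (cofmat n H s) = n" "dim_col (cofmat n H s) = n"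
  by (simp_all add: cofmat_def)

lemma finite_idx_sets [simp]: "finite (idx_sets s n)" "finite (idx_sets_with s n i)"
  unfolding idx_sets_def idx_sets_with_def by (auto intro: finite_subset[of _ "Pow {0..<n}"])

lemma idx_sets_withD:
  "\<beta> \<in> idx_sets_with s n i \<Longrightarrow> finite \<beta> \<and> i \<in> \<beta> \<and> \<beta> \<subseteq> {0..<n} \<and> card \<beta> = s"
  unfolding idx_sets_with_def by (auto intro: finite_subset)

lemma col_repl_eq: "col_repl H i b = (\<lambda>x y. if y = i then b x else ent H x y)"
  by (auto simp: col_repl_def ent_def fun_eq_iff)

lemma herm_on_ent:
  assumes "H \<in> carrier_mat n n" "ctrans H = H" "S \<subseteq> {0..<n}"
  shows "herm_on S (ent H)"
  unfolding herm_on_def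
proof (intro ballI)
  fix a b assume "a \<in> S" "b \<in> S"
  then have ab: "a < n" "b < n" using assms(3) by auto
  have "H $$ (a, b) = ctrans H $$ (a, b)" using assms(2) by simp
  also have "\<dots> = qcnj (H $$ (b, a))" using assms(1) ab by (simp add: ctrans_def)
  finally show "ent H a b = qcnj (ent H b a)" by (simp add: ent_def)
qed

lemma herm_on_col_repl:
  assumes "H \<in> carrier_mat n n" "ctrans H = H" "S \<subseteq> {0..<n}"
  shows "herm_on (S - {i}) (col_repl H i b)"
  unfolding herm_on_def
proof (intro ballI)
  fix a b' assume ab: "a \<in> S - {i}" "b' \<in> S - {i}"
  then have "ent H a b' = qcnj (ent H b' a)" using herm_on_ent[OF assms] unfolding herm_on_def by blast
  then show "col_repl H i b a b' = qcnj (col_repl H i b b' a)" using ab by (simp add: col_repl_eq)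
qed

lemma herm_det_cong:
  assumes "finite S" "\<And>a b. a \<in> S \<Longrightarrow> b \<in> S \<Longrightarrow> c a b = c' a b"
  shows "herm_det S c = herm_det S c'"
  unfolding herm_det_wgt by (intro sum.cong refl wgt_cong) (use assms in auto)

lemma cofmat_apply:
  assumes i: "i < n"
  shows "(\<Sum>\<beta>\<in>idx_sets_with s n i. cdet_on \<beta> (col_repl H i b) i) = (\<Sum>k<n. cofmat n H s $$ (i, k) * b k)"
proof -
  let ?e = "\<lambda>k r. if r = k then 1 else (0 :: quat)"
  have "cdet_on \<beta> (col_repl H i b) i = (\<Sum>k<n. cdet_on \<beta> (col_repl H i (?e k)) i * b k)"
    if "\<beta> \<in> idx_sets_with s n i" for \<beta>
  proof -
    have \<beta>: "finite \<beta>" "i \<in> \<beta>" "\<beta> \<subseteq> {0..<n}" using idx_sets_withD[OF that] by auto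
    note lin = cdet_on_column_linear[OF \<beta>(1,2), of _ "ent H", folded col_repl_eq]
    \<comment> \<open>A unit vector supported outside \<beta> restricts to the zero column, so the
      sum over \<beta> extends to all indices below \<open>n\<close>.\<close>
    have z: "cdet_on \<beta> (col_repl H i (?e k)) i = 0" if "k \<notin> \<beta>" for k
      unfolding lin[of "?e k"] using that by (intro sum.neutral) auto
    have "cdet_on \<beta> (col_repl H i b) i = (\<Sum>k\<in>\<beta>. cdet_on \<beta> (col_repl H i (?e k)) i * b k)"
      by (rule lin)
    also have "\<dots> = (\<Sum>k<n. cdet_on \<beta> (col_repl H i (?e k)) i * b k)"
      by (rule sum.mono_neutral_left) (use \<beta> z in auto)
    finally show ?thesis .
  qed
  then have "(\<Sum>\<beta>\<in>idx_sets_with s n i. cdet_on \<beta> (col_repl H i b) i)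
    = (\<Sum>\<beta>\<in>idx_sets_with s n i. \<Sum>k<n. cdet_on \<beta> (col_repl H i (?e k)) i * b k)"
    by (rule sum.cong[OF refl])
  also have "\<dots> = (\<Sum>k<n. cofmat n H s $$ (i, k) * b k)"
    using i by (subst sum.swap) (simp add: cofmat_def sum_distrib_right)
  finally show ?thesis .
qed

context
  fixes H :: "quat mat" and n :: nat
  assumes H: "H \<in> carrier_mat n n" and herm: "ctrans H = H"
begin

text \<open>Column \<open>i\<close> is replaced by column \<open>k\<close> of \<open>H\<close>
  itself. For \<open>k = i\<close> nothing changes and minors appear; for \<beta> containing some
  other \<open>k\<close> two columns agree.\<close>

lemma cofmat_mult_entry:
  assumes "i < n" "k < n"
  shows "(cofmat n H s * H) $$ (i, k)
    = (\<Sum>\<beta>\<in>idx_sets_with s n i. cdet_on \<beta> (col_repl H i (\<lambda>r. H $$ (r, k))) i)"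
  unfolding cofmat_apply[OF assms(1)] by (rule mult_entry[OF cofmat_carrier H assms])

lemma cofmat_mult_diag:
  assumes i: "i < n"
  shows "(cofmat n H s * H) $$ (i, i) = (\<Sum>\<beta>\<in>idx_sets_with s n i. qreal (herm_det \<beta> (ent H)))"
  unfolding cofmat_mult_entry[OF i i]
proof (rule sum.cong[OF refl])
  fix \<beta> assume "\<beta> \<in> idx_sets_with s n i"
  then have \<beta>: "finite \<beta>" "i \<in> \<beta>" "\<beta> \<subseteq> {0..<n}" by (auto dest!: idx_sets_withD)
  have "col_repl H i (\<lambda>r. H $$ (r, i)) = ent H" by (auto simp: col_repl_def ent_def fun_eq_iff)
  then show "cdet_on \<beta> (col_repl H i (\<lambda>r. H $$ (r, i))) i = qreal (herm_det \<beta> (ent H))"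
    using cdet_on_hermitian[OF \<beta>(1,2) herm_on_ent[OF H herm \<beta>(3)]] by simp
qed

text \<open>\<open>cofmat_mult_diag\<close> sums the minors of order \<open>s\<close> that contain
  \<open>i\<close>, this lemma those that avoid \<open>i\<close>; together they exhaust
  \<open>minor_sum\<close>.\<close>

lemma cofmat_diag:
  assumes i: "i < n"
  shows "cofmat n H (Suc s) $$ (i, i) = (\<Sum>\<beta>\<in>{\<beta> \<in> idx_sets s n. i \<notin> \<beta>}. qreal (herm_det \<beta> (ent H)))"
proof -
  have "cofmat n H (Suc s) $$ (i, i)
    = (\<Sum>\<gamma>\<in>idx_sets_with (Suc s) n i. cdet_on \<gamma> (col_repl H i (\<lambda>r. if r = i then 1 else 0)) i)"
    using i by (simp add: cofmat_def)
  also have "\<dots> = (\<Sum>\<gamma>\<in>idx_sets_with (Suc s) n i. qreal (herm_det (\<gamma> - {i}) (ent H)))"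
  proof (rule sum.cong[OF refl])
    fix \<gamma> assume "\<gamma> \<in> idx_sets_with (Suc s) n i"
    then have \<gamma>: "finite \<gamma>" "i \<in> \<gamma>" "\<gamma> \<subseteq> {0..<n}" by (auto dest!: idx_sets_withD)
    have "cdet_on \<gamma> (col_repl H i (\<lambda>r. if r = i then 1 else 0)) i
      = qreal (herm_det (\<gamma> - {i}) (col_repl H i (\<lambda>r. if r = i then 1 else 0)))"
      by (rule cdet_on_unit_column[OF \<gamma>(1,2) herm_on_col_repl[OF H herm \<gamma>(3)]]) (simp add: col_repl_def)
    also have "herm_det (\<gamma> - {i}) (col_repl H i (\<lambda>r. if r = i then 1 else 0)) = herm_det (\<gamma> - {i}) (ent H)"
      by (rule herm_det_cong) (use \<gamma> in \<open>auto simp: col_repl_eq\<close>)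
    finally show "cdet_on \<gamma> (col_repl H i (\<lambda>r. if r = i then 1 else 0)) i
      = qreal (herm_det (\<gamma> - {i}) (ent H))" .
  qed
  also have "\<dots> = (\<Sum>\<beta>\<in>{\<beta> \<in> idx_sets s n. i \<notin> \<beta>}. qreal (herm_det \<beta> (ent H)))"
  proof (rule sum.reindex_bij_witness[of _ "insert i" "\<lambda>\<gamma>. \<gamma> - {i}"])
    fix \<gamma> assume "\<gamma> \<in> idx_sets_with (Suc s) n i"
    from idx_sets_withD[OF this]
    show "insert i (\<gamma> - {i}) = \<gamma>" "\<gamma> - {i} \<in> {\<beta> \<in> idx_sets s n. i \<notin> \<beta>}"
      by (auto simp: idx_sets_def)
  next
    fix \<beta> assume \<beta>: "\<beta> \<in> {\<beta> \<in> idx_sets s n. i \<notin> \<beta>}"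
    then show "insert i \<beta> - {i} = \<beta>" by auto
    have "finite \<beta>" using \<beta> by (auto simp: idx_sets_def intro: finite_subset)
    then show "insert i \<beta> \<in> idx_sets_with (Suc s) n i"
      using \<beta> i by (auto simp: idx_sets_def idx_sets_with_def)
  qed auto
  finally show ?thesis .
qed

text \<open>Deleting \<open>k\<close> from an index set moves column \<open>k\<close> of
  \<open>H\<close> into place \<open>i\<close>. Only sets avoiding \<open>k\<close> arise, but those
  containing \<open>k\<close> have two equal columns, so adding them completes the entry of the
  product at no cost.\<close>

lemma cofmat_off_diag:
  assumes i: "i < n" and k: "k < n" and ik: "i \<noteq> k"
  shows "cofmat n H (Suc s) $$ (i, k) = - (cofmat n H s * H) $$ (i, k)"
proof -
  let ?e = "\<lambda>r. if r = k then 1 else (0 :: quat)"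
  let ?h = "\<lambda>r. H $$ (r, k)"
  have "cofmat n H (Suc s) $$ (i, k) = (\<Sum>\<gamma>\<in>idx_sets_with (Suc s) n i. cdet_on \<gamma> (col_repl H i ?e) i)"
    using i k by (simp add: cofmat_def)
  also have "\<dots> = (\<Sum>\<gamma>\<in>{\<gamma> \<in> idx_sets_with (Suc s) n i. k \<in> \<gamma>}. cdet_on \<gamma> (col_repl H i ?e) i)"
  proof (rule sum.mono_neutral_right)
    show "\<forall>\<gamma>\<in>idx_sets_with (Suc s) n i - {\<gamma> \<in> idx_sets_with (Suc s) n i. k \<in> \<gamma>}.
      cdet_on \<gamma> (col_repl H i ?e) i = 0"
    proof
      fix \<gamma> assume "\<gamma> \<in> idx_sets_with (Suc s) n i - {\<gamma> \<in> idx_sets_with (Suc s) n i. k \<in> \<gamma>}"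
      then have \<gamma>: "finite \<gamma>" "i \<in> \<gamma>" "k \<notin> \<gamma>" by (auto dest!: idx_sets_withD)
      show "cdet_on \<gamma> (col_repl H i ?e) i = 0"
        unfolding col_repl_eq cdet_on_column_linear[OF \<gamma>(1,2), of ?e "ent H"]
        using \<gamma>(3) by (intro sum.neutral) auto
    qed
  qed auto
  also have "\<dots> = (\<Sum>\<gamma>\<in>{\<gamma> \<in> idx_sets_with (Suc s) n i. k \<in> \<gamma>}. - cdet_on (\<gamma> - {k}) (col_repl H i ?h) i)"
  proof (rule sum.cong[OF refl])
    fix \<gamma> assume "\<gamma> \<in> {\<gamma> \<in> idx_sets_with (Suc s) n i. k \<in> \<gamma>}"
    then have \<gamma>: "finite \<gamma>" "i \<in> \<gamma>" "k \<in> \<gamma>" "\<gamma> \<subseteq> {0..<n}" by (auto dest!: idx_sets_withD)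
    have "(\<lambda>a b. if b = i then col_repl H i ?e a k else col_repl H i ?e a b) = col_repl H i ?h"
      using ik by (auto simp: col_repl_def fun_eq_iff)
    then show "cdet_on \<gamma> (col_repl H i ?e) i = - cdet_on (\<gamma> - {k}) (col_repl H i ?h) i"
      using cdet_on_off_unit_column[OF \<gamma>(1,2,3) ik herm_on_col_repl[OF H herm \<gamma>(4)], of ?e]
      by (simp add: col_repl_def)
  qed
  also have "\<dots> = (\<Sum>\<beta>\<in>{\<beta> \<in> idx_sets_with s n i. k \<notin> \<beta>}. - cdet_on \<beta> (col_repl H i ?h) i)"
  proof (rule sum.reindex_bij_witness[of _ "insert k" "\<lambda>\<gamma>. \<gamma> - {k}"])
    fix \<gamma> assume "\<gamma> \<in> {\<gamma> \<in> idx_sets_with (Suc s) n i. k \<in> \<gamma>}"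
    then have "finite \<gamma> \<and> i \<in> \<gamma> \<and> \<gamma> \<subseteq> {0..<n} \<and> card \<gamma> = Suc s \<and> k \<in> \<gamma>" by (auto dest!: idx_sets_withD)
    then show "insert k (\<gamma> - {k}) = \<gamma>" "\<gamma> - {k} \<in> {\<beta> \<in> idx_sets_with s n i. k \<notin> \<beta>}"
      using ik by (auto simp: idx_sets_with_def)
  next
    fix \<beta> assume \<beta>: "\<beta> \<in> {\<beta> \<in> idx_sets_with s n i. k \<notin> \<beta>}"
    then have "finite \<beta> \<and> i \<in> \<beta> \<and> \<beta> \<subseteq> {0..<n} \<and> card \<beta> = s \<and> k \<notin> \<beta>" by (auto dest!: idx_sets_withD)
    then show "insert k \<beta> - {k} = \<beta>" "insert k \<beta> \<in> {\<gamma> \<in> idx_sets_with (Suc s) n i. k \<in> \<gamma>}"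
      using k by (auto simp: idx_sets_with_def)
  qed auto
  also have "\<dots> = - (\<Sum>\<beta>\<in>{\<beta> \<in> idx_sets_with s n i. k \<notin> \<beta>}. cdet_on \<beta> (col_repl H i ?h) i)"
    by (rule sum_negf)
  also have "(\<Sum>\<beta>\<in>{\<beta> \<in> idx_sets_with s n i. k \<notin> \<beta>}. cdet_on \<beta> (col_repl H i ?h) i)
    = (\<Sum>\<beta>\<in>idx_sets_with s n i. cdet_on \<beta> (col_repl H i ?h) i)"
  proof (rule sum.mono_neutral_left)
    show "\<forall>\<beta>\<in>idx_sets_with s n i - {\<beta> \<in> idx_sets_with s n i. k \<notin> \<beta>}. cdet_on \<beta> (col_repl H i ?h) i = 0"
    proof
      fix \<beta> assume "\<beta> \<in> idx_sets_with s n i - {\<beta> \<in> idx_sets_with s n i. k \<notin> \<beta>}"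
      then have \<beta>: "finite \<beta>" "i \<in> \<beta>" "k \<in> \<beta>" "\<beta> \<subseteq> {0..<n}" by (auto dest!: idx_sets_withD)
      show "cdet_on \<beta> (col_repl H i ?h) i = 0"
        by (rule cdet_on_equal_columns[OF \<beta>(1,2,3) ik herm_on_col_repl[OF H herm \<beta>(4)]])
          (use ik in \<open>simp add: col_repl_def\<close>)
    qed
  qed auto
  also have "\<dots> = (cofmat n H s * H) $$ (i, k)" by (rule cofmat_mult_entry[OF i k, symmetric])
  finally show ?thesis .
qed

lemma cofmat_Suc:
  "cofmat n H (Suc s) = qreal (minor_sum n H s) \<cdot>\<^sub>m 1\<^sub>m n - cofmat n H s * H"
proof (rule eq_matI)
  fix i k assume "i < dim_row (qreal (minor_sum n H s) \<cdot>\<^sub>m 1\<^sub>m n - cofmat n H s * H)"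
    "k < dim_col (qreal (minor_sum n H s) \<cdot>\<^sub>m 1\<^sub>m n - cofmat n H s * H)"
  then have ik: "i < n" "k < n" using H by auto
  have e: "(qreal (minor_sum n H s) \<cdot>\<^sub>m 1\<^sub>m n - cofmat n H s * H) $$ (i, k)
    = qreal (minor_sum n H s) * (if i = k then 1 else 0) - (cofmat n H s * H) $$ (i, k)"
    using ik H cofmat_carrier[of n H s] by (simp del: index_mult_mat(1))
  show "cofmat n H (Suc s) $$ (i, k) = (qreal (minor_sum n H s) \<cdot>\<^sub>m 1\<^sub>m n - cofmat n H s * H) $$ (i, k)"
  proof (cases "i = k")
    case False
    then show ?thesis unfolding e using cofmat_off_diag[OF ik False] by simp
  next
    case True
    have s: "idx_sets s n = {\<beta> \<in> idx_sets s n. i \<notin> \<beta>} \<union> idx_sets_with s n i"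
      by (auto simp: idx_sets_def idx_sets_with_def)
    have "qreal (minor_sum n H s) = (\<Sum>\<beta>\<in>{\<beta> \<in> idx_sets s n. i \<notin> \<beta>} \<union> idx_sets_with s n i. qreal (herm_det \<beta> (ent H)))"
      unfolding minor_sum_def qreal_sum by (rule sum.cong[OF s refl])
    also have "\<dots> = cofmat n H (Suc s) $$ (i, i) + (cofmat n H s * H) $$ (i, i)"
      unfolding cofmat_diag[OF ik(1)] cofmat_mult_diag[OF ik(1)]
      by (rule sum.union_disjoint) (auto simp: idx_sets_with_def)
    finally show ?thesis unfolding e using True by (simp del: index_mult_mat(1))
  qed
qed (use H in auto)

text \<open>Each principal minor of order \<open>s\<close> is counted once for every one of its
  \<open>s\<close> indices.\<close>

lemma qtr_cofmat_mult: "qtr (cofmat n H s * H) = real s * minor_sum n H s"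
proof -
  have "qtr (cofmat n H s * H) = (\<Sum>i<n. \<Sum>\<beta>\<in>idx_sets_with s n i. herm_det \<beta> (ent H))"
    using cofmat_carrier[of n H s] by (simp add: qtr_def cofmat_mult_diag qre_sum del: index_mult_mat(1))
  also have "\<dots> = (\<Sum>i<n. \<Sum>\<beta>\<in>{\<beta> \<in> idx_sets s n. i \<in> \<beta>}. herm_det \<beta> (ent H))"
    by (intro sum.cong) (auto simp: idx_sets_def idx_sets_with_def)
  also have "\<dots> = (\<Sum>\<beta>\<in>idx_sets s n. \<Sum>i\<in>{i \<in> {..<n}. i \<in> \<beta>}. herm_det \<beta> (ent H))"
    by (rule sum.swap_restrict) auto
  also have "\<dots> = (\<Sum>\<beta>\<in>idx_sets s n. real s * herm_det \<beta> (ent H))"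
  proof (rule sum.cong[OF refl])
    fix \<beta> assume \<beta>: "\<beta> \<in> idx_sets s n"
    then have "{i \<in> {..<n}. i \<in> \<beta>} = \<beta>" by (auto simp: idx_sets_def)
    then show "(\<Sum>i\<in>{i \<in> {..<n}. i \<in> \<beta>}. herm_det \<beta> (ent H)) = real s * herm_det \<beta> (ent H)"
      using \<beta> by (simp add: idx_sets_def)
  qed
  finally show ?thesis by (simp add: minor_sum_def sum_distrib_left)
qed

lemma cofmat_0: "cofmat n H 0 = 0\<^sub>m n n"
proof -
  have "idx_sets_with 0 n i = {}" for i
    by (auto dest!: idx_sets_withD)
  then show ?thesis by (intro eq_matI) (auto simp: cofmat_def)
qed

text \<open>There are no minors of order n + 1. Read through the recursion, this plays the part of
  the Cayley-Hamilton theorem.\<close>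

lemma cofmat_Suc_dim: "cofmat n H (Suc n) = 0\<^sub>m n n"
proof -
  have "card \<beta> \<noteq> Suc n" if "\<beta> \<subseteq> {0..<n}" for \<beta>
    using card_mono[OF _ that] by simp
  then have "idx_sets_with (Suc n) n i = {}" for i
    by (auto simp: idx_sets_with_def)
  then show ?thesis by (intro eq_matI) (auto simp: cofmat_def)
qed

lemma minor_sum_0: "minor_sum n H 0 = 1"
proof -
  have "idx_sets 0 n = {{}}" by (auto simp: idx_sets_def card_eq_0_iff dest: finite_subset)
  then show ?thesis by (simp add: minor_sum_def herm_det_def orbs_def osign_def)
qed

text \<open>By the recursion \<open>cofmat n H s\<close> is a real polynomial in \<open>H\<close>,
  so it commutes with whatever commutes with \<open>H\<close>.\<close>

lemma cofmat_commute:
  assumes Z: "Z \<in> carrier_mat n n" and ZH: "Z * H = H * Z"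
  shows "Z * cofmat n H s = cofmat n H s * Z"
proof (induction s)
  case 0
  then show ?case using Z by (simp add: cofmat_0)
next
  case (Suc s)
  let ?K = "cofmat n H s" and ?q = "qreal (minor_sum n H s)"
  have K: "?K \<in> carrier_mat n n" by simp
  have "Z * cofmat n H (Suc s) = Z * (?q \<cdot>\<^sub>m 1\<^sub>m n) - Z * (?K * H)"
    unfolding cofmat_Suc by (rule mult_minus_distrib_mat[OF Z]) (use H K in auto)
  also have "Z * (?q \<cdot>\<^sub>m 1\<^sub>m n) = ?q \<cdot>\<^sub>m Z"
    using smult_mult_right[OF Z one_carrier_mat] Z by simp
  also have "Z * (?K * H) = Z * ?K * H" by (rule assoc_mult_mat[OF Z K H, symmetric])
  also have "\<dots> = ?K * (Z * H)" unfolding Suc by (rule assoc_mult_mat[OF K Z H])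
  also have "\<dots> = ?K * H * Z" unfolding ZH by (rule assoc_mult_mat[OF K H Z, symmetric])
  also have "?q \<cdot>\<^sub>m Z - ?K * H * Z = (?q \<cdot>\<^sub>m 1\<^sub>m n) * Z - ?K * H * Z"
    using smult_mult_left[OF one_carrier_mat Z] Z by simp
  also have "\<dots> = cofmat n H (Suc s) * Z"
    unfolding cofmat_Suc by (rule minus_mult_distrib_mat[symmetric]) (use H K Z in auto)
  finally show ?case .
qed

lemma ctrans_cofmat: "ctrans (cofmat n H s) = cofmat n H s"
proof (induction s)
  case 0
  then show ?case by (simp add: cofmat_0)
next
  case (Suc s)
  let ?K = "cofmat n H s" and ?q = "qreal (minor_sum n H s)"
  have K: "?K \<in> carrier_mat n n" by simp
  have "ctrans (cofmat n H (Suc s)) = ctrans (?q \<cdot>\<^sub>m 1\<^sub>m n) - ctrans (?K * H)"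
    unfolding cofmat_Suc by (rule ctrans_minus) (use H K in auto)
  also have "\<dots> = ?q \<cdot>\<^sub>m 1\<^sub>m n - H * ?K" using ctrans_mult[OF K H] Suc herm by simp
  also have "H * ?K = ?K * H" by (rule cofmat_commute[OF H refl])
  finally show ?case by (simp add: cofmat_Suc)
qed

text \<open>The Gram matrix of H Z is Z* H (H Z), which vanishes.\<close>

lemma hermitian_square_cancel:
  assumes Z: "Z \<in> carrier_mat n k" and 0: "H * (H * Z) = 0\<^sub>m n k"
  shows "H * Z = 0\<^sub>m n k"
proof (rule gram_eq_zero)
  show "H * Z \<in> carrier_mat n k" using H Z by simp
  have "ctrans (H * Z) * (H * Z) = ctrans Z * H * (H * Z)" using ctrans_mult[OF H Z] herm by simp
  also have "\<dots> = ctrans Z * (H * (H * Z))"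
    by (rule assoc_mult_mat[OF ctrans_carrier[OF Z] H mult_carrier_mat[OF H Z]])
  also have "\<dots> = 0\<^sub>m k k" unfolding 0 using Z by (simp add: ctrans_def)
  finally show "ctrans (H * Z) * (H * Z) = 0\<^sub>m k k" .
qed

text \<open>Take the largest r with nonzero minor sum. Beyond r the recursion is
  K (s + 1) = - K s H, and it ends at K (n + 1) = 0; since H is Hermitian, H (H Z) = 0 forces
  H Z = 0, so descending gives K (r + 1) H = 0.\<close>

lemma cofmat_top:
  obtains r where "minor_sum n H r \<noteq> 0" "cofmat n H r * H * H = qreal (minor_sum n H r) \<cdot>\<^sub>m H"
proof -
  define R where "R = {s. s \<le> n \<and> minor_sum n H s \<noteq> 0}"
  have finR: "finite R" by (simp add: R_def)
  have "0 \<in> R" by (simp add: R_def minor_sum_0)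
  then have "Max R \<in> R" using finR by (intro Max_in) auto
  then have r: "Max R \<le> n" "minor_sum n H (Max R) \<noteq> 0" by (auto simp: R_def)
  have big: "minor_sum n H s = 0" if "Max R < s" "s \<le> n" for s
  proof (rule ccontr)
    assume "minor_sum n H s \<noteq> 0"
    then have "s \<in> R" using that(2) by (simp add: R_def)
    then show False using Max_ge[OF finR] that(1) by fastforce
  qed
  have "cofmat n H (Suc (Max R)) * H = 0\<^sub>m n n"
  proof (rule inc_induct[of "Suc (Max R)" "Suc n"])
    show "cofmat n H (Suc n) * H = 0\<^sub>m n n" using H by (simp add: cofmat_Suc_dim)
  next
    fix s assume s: "Suc (Max R) \<le> s" "s < Suc n" and IH: "cofmat n H (Suc s) * H = 0\<^sub>m n n"
    let ?K = "cofmat n H s"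
    have K: "?K \<in> carrier_mat n n" by simp
    have KH: "?K * H \<in> carrier_mat n n" by (rule mult_carrier_mat[OF K H])
    have HK: "H * ?K = ?K * H" by (rule cofmat_commute[OF H refl])
    have "0\<^sub>m n n = (0\<^sub>m n n - ?K * H) * H"
      using IH big[of s] s by (simp add: cofmat_Suc zero_smult_qreal[OF one_carrier_mat])
    also have "\<dots> = 0\<^sub>m n n * H - ?K * H * H"
      by (rule minus_mult_distrib_mat[OF zero_carrier_mat KH H])
    finally have "0\<^sub>m n n - ?K * H * H = 0\<^sub>m n n" using H by simp
    then have "0\<^sub>m n n = ?K * H * H"
      by (rule minus_eq_zero_mat[OF zero_carrier_mat mult_carrier_mat[OF KH H]])
    also have "\<dots> = H * ?K * H" unfolding HK ..
    also have "\<dots> = H * (?K * H)" by (rule assoc_mult_mat[OF H K H])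
    also have "\<dots> = H * (H * ?K)" unfolding HK ..
    finally have "H * (H * ?K) = 0\<^sub>m n n" by simp
    then have "H * ?K = 0\<^sub>m n n" by (rule hermitian_square_cancel[OF K])
    then show "?K * H = 0\<^sub>m n n" unfolding HK .
  qed (use r in simp)
  moreover have "cofmat n H (Suc (Max R)) * H
    = qreal (minor_sum n H (Max R)) \<cdot>\<^sub>m H - cofmat n H (Max R) * H * H"
  proof -
    have "cofmat n H (Suc (Max R)) * H
      = (qreal (minor_sum n H (Max R)) \<cdot>\<^sub>m 1\<^sub>m n) * H - cofmat n H (Max R) * H * H"
      unfolding cofmat_Suc
      by (rule minus_mult_distrib_mat[OF smult_carrier_mat[OF one_carrier_mat] mult_carrier_mat[OF cofmat_carrier H] H])
    then show ?thesis using smult_mult_left[OF one_carrier_mat H] H by simp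
  qed
  ultimately have "qreal (minor_sum n H (Max R)) \<cdot>\<^sub>m H - cofmat n H (Max R) * H * H = 0\<^sub>m n n" by simp
  then have "qreal (minor_sum n H (Max R)) \<cdot>\<^sub>m H = cofmat n H (Max R) * H * H"
    by (rule minus_eq_zero_mat[OF smult_carrier_mat[OF H]
      mult_carrier_mat[OF mult_carrier_mat[OF cofmat_carrier H] H]])
  then show thesis using that[OF r(2)] by simp
qed

end

subsection \<open>Positive definite matrices\<close>

text \<open>Definiteness speaks of single vectors; the diagonal entries of Z* M Z are the values of
  the form at the columns of Z.\<close>

lemma hpd_cancel:
  assumes M: "hpd n M" and Z: "Z \<in> carrier_mat n k" and 0: "ctrans Z * M * Z = 0\<^sub>m k k"
  shows "Z = 0\<^sub>m n k"
proof (rule eq_matI)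
  have Mc: "M \<in> carrier_mat n n" using M by (simp add: hpd_def)
  fix i j assume "i < dim_row (0\<^sub>m n k)" "j < dim_col (0\<^sub>m n k)"
  then have ij: "i < n" "j < k" by auto
  define x where "x = mat n 1 (\<lambda>(a, _). Z $$ (a, j))"
  have x: "x \<in> carrier_mat n 1" by (simp add: x_def)
  have cx: "ctrans x \<in> carrier_mat 1 n" using x by simp
  have cZ: "ctrans Z \<in> carrier_mat k n" using Z by simp
  have one: "0 < (1 :: nat)" by simp
  have "(ctrans x * M) $$ (0, l) = (ctrans Z * M) $$ (j, l)" if "l < n" for l
    unfolding mult_entry[OF cx Mc one that] mult_entry[OF cZ Mc ij(2) that]
    using ij Z by (intro sum.cong) (auto simp: x_def ctrans_def)
  then have "(ctrans x * M * x) $$ (0, 0) = (ctrans Z * M * Z) $$ (j, j)"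
    unfolding mult_entry[OF mult_carrier_mat[OF cx Mc] x one one]
      mult_entry[OF mult_carrier_mat[OF cZ Mc] Z ij(2) ij(2)]
    by (intro sum.cong) (auto simp: x_def simp del: index_mult_mat(1))
  then have e: "(ctrans x * M * x) $$ (0, 0) = 0" using 0 ij by (simp del: index_mult_mat(1))
  have "x = 0\<^sub>m n 1"
  proof (rule ccontr)
    assume "x \<noteq> 0\<^sub>m n 1"
    then obtain r where "r > 0" "ctrans x * M * x = mat 1 1 (\<lambda>_. qreal r)"
      using M x unfolding hpd_def by blast
    then show False using e by simp
  qed
  then have "x $$ (i, 0) = 0" using ij by simp
  then show "Z $$ (i, j) = 0\<^sub>m n k $$ (i, j)" using ij by (simp add: x_def)
qed (use Z in auto)

lemma hpd_inj:
  assumes M: "hpd n M" and Z: "Z \<in> carrier_mat n k" and 0: "M * Z = 0\<^sub>m n k"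
  shows "Z = 0\<^sub>m n k"
proof (rule hpd_cancel[OF M Z])
  have Mc: "M \<in> carrier_mat n n" using M by (simp add: hpd_def)
  have "ctrans Z * M * Z = ctrans Z * (M * Z)"
    by (rule assoc_mult_mat[OF ctrans_carrier[OF Z] Mc Z])
  then show "ctrans Z * M * Z = 0\<^sub>m k k" unfolding 0 using Z by (simp add: ctrans_def)
qed

lemma hpd_left_cancel:
  assumes M: "hpd n M" and Z: "Z \<in> carrier_mat n k" "W \<in> carrier_mat n k" and eq: "M * Z = M * W"
  shows "Z = W"
proof (rule minus_eq_zero_mat[OF Z], rule hpd_inj[OF M])
  have Mc: "M \<in> carrier_mat n n" using M by (simp add: hpd_def)
  show "Z - W \<in> carrier_mat n k" using Z by (simp add: minus_carrier_mat)
  have "M * (Z - W) = M * Z - M * W" by (rule mult_minus_distrib_mat[OF Mc Z])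
  then show "M * (Z - W) = 0\<^sub>m n k" using eq Mc Z by simp
qed

lemma hpdD: "hpd n M \<Longrightarrow> M \<in> carrier_mat n n" "hpd n M \<Longrightarrow> ctrans M = M"
  by (auto simp: hpd_def hermitian_def)

text \<open>The inverse is a normalised cofactor matrix: the top identity K N N = d N rearranges to
  N (K N) = N (d I), and definiteness cancels the outer N.\<close>

lemma qinv_hpd:
  assumes N: "hpd n N"
  shows "qinv n N \<in> carrier_mat n n" "N * qinv n N = 1\<^sub>m n" "qinv n N * N = 1\<^sub>m n"
    "ctrans (qinv n N) = qinv n N"
proof -
  note Nc = hpdD(1)[OF N] and Nh = hpdD(2)[OF N]
  obtain r where r: "minor_sum n N r \<noteq> 0"
    "cofmat n N r * N * N = qreal (minor_sum n N r) \<cdot>\<^sub>m N"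
    by (rule cofmat_top[OF Nc Nh])
  let ?K = "cofmat n N r" and ?d = "minor_sum n N r"
  have K: "?K \<in> carrier_mat n n" by simp
  have NK: "N * ?K = ?K * N" by (rule cofmat_commute[OF Nc Nh Nc refl])
  have "N * (?K * N) = N * ?K * N" by (rule assoc_mult_mat[OF Nc K Nc, symmetric])
  also have "\<dots> = qreal ?d \<cdot>\<^sub>m N" unfolding NK r(2) ..
  also have "\<dots> = N * (qreal ?d \<cdot>\<^sub>m 1\<^sub>m n)"
    using smult_mult_right[OF Nc one_carrier_mat] Nc by simp
  finally have KN: "?K * N = qreal ?d \<cdot>\<^sub>m 1\<^sub>m n"
    by (rule hpd_left_cancel[OF N mult_carrier_mat[OF K Nc] smult_carrier_mat[OF one_carrier_mat]])
  define Y where "Y = qreal (inverse ?d) \<cdot>\<^sub>m ?K"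
  have Y: "Y \<in> carrier_mat n n" by (simp add: Y_def)
  \<comment> \<open>With \<open>qreal_simps(6)\<close> removed the product of \<open>?d\<close> and
    its inverse stays inside \<open>qreal\<close> and cancels in the reals.\<close>
  have YN: "Y * N = 1\<^sub>m n"
    unfolding Y_def smult_mult_left[OF K Nc] KN smult_smult_qreal using r(1) by (simp del: qreal_simps(6))
  have NY: "N * Y = 1\<^sub>m n"
    unfolding Y_def smult_mult_right[OF Nc K] NK KN smult_smult_qreal using r(1) by (simp del: qreal_simps(6))
  have "qinv n N = Y"
    unfolding qinv_def
  proof (rule the_equality)
    fix W assume W: "W \<in> carrier_mat n n \<and> N * W = 1\<^sub>m n \<and> W * N = 1\<^sub>m n"
    then have "N * W = N * Y" using NY by simp
    then show "W = Y" using W by (intro hpd_left_cancel[OF N _ Y]) blast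
  qed (use Y YN NY in auto)
  then show "qinv n N \<in> carrier_mat n n" "N * qinv n N = 1\<^sub>m n" "qinv n N * N = 1\<^sub>m n"
    "ctrans (qinv n N) = qinv n N"
    using Y YN NY ctrans_cofmat[OF Nc Nh] by (auto simp: Y_def)
qed

section \<open>Matrix algebra with side conditions on dimensions\<close>

lemma dim_ctrans [simp]: "dim_row (ctrans A) = dim_col A" "dim_col (ctrans A) = dim_row A"
  by (simp_all add: ctrans_def)

text \<open>With equations between dimensions as premises these laws act as rewrite rules, because
  \<open>simp\<close> can discharge the premises; carrier premises would leave dimensions to be
  guessed.\<close>

lemma assoc_dim:
  fixes A B C :: "quat mat"
  assumes "dim_col A = dim_row B" "dim_col B = dim_row C"
  shows "(A * B) * C = A * (B * C)"
  by (rule assoc_mult_mat[OF carrier_matI[OF refl assms(1)] carrier_matI[OF refl assms(2)] carrier_matI[OF refl refl]])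

lemma ctrans_mult_dim:
  assumes "dim_col A = dim_row B"
  shows "ctrans (A * B) = ctrans B * ctrans A"
  by (rule ctrans_mult[OF carrier_matI[OF refl assms] carrier_matI[OF refl refl]])

lemma smult_left_dim:
  assumes "dim_col A = dim_row B"
  shows "(x \<cdot>\<^sub>m A) * B = x \<cdot>\<^sub>m (A * B)"
  by (rule smult_mult_left[OF carrier_matI[OF refl assms] carrier_matI[OF refl refl]])

lemma smult_right_dim:
  assumes "dim_col A = dim_row B"
  shows "A * (qreal a \<cdot>\<^sub>m B) = qreal a \<cdot>\<^sub>m (A * B)"
  by (rule smult_mult_right[OF carrier_matI[OF refl assms] carrier_matI[OF refl refl]])

lemmas dim_algebra = assoc_dim ctrans_mult_dim smult_left_dim smult_right_dim

lemma carrier_dims: "A \<in> carrier_mat m n \<Longrightarrow> dim_row A = m" "A \<in> carrier_mat m n \<Longrightarrow> dim_col A = n"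
  by auto

subsection \<open>The weighted Moore-Penrose inverse\<close>

text \<open>Self-adjoint projections for the inner product of M agree if they have the same range
  (first alternative) or the same kernel (second). For equal ranges M X1 = (M X2 X1)* = X1* M X2 = M
  X1 X2 = M X2.\<close>

lemma hpd_projection_unique:
  assumes M: "hpd m M" and X: "X1 \<in> carrier_mat m m" "X2 \<in> carrier_mat m m"
    and h: "ctrans (M * X1) = M * X1" "ctrans (M * X2) = M * X2"
    and c: "X2 * X1 = X1 \<and> X1 * X2 = X2 \<or> X1 * X2 = X1 \<and> X2 * X1 = X2"
  shows "X1 = X2"
proof (rule hpd_left_cancel[OF M X])
  note dims [simp] = carrier_dims[OF hpdD(1)[OF M]] carrier_dims[OF X(1)] carrier_dims[OF X(2)]
  have h': "ctrans X1 * M = M * X1" "ctrans X2 * M = M * X2"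
    using h hpdD(2)[OF M] by (simp_all add: ctrans_mult_dim)
  from c show "M * X1 = M * X2"
  proof
    assume c: "X2 * X1 = X1 \<and> X1 * X2 = X2"
    have "M * X1 = ctrans (M * (X2 * X1))" using c h by simp
    also have "\<dots> = ctrans X1 * ctrans (M * X2)" by (simp add: ctrans_mult_dim flip: assoc_dim)
    also have "\<dots> = (ctrans X1 * M) * X2" unfolding h(2) by (simp add: assoc_dim)
    also have "\<dots> = M * (X1 * X2)" unfolding h'(1) by (simp add: assoc_dim)
    finally show ?thesis using c by simp
  next
    assume c: "X1 * X2 = X1 \<and> X2 * X1 = X2"
    have "M * X1 = ctrans (M * (X1 * X2))" using c h by simp
    also have "\<dots> = ctrans X2 * ctrans (M * X1)" by (simp add: ctrans_mult_dim flip: assoc_dim)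
    also have "\<dots> = (ctrans X2 * M) * X1" unfolding h(1) by (simp add: assoc_dim)
    also have "\<dots> = M * (X2 * X1)" unfolding h'(2) by (simp add: assoc_dim)
    finally show ?thesis using c by simp
  qed
qed

text \<open>For two solutions Y and Z, A Y and A Z are M-self-adjoint projections with the same
  range, Y A and Z A are N-self-adjoint ones with the same kernel. Hence A Z = A Y and Z A = Y A,
  and Z = Z A Z = Y A Y = Y.\<close>

lemma wmpi_eqI:
  assumes A: "A \<in> carrier_mat m n" and M: "hpd m M" and N: "hpd n N"
    and Y: "Y \<in> carrier_mat n m" "A * Y * A = A" "Y * A * Y = Y"
      "ctrans (M * A * Y) = M * A * Y" "ctrans (N * Y * A) = N * Y * A"
  shows "wmpi A M N = Y"
  unfolding wmpi_def
proof (rule the_equality)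
  show "Y \<in> carrier_mat (dim_col A) (dim_row A) \<and> A * Y * A = A \<and> Y * A * Y = Y \<and>
    ctrans (M * A * Y) = M * A * Y \<and> ctrans (N * Y * A) = N * Y * A"
    using A Y by auto
next
  fix Z assume "Z \<in> carrier_mat (dim_col A) (dim_row A) \<and> A * Z * A = A \<and> Z * A * Z = Z \<and>
    ctrans (M * A * Z) = M * A * Z \<and> ctrans (N * Z * A) = N * Z * A"
  then have Z: "Z \<in> carrier_mat n m" "A * Z * A = A" "Z * A * Z = Z"
    "ctrans (M * A * Z) = M * A * Z" "ctrans (N * Z * A) = N * Z * A"
    using A by auto
  note dims [simp] = carrier_dims[OF hpdD(1)[OF M]] carrier_dims[OF hpdD(1)[OF N]]
    carrier_dims[OF A] carrier_dims[OF Y(1)] carrier_dims[OF Z(1)]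
  have absorb: "A * U * (A * V) = A * V" "V * A * (U * A) = V * A"
    if "A * U * A = A" "dim_row U = n" "dim_col U = m" "dim_row V = n" "dim_col V = m" for U V
  proof -
    have "A * U * (A * V) = (A * U * A) * V" using that(2-) by (simp add: assoc_dim)
    then show "A * U * (A * V) = A * V" using that(1) by simp
    have "V * A * (U * A) = V * (A * U * A)" using that(2-) by (simp add: assoc_dim)
    then show "V * A * (U * A) = V * A" using that(1) by simp
  qed
  have AZ: "A * Z = A * Y"
  proof (rule hpd_projection_unique[OF M])
    show "A * Y * (A * Z) = A * Z \<and> A * Z * (A * Y) = A * Y \<or>
      A * Z * (A * Y) = A * Z \<and> A * Y * (A * Z) = A * Y"
      using absorb(1)[OF Y(2), of Z] absorb(1)[OF Z(2), of Y] by simp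
  qed (use A Y Z in \<open>auto simp: assoc_dim intro!: mult_carrier_mat\<close>)
  have ZA: "Z * A = Y * A"
  proof (rule hpd_projection_unique[OF N])
    show "Y * A * (Z * A) = Z * A \<and> Z * A * (Y * A) = Y * A \<or>
      Z * A * (Y * A) = Z * A \<and> Y * A * (Z * A) = Y * A"
      using absorb(2)[OF Y(2), of Z] absorb(2)[OF Z(2), of Y] by simp
  qed (use A Y Z in \<open>auto simp: assoc_dim intro!: mult_carrier_mat\<close>)
  have "Z = Z * A * Z" using Z(3) by simp
  also have "\<dots> = Y * (A * Z)" unfolding ZA by (simp add: assoc_dim)
  also have "\<dots> = Y * A * Y" unfolding AZ by (simp add: assoc_dim)
  also have "\<dots> = Y" by (rule Y(3))
  finally show "Z = Y" .
qed

text \<open>The normalised cofactor matrix K H / d is the orthogonal projection onto the range of H.\<close>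

lemma hermitian_projection:
  assumes H: "H \<in> carrier_mat n n" and herm: "ctrans H = H"
  obtains r E where "minor_sum n H r \<noteq> 0" "E = qreal (inverse (minor_sum n H r)) \<cdot>\<^sub>m (cofmat n H r * H)"
    "E \<in> carrier_mat n n" "ctrans E = E" "H * E = H" "E * cofmat n H r = cofmat n H r * E"
    "qtr E = real r" "\<And>Z. Z \<in> carrier_mat n n \<Longrightarrow> Z * H = H * Z \<Longrightarrow> Z * E = E * Z"
proof -
  obtain r where r: "minor_sum n H r \<noteq> 0"
    "cofmat n H r * H * H = qreal (minor_sum n H r) \<cdot>\<^sub>m H"
    by (rule cofmat_top[OF H herm])
  let ?K = "cofmat n H r" and ?d = "minor_sum n H r"
  note dims [simp] = carrier_dims[OF H]
  define E where "E = qreal (inverse ?d) \<cdot>\<^sub>m (?K * H)"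
  have HK: "H * ?K = ?K * H" by (rule cofmat_commute[OF H herm H refl])
  show thesis
  proof (rule that[OF r(1) E_def])
    show "E \<in> carrier_mat n n" unfolding E_def by (rule carrier_matI) simp_all
    show "ctrans E = E" by (simp add: E_def ctrans_mult_dim herm ctrans_cofmat[OF H herm] HK)
    have "H * (?K * H) = qreal ?d \<cdot>\<^sub>m H" using r(2) by (simp add: HK flip: assoc_dim)
    then have "H * E = qreal (inverse ?d) \<cdot>\<^sub>m (qreal ?d \<cdot>\<^sub>m H)" by (simp add: E_def smult_right_dim)
    then show "H * E = H" unfolding smult_smult_qreal using r(1) by (simp del: qreal_simps(6))
    show "E * ?K = ?K * E" by (simp add: E_def dim_algebra HK)
    show "qtr E = real r"
      unfolding E_def using qtr_smult[OF mult_carrier_mat[OF cofmat_carrier H]] qtr_cofmat_mult[OF H herm] r(1)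
      by simp
    show "Z * E = E * Z" if Z: "Z \<in> carrier_mat n n" "Z * H = H * Z" for Z
    proof -
      note [simp] = carrier_dims[OF Z(1)]
      have "Z * (?K * H) = (Z * ?K) * H" by (simp add: assoc_dim)
      also have "\<dots> = ?K * (Z * H)" unfolding cofmat_commute[OF H herm Z] by (simp add: assoc_dim)
      also have "\<dots> = ?K * H * Z" unfolding Z(2) by (simp add: assoc_dim)
      finally show ?thesis by (simp add: E_def smult_right_dim smult_left_dim)
    qed
  qed
qed

text \<open>The candidate Y = K S / d has Y A = E, the projection attached to H = S A. What remains
  is A E = A, E S = S and the two symmetries, all resting on the fact that N commutes with
  H.\<close>

lemma wmpi_left:
  fixes A M N S :: "quat mat" and m n :: nat
  defines "S \<equiv> qinv n N * ctrans A * M"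
  assumes A: "A \<in> carrier_mat m n" and M: "hpd m M" and N: "hpd n N" and herm: "ctrans (S * A) = S * A"
  shows "minor_sum n (S * A) (qrank A) \<noteq> 0"
    "wmpi A M N = qreal (inverse (minor_sum n (S * A) (qrank A))) \<cdot>\<^sub>m (cofmat n (S * A) (qrank A) * S)"
proof -
  let ?H = "S * A" and ?I = "qinv n N"
  note I = qinv_hpd[OF N] and Mc = hpdD(1)[OF M] and Nc = hpdD(1)[OF N]
  note Mh = hpdD(2)[OF M] and Nh = hpdD(2)[OF N]
  note dims [simp] = carrier_dims[OF Mc] carrier_dims[OF Nc] carrier_dims[OF A] carrier_dims[OF I(1)]
  have S: "S \<in> carrier_mat n m" unfolding S_def by (rule carrier_matI) simp_all
  note [simp] = carrier_dims[OF S]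
  have H: "?H \<in> carrier_mat n n" by (rule carrier_matI) simp_all
  obtain r E where r: "minor_sum n ?H r \<noteq> 0"
    and E: "E = qreal (inverse (minor_sum n ?H r)) \<cdot>\<^sub>m (cofmat n ?H r * ?H)"
      "E \<in> carrier_mat n n" "ctrans E = E" "?H * E = ?H" "E * cofmat n ?H r = cofmat n ?H r * E"
      "qtr E = real r" "\<And>Z. Z \<in> carrier_mat n n \<Longrightarrow> Z * ?H = ?H * Z \<Longrightarrow> Z * E = E * Z"
    by (rule hermitian_projection[OF H herm]) blast
  let ?K = "cofmat n ?H r"
  note [simp] = carrier_dims[OF E(2)]
  have NS: "N * S = ctrans A * M"
  proof -
    have "N * S = (N * ?I) * (ctrans A * M)" unfolding S_def by (simp add: assoc_dim)
    then show ?thesis by (simp add: I(2))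
  qed
  have G: "N * ?H = ctrans A * M * A" using NS by (simp flip: assoc_dim)
  \<comment> \<open>Two Hermitian matrices whose product is Hermitian commute.\<close>
  have "?H * N = ctrans (N * ?H)" using herm Nh by (simp add: ctrans_mult_dim[of N])
  also have "\<dots> = N * ?H" unfolding G using Mh by (simp add: dim_algebra)
  finally have NH: "N * ?H = ?H * N" by simp
  have "?I * ?H = ?I * (?H * (N * ?I))" by (simp add: I(2))
  also have "\<dots> = ?I * (?H * N) * ?I" by (simp add: assoc_dim)
  also have "\<dots> = (?I * N) * (?H * ?I)" unfolding NH[symmetric] by (simp add: assoc_dim)
  finally have IH: "?I * ?H = ?H * ?I" by (simp add: I(3))
  have IK: "?I * ?K = ?K * ?I" by (rule cofmat_commute[OF H herm I(1) IH])
  have IE: "?I * E = E * ?I" by (rule E(7)[OF I(1) IH])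
  have NE: "N * E = E * N" by (rule E(7)[OF Nc NH])
  \<comment> \<open>H (E - I) = 0 makes the form of M vanish on the columns of A (E - I), so
    definiteness of M gives A E = A.\<close>
  define x where "x = E - 1\<^sub>m n"
  have xc: "x \<in> carrier_mat n n" unfolding x_def using E(2) by (simp add: minus_carrier_mat)
  note [simp] = carrier_dims[OF xc]
  have Ax: "U * x = U * E - U" if "U \<in> carrier_mat k n" for U k
    unfolding x_def using mult_minus_distrib_mat[OF that E(2) one_carrier_mat] that by simp
  have "?H * x = 0\<^sub>m n n" unfolding Ax[OF H] E(4) using H by simp
  then have "N * (?H * x) = 0\<^sub>m n n" by simp
  then have "ctrans A * M * A * x = 0\<^sub>m n n" unfolding G[symmetric] by (simp add: assoc_dim)
  then have "ctrans (A * x) * M * (A * x) = 0\<^sub>m n n" by (simp add: dim_algebra)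
  then have "A * x = 0\<^sub>m m n" by (rule hpd_cancel[OF M mult_carrier_mat[OF A xc]])
  then have "A * E - A = 0\<^sub>m m n" unfolding Ax[OF A] .
  then have AE: "A * E = A" by (rule minus_eq_zero_mat[OF mult_carrier_mat[OF A E(2)] A])
  have "ctrans (A * E) = ctrans A" unfolding AE ..
  then have EA: "E * ctrans A = ctrans A" by (simp add: ctrans_mult_dim E(3))
  have "E * S = (E * ?I) * (ctrans A * M)" unfolding S_def by (simp add: assoc_dim)
  also have "\<dots> = ?I * (E * ctrans A) * M" unfolding IE[symmetric] by (simp add: assoc_dim)
  finally have ES: "E * S = S" unfolding EA S_def .
  define Y where "Y = qreal (inverse (minor_sum n ?H r)) \<cdot>\<^sub>m (?K * S)"
  have Y: "Y \<in> carrier_mat n m" unfolding Y_def by (rule carrier_matI) simp_all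
  note [simp] = carrier_dims[OF Y]
  have YA: "Y * A = E" unfolding Y_def E(1) by (simp add: dim_algebra)
  have AYA: "A * Y * A = A" using YA AE by (simp add: assoc_dim)
  have "?K * S = ?K * (E * S)" unfolding ES ..
  also have "\<dots> = (E * ?K) * S" unfolding E(5) by (simp add: assoc_dim)
  finally have "E * (?K * S) = ?K * S" by (simp add: assoc_dim)
  then have EY: "E * Y = Y" unfolding Y_def by (simp add: smult_right_dim)
  have W: "wmpi A M N = Y"
  proof (rule wmpi_eqI[OF A M N Y AYA])
    show "Y * A * Y = Y" unfolding YA by (rule EY)
    \<comment> \<open>M A Y is a real multiple of M A (K I) A* M, where I is the inverse of N; K and
      I are Hermitian and commute, so K I is Hermitian.\<close>
    have "M * A * Y = qreal (inverse (minor_sum n ?H r)) \<cdot>\<^sub>m (M * A * (?K * ?I) * ctrans A * M)"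
      unfolding Y_def by (simp add: dim_algebra S_def)
    moreover have "ctrans (M * A * (?K * ?I) * ctrans A * M) = M * A * (?I * ?K) * ctrans A * M"
      by (simp add: dim_algebra Mh I(4) ctrans_cofmat[OF H herm])
    ultimately show "ctrans (M * A * Y) = M * A * Y" unfolding IK by simp
    have "N * Y * A = N * E" using YA by (simp add: assoc_dim)
    then show "ctrans (N * Y * A) = N * Y * A" by (simp add: ctrans_mult_dim Nh E(3) NE)
  qed
  \<comment> \<open>The index found by the recursion is the real trace of E = Y A, which equals that
    of A Y and hence the rank.\<close>
  have "real r = qtr (A * Y)" using qtr_mult_commute[OF A Y] YA E(6) by simp
  also have "\<dots> = real (qrank A)" by (rule qrank_eq_trace[OF A Y AYA])
  finally have "r = qrank A" by simp
  then show "minor_sum n ?H (qrank A) \<noteq> 0"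
    "wmpi A M N = qreal (inverse (minor_sum n ?H (qrank A))) \<cdot>\<^sub>m (cofmat n ?H (qrank A) * S)"
    using r W unfolding Y_def by simp_all
qed

text \<open>The mirror image, with B Y = E. Here P commutes with H = B S, since P H = P B I B* P is
  Hermitian, where I is the inverse of Q.\<close>

lemma wmpi_right:
  fixes B P Q S :: "quat mat" and p q :: nat
  defines "S \<equiv> qinv q Q * ctrans B * P"
  assumes B: "B \<in> carrier_mat p q" and P: "hpd p P" and Q: "hpd q Q" and herm: "ctrans (B * S) = B * S"
  shows "minor_sum p (B * S) (qrank B) \<noteq> 0"
    "wmpi B P Q = qreal (inverse (minor_sum p (B * S) (qrank B))) \<cdot>\<^sub>m (S * cofmat p (B * S) (qrank B))"
proof -
  let ?H = "B * S" and ?I = "qinv q Q"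
  note I = qinv_hpd[OF Q] and Pc = hpdD(1)[OF P] and Qc = hpdD(1)[OF Q]
  note Ph = hpdD(2)[OF P] and Qh = hpdD(2)[OF Q]
  note dims [simp] = carrier_dims[OF Pc] carrier_dims[OF Qc] carrier_dims[OF B] carrier_dims[OF I(1)]
  have S: "S \<in> carrier_mat q p" unfolding S_def by (rule carrier_matI) simp_all
  note [simp] = carrier_dims[OF S]
  have H: "?H \<in> carrier_mat p p" by (rule carrier_matI) simp_all
  obtain r E where r: "minor_sum p ?H r \<noteq> 0"
    and E: "E = qreal (inverse (minor_sum p ?H r)) \<cdot>\<^sub>m (cofmat p ?H r * ?H)"
      "E \<in> carrier_mat p p" "ctrans E = E" "?H * E = ?H" "E * cofmat p ?H r = cofmat p ?H r * E"
      "qtr E = real r" "\<And>Z. Z \<in> carrier_mat p p \<Longrightarrow> Z * ?H = ?H * Z \<Longrightarrow> Z * E = E * Z"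
    by (rule hermitian_projection[OF H herm]) blast
  let ?K = "cofmat p ?H r"
  note [simp] = carrier_dims[OF E(2)]
  have QS: "Q * S = ctrans B * P"
  proof -
    have "Q * S = (Q * ?I) * (ctrans B * P)" unfolding S_def by (simp add: assoc_dim)
    then show ?thesis by (simp add: I(2))
  qed
  have "?H * P = ctrans (P * ?H)" using herm Ph by (simp add: ctrans_mult_dim[of P])
  also have "\<dots> = P * ?H" unfolding S_def using Ph I(4) by (simp add: dim_algebra)
  finally have PH: "P * ?H = ?H * P" by simp
  have PK: "P * ?K = ?K * P" by (rule cofmat_commute[OF H herm Pc PH])
  have PE: "P * E = E * P" by (rule E(7)[OF Pc PH])
  define x where "x = E - 1\<^sub>m p"
  have xc: "x \<in> carrier_mat p p" unfolding x_def using E(2) by (simp add: minus_carrier_mat)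
  note [simp] = carrier_dims[OF xc]
  have xh: "ctrans x = x" unfolding x_def using ctrans_minus[OF E(2) one_carrier_mat] E(3) by simp
  have Ux: "U * x = U * E - U" if "U \<in> carrier_mat k p" for U k
    unfolding x_def using mult_minus_distrib_mat[OF that E(2) one_carrier_mat] that by simp
  have Hx: "?H * x = 0\<^sub>m p p" unfolding Ux[OF H] E(4) using H by simp
  \<comment> \<open>S* Q S equals P H, so the form of Q vanishes on S x because H x = 0; this yields
    S E = S.\<close>
  have "ctrans (S * x) * Q * (S * x) = x * ctrans S * (Q * S) * x"
    by (simp add: dim_algebra xh)
  also have "\<dots> = x * P * (?H * x)"
    unfolding QS unfolding S_def using Ph I(4) by (simp add: dim_algebra)
  also have "\<dots> = 0\<^sub>m p p" unfolding Hx by simp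
  finally have Sx: "S * x = 0\<^sub>m q p" by (rule hpd_cancel[OF Q mult_carrier_mat[OF S xc]])
  then have "S * E - S = 0\<^sub>m q p" unfolding Ux[OF S] .
  then have SE: "S * E = S" by (rule minus_eq_zero_mat[OF mult_carrier_mat[OF S E(2)] S])
  \<comment> \<open>Multiplying S E = S by Q and conjugate transposing gives P B = E P B; E passes
    P, and cancelling P leaves B = E B.\<close>
  have "ctrans B * P = Q * (S * E)" unfolding SE QS ..
  also have "\<dots> = ctrans B * P * E" using QS by (simp flip: assoc_dim)
  finally have "ctrans (ctrans B * P) = ctrans (ctrans B * P * E)" by simp
  then have "P * B = E * P * B" using Ph E(3) by (simp add: dim_algebra)
  also have "\<dots> = P * (E * B)" unfolding PE[symmetric] by (simp add: assoc_dim)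
  finally have EB: "B = E * B"
    by (rule hpd_left_cancel[OF P B mult_carrier_mat[OF E(2) B]])
  define Y where "Y = qreal (inverse (minor_sum p ?H r)) \<cdot>\<^sub>m (S * ?K)"
  have Y: "Y \<in> carrier_mat q p" unfolding Y_def by (rule carrier_matI) simp_all
  note [simp] = carrier_dims[OF Y]
  have "?H * ?K = ?K * ?H" by (rule cofmat_commute[OF H herm H refl])
  then have BY: "B * Y = E" unfolding Y_def E(1) by (simp add: smult_right_dim flip: assoc_dim)
  have BYB: "B * Y * B = B" unfolding BY using EB by simp
  have "S * ?K = S * E * ?K" unfolding SE ..
  also have "\<dots> = S * ?K * E" using E(5) by (simp add: assoc_dim)
  finally have YE: "Y * E = Y" unfolding Y_def by (simp add: smult_left_dim)
  have W: "wmpi B P Q = Y"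
  proof (rule wmpi_eqI[OF B P Q Y BYB])
    have "Y * B * Y = Y * (B * Y)" by (simp add: assoc_dim)
    then show "Y * B * Y = Y" unfolding BY YE .
    have "P * B * Y = P * E" using BY by (simp add: assoc_dim)
    then show "ctrans (P * B * Y) = P * B * Y" by (simp add: ctrans_mult_dim Ph E(3) PE)
    have "Q * Y * B = qreal (inverse (minor_sum p ?H r)) \<cdot>\<^sub>m (Q * S * ?K * B)"
      unfolding Y_def by (simp add: dim_algebra)
    also have "Q * S * ?K * B = ctrans B * (P * ?K) * B" unfolding QS by (simp add: assoc_dim)
    finally have e: "Q * Y * B = qreal (inverse (minor_sum p ?H r)) \<cdot>\<^sub>m (ctrans B * (P * ?K) * B)" .
    have "ctrans (ctrans B * (P * ?K) * B) = ctrans B * (?K * P) * B"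
      by (simp add: dim_algebra Ph ctrans_cofmat[OF H herm])
    then show "ctrans (Q * Y * B) = Q * Y * B" unfolding e PK by simp
  qed
  have "real r = qtr (B * Y)" unfolding BY E(6) ..
  also have "\<dots> = real (qrank B)" by (rule qrank_eq_trace[OF B Y BYB])
  finally have "r = qrank B" by simp
  then show "minor_sum p ?H (qrank B) \<noteq> 0"
    "wmpi B P Q = qreal (inverse (minor_sum p ?H (qrank B))) \<cdot>\<^sub>m (S * cofmat p ?H (qrank B))"
    using r W unfolding Y_def by simp_all
qed

section \<open>Row expansions, denominators and the entries of the solution\<close>

lemma cofmat_apply_row:
  assumes H: "H \<in> carrier_mat n n" and herm: "ctrans H = H" and j: "j < n"
  shows "(\<Sum>\<alpha>\<in>idx_sets_with s n j. rdet_on \<alpha> (row_repl H j b) j) = (\<Sum>l<n. b l * cofmat n H s $$ (l, j))"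
proof -
  have "qcnj (rdet_on \<alpha> (row_repl H j b) j) = cdet_on \<alpha> (col_repl H j (\<lambda>r. qcnj (b r))) j"
    if \<alpha>: "\<alpha> \<in> idx_sets_with s n j" for \<alpha>
  proof -
    have a: "finite \<alpha>" "j \<in> \<alpha>" "\<alpha> \<subseteq> {0..<n}" using idx_sets_withD[OF \<alpha>] by auto
    have "qcnj (row_repl H j b y x) = col_repl H j (\<lambda>r. qcnj (b r)) x y" if "x \<in> \<alpha>" "y \<in> \<alpha>" for x y
    proof -
      have "ent H x y = qcnj (ent H y x)"
        using herm_on_ent[OF H herm a(3)] that unfolding herm_on_def by blast
      then show ?thesis by (simp add: row_repl_def col_repl_def ent_def)
    qed
    then show ?thesis unfolding qcnj_rdet_on[OF a(1)] by (rule cdet_on_cong[OF a(1,2)])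
  qed
  then have "qcnj (\<Sum>\<alpha>\<in>idx_sets_with s n j. rdet_on \<alpha> (row_repl H j b) j)
      = (\<Sum>\<alpha>\<in>idx_sets_with s n j. cdet_on \<alpha> (col_repl H j (\<lambda>r. qcnj (b r))) j)"
    unfolding qcnj_sum by (rule sum.cong[OF refl])
  also have "\<dots> = (\<Sum>l<n. cofmat n H s $$ (j, l) * qcnj (b l))" by (rule cofmat_apply[OF j])
  also have "\<dots> = (\<Sum>l<n. qcnj (b l * cofmat n H s $$ (l, j)))"
  \<comment> \<open>The cofactor matrix is Hermitian, so the conjugate of its row \<open>j\<close>
    is its column \<open>j\<close>.\<close>
  proof (rule sum.cong[OF refl])
    fix l assume "l \<in> {..<n}"
    then have "ctrans (cofmat n H s) $$ (j, l) = qcnj (cofmat n H s $$ (l, j))" using j by (simp add: ctrans_def)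
    then show "cofmat n H s $$ (j, l) * qcnj (b l) = qcnj (b l * cofmat n H s $$ (l, j))"
      unfolding ctrans_cofmat[OF H herm] by simp
  qed
  also have "\<dots> = qcnj (\<Sum>l<n. b l * cofmat n H s $$ (l, j))" by (simp only: qcnj_sum)
  finally show ?thesis by (simp only: qcnj_eq_iff)
qed

text \<open>\<open>s\<close> is positive because \<open>hdet_on\<close> expands along
  \<open>Min S\<close>, which requires a nonempty index set.\<close>

lemma sum_hdet_on:
  assumes H: "H \<in> carrier_mat n n" and herm: "ctrans H = H" and s: "s \<ge> 1"
  shows "(\<Sum>\<beta>\<in>idx_sets s n. hdet_on \<beta> (ent H)) = qreal (minor_sum n H s)"
  unfolding minor_sum_def qreal_sum
proof (rule sum.cong[OF refl])
  fix \<beta> assume "\<beta> \<in> idx_sets s n"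
  then have \<beta>: "\<beta> \<subseteq> {0..<n}" "card \<beta> = s" by (auto simp: idx_sets_def)
  then have "finite \<beta>" "\<beta> \<noteq> {}" using s by (auto intro: finite_subset)
  then show "hdet_on \<beta> (ent H) = qreal (herm_det \<beta> (ent H))"
    by (rule hdet_on_hermitian) (rule herm_on_ent[OF H herm \<beta>(1)])
qed

lemma idx_sets_full: "idx_sets n n = {{0..<n}}"
proof -
  have "\<beta> = {0..<n}" if "\<beta> \<subseteq> {0..<n}" "card \<beta> = n" for \<beta>
    using that by (intro card_subset_eq) auto
  then show ?thesis by (auto simp: idx_sets_def)
qed

lemma idx_sets_with_full:
  assumes "i < n"
  shows "idx_sets_with n n i = {{0..<n}}"
proof (intro equalityI subsetI)
  fix \<beta> assume "\<beta> \<in> idx_sets_with n n i"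
  then have "\<beta> \<in> idx_sets n n" by (simp add: idx_sets_def idx_sets_with_def)
  then show "\<beta> \<in> {{0..<n}}" by (simp only: idx_sets_full)
qed (use assms in \<open>simp add: idx_sets_with_def\<close>)

theorem theorem3p1:
  fixes A B D M N P Q AA BB Dt X :: "quat mat" and m n p q r1 r2 :: nat
    and dB_sum dA_sum dB_full dA_full :: "nat \<Rightarrow> nat \<Rightarrow> quat"
    and sumA sumB detA detB :: quat
  assumes A: "A \<in> carrier_mat m n" and B: "B \<in> carrier_mat p q" and D: "D \<in> carrier_mat m q"
    and M: "hpd m M" and N: "hpd n N" and P: "hpd p P" and Q: "hpd q Q"
    and r1_pos: "qrank A \<ge> 1" and r2_pos: "qrank B \<ge> 1"
    and AA_herm: "hermitian (qinv n N * ctrans A * M * A)"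
    and BB_herm: "hermitian (B * (qinv q Q * ctrans B * P))"
    and "r1 = qrank A" and "r2 = qrank B"
    and "AA = qinv n N * ctrans A * M * A"
    and "BB = B * (qinv q Q * ctrans B * P)"
    and "Dt = (qinv n N * ctrans A * M) * D * (qinv q Q * ctrans B * P)"
    and "X = wmpi A M N * D * wmpi B P Q"
    and "dB_sum = (\<lambda>j k. \<Sum>\<alpha>\<in>idx_sets_with r2 p j. rdet_on \<alpha> (row_repl BB j (\<lambda>s. Dt $$ (k,s))) j)"
    and "dA_sum = (\<lambda>i l. \<Sum>\<beta>\<in>idx_sets_with r1 n i. cdet_on \<beta> (col_repl AA i (\<lambda>r. Dt $$ (r,l))) i)"
    and "dB_full = (\<lambda>j k. rdet_on {0..<p} (row_repl BB j (\<lambda>s. Dt $$ (k,s))) j)"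
    and "dA_full = (\<lambda>i l. cdet_on {0..<n} (col_repl AA i (\<lambda>r. Dt $$ (r,l))) i)"
    and "sumA = (\<Sum>\<beta>\<in>idx_sets r1 n. hdet_on \<beta> (ent AA))"
    and "sumB = (\<Sum>\<alpha>\<in>idx_sets r2 p. hdet_on \<alpha> (ent BB))"
    and "detA = hdet_on {0..<n} (ent AA)"
    and "detB = hdet_on {0..<p} (ent BB)"
  shows
    "(r1 < n \<and> r2 < p \<longrightarrow> (\<forall>i<n. \<forall>j<p.
        X $$ (i,j) = (\<Sum>\<beta>\<in>idx_sets_with r1 n i. cdet_on \<beta> (col_repl AA i (dB_sum j)) i) / (sumA * sumB) \<and>
        X $$ (i,j) = (\<Sum>\<alpha>\<in>idx_sets_with r2 p j. rdet_on \<alpha> (row_repl BB j (dA_sum i)) j) / (sumA * sumB)))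
   \<and> (r1 = n \<and> r2 = p \<longrightarrow> (\<forall>i<n. \<forall>j<p.
        X $$ (i,j) = cdet_on {0..<n} (col_repl AA i (dB_full j)) i / (detA * detB) \<and>
        X $$ (i,j) = rdet_on {0..<p} (row_repl BB j (dA_full i)) j / (detA * detB)))
   \<and> (r1 = n \<and> r2 < p \<longrightarrow> (\<forall>i<n. \<forall>j<p.
        X $$ (i,j) = cdet_on {0..<n} (col_repl AA i (dB_sum j)) i / (detA * sumB) \<and>
        X $$ (i,j) = (\<Sum>\<alpha>\<in>idx_sets_with r2 p j. rdet_on \<alpha> (row_repl BB j (dA_full i)) j) / (detA * sumB)))
   \<and> (r1 < n \<and> r2 = p \<longrightarrow> (\<forall>i<n. \<forall>j<p.
        X $$ (i,j) = rdet_on {0..<p} (row_repl BB j (dA_sum i)) j / (sumA * detB) \<and>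
        X $$ (i,j) = (\<Sum>\<beta>\<in>idx_sets_with r1 n i. cdet_on \<beta> (col_repl AA i (dB_full j)) i) / (sumA * detB)))"
proof -
  define SA where "SA = qinv n N * ctrans A * M"
  define SB where "SB = qinv q Q * ctrans B * P"
  have AA: "AA = SA * A" and BB: "BB = B * SB" and Dt: "Dt = SA * D * SB"
    by (simp_all add: assms SA_def SB_def)
  note dims [simp] = carrier_dims[OF A] carrier_dims[OF B] carrier_dims[OF D]
    carrier_dims[OF hpdD(1)[OF M]] carrier_dims[OF hpdD(1)[OF P]]
    carrier_dims[OF qinv_hpd(1)[OF N]] carrier_dims[OF qinv_hpd(1)[OF Q]]
  have SAd [simp]: "dim_row SA = n" "dim_col SA = m" by (simp_all add: SA_def)
  have SBd [simp]: "dim_row SB = q" "dim_col SB = p" by (simp_all add: SB_def)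
  have AAc: "AA \<in> carrier_mat n n" by (rule carrier_matI) (simp_all add: AA)
  have BBc: "BB \<in> carrier_mat p p" by (rule carrier_matI) (simp_all add: BB)
  have Dtc: "Dt \<in> carrier_mat n p" by (rule carrier_matI) (simp_all add: Dt)
  have hA: "ctrans AA = AA" using AA_herm by (simp add: hermitian_def AA SA_def)
  have hB: "ctrans BB = BB" using BB_herm by (simp add: hermitian_def BB SB_def)
  define KA where "KA = cofmat n AA r1"
  define KB where "KB = cofmat p BB r2"
  define a where "a = minor_sum n AA r1"
  define b where "b = minor_sum p BB r2"
  have KAc: "KA \<in> carrier_mat n n" and KBc: "KB \<in> carrier_mat p p" by (simp_all add: KA_def KB_def)
  note [simp] = carrier_dims[OF KAc] carrier_dims[OF KBc]
  have wA: "wmpi A M N = qreal (inverse a) \<cdot>\<^sub>m (KA * SA)"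
    using wmpi_left(2)[OF A M N] hA by (simp add: AA SA_def a_def KA_def assms(12))
  have wB: "wmpi B P Q = qreal (inverse b) \<cdot>\<^sub>m (SB * KB)"
    using wmpi_right(2)[OF B P Q] hB by (simp add: BB SB_def b_def KB_def assms(13))
  \<comment> \<open>The sharp factors of the two inverses enclose \<open>D\<close> and form
    \<open>Dt\<close>; the real scalars are central and can be collected in front.\<close>
  have "X = qreal (inverse b) \<cdot>\<^sub>m (qreal (inverse a) \<cdot>\<^sub>m (KA * (Dt * KB)))"
    unfolding assms(17) wA wB Dt by (simp add: dim_algebra)
  then have X: "X = qreal (inverse (a * b)) \<cdot>\<^sub>m (KA * (Dt * KB))"
    by (simp only: smult_smult_qreal inverse_mult_distrib mult.commute)
  have sA: "sumA = qreal a" and sB: "sumB = qreal b"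
    using sum_hdet_on[OF AAc hA] sum_hdet_on[OF BBc hB] r1_pos r2_pos assms(12,13,22,23)
    by (simp_all add: a_def b_def)
  \<comment> \<open>Division is right multiplication by the inverse, whereas the scalar stands on
    the left; it is real, so the side does not matter.\<close>
  have Xij: "X $$ (i, j) = v / (sumA * sumB)" if "i < n" "j < p" "(KA * (Dt * KB)) $$ (i, j) = v" for i j v
  proof -
    have "X $$ (i, j) = qreal (inverse (a * b)) * v" unfolding X using that by simp
    also have "\<dots> = v * inverse (qreal (a * b))" unfolding inverse_qreal by (rule qreal_commute[symmetric])
    finally show ?thesis by (simp add: sA sB divide_quat_def)
  qed
  have dB: "dB_sum j k = (Dt * KB) $$ (k, j)" if "k < n" "j < p" for j k
    unfolding assms(18) cofmat_apply_row[OF BBc hB that(2)]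
    using mult_entry[OF Dtc KBc that] by (simp add: KB_def)
  have dA: "dA_sum i l = (KA * Dt) $$ (i, l)" if "i < n" "l < p" for i l
    unfolding assms(19) cofmat_apply[OF that(1)]
    using mult_entry[OF KAc Dtc that] by (simp add: KA_def)
  \<comment> \<open>The two formulas are the two bracketings of the triple product of
    \<open>KA\<close>, \<open>Dt\<close> and \<open>KB\<close>. They are proved here for all ranks
    at once.\<close>
  have main: "X $$ (i,j) = (\<Sum>\<beta>\<in>idx_sets_with r1 n i. cdet_on \<beta> (col_repl AA i (dB_sum j)) i) / (sumA * sumB)"
    "X $$ (i,j) = (\<Sum>\<alpha>\<in>idx_sets_with r2 p j. rdet_on \<alpha> (row_repl BB j (dA_sum i)) j) / (sumA * sumB)"
    if ij: "i < n" "j < p" for i j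
  proof -
    have "(KA * (Dt * KB)) $$ (i, j) = (\<Sum>k<n. KA $$ (i, k) * (Dt * KB) $$ (k, j))"
      by (rule mult_entry[OF KAc mult_carrier_mat[OF Dtc KBc] ij])
    also have "\<dots> = (\<Sum>k<n. KA $$ (i, k) * dB_sum j k)"
      by (rule sum.cong[OF refl]) (use ij dB in auto)
    also have "\<dots> = (\<Sum>\<beta>\<in>idx_sets_with r1 n i. cdet_on \<beta> (col_repl AA i (dB_sum j)) i)"
      unfolding KA_def by (rule cofmat_apply[OF ij(1), symmetric])
    finally show "X $$ (i,j) = (\<Sum>\<beta>\<in>idx_sets_with r1 n i. cdet_on \<beta> (col_repl AA i (dB_sum j)) i) / (sumA * sumB)"
      by (rule Xij[OF ij])
    have "(KA * (Dt * KB)) $$ (i, j) = (KA * Dt * KB) $$ (i, j)"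
      using carrier_dims[OF Dtc] by (simp only: assoc_dim carrier_dims[OF KAc] carrier_dims[OF KBc])
    also have "\<dots> = (\<Sum>l<p. (KA * Dt) $$ (i, l) * KB $$ (l, j))"
      by (rule mult_entry[OF mult_carrier_mat[OF KAc Dtc] KBc ij])
    also have "\<dots> = (\<Sum>l<p. dA_sum i l * KB $$ (l, j))"
      by (rule sum.cong[OF refl]) (use ij dA in auto)
    also have "\<dots> = (\<Sum>\<alpha>\<in>idx_sets_with r2 p j. rdet_on \<alpha> (row_repl BB j (dA_sum i)) j)"
      unfolding KB_def by (rule cofmat_apply_row[OF BBc hB ij(2), symmetric])
    finally show "X $$ (i,j) = (\<Sum>\<alpha>\<in>idx_sets_with r2 p j. rdet_on \<alpha> (row_repl BB j (dA_sum i)) j) / (sumA * sumB)"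
      by (rule Xij[OF ij])
  qed
  \<comment> \<open>At full rank the only index set is the whole range, so the sums collapse to
    determinants of the whole matrix and the remaining cases become instances of
    \<open>main\<close>.\<close>
  have fullA: "idx_sets_with r1 n i = {{0..<n}}" "dA_full i = dA_sum i" "detA = sumA" if "r1 = n" "i < n" for i
    using that by (simp_all add: assms(19,21,22,24) idx_sets_full idx_sets_with_full)
  have fullB: "idx_sets_with r2 p j = {{0..<p}}" "dB_full j = dB_sum j" "detB = sumB" if "r2 = p" "j < p" for j
    using that by (simp_all add: assms(18,20,23,25) idx_sets_full idx_sets_with_full)
  show ?thesis
  proof (intro conjI impI allI)
    fix i j assume c: "r1 = n \<and> r2 = p" and ij: "i < n" "j < p"
    note [simp] = fullA[OF conjunct1[OF c] ij(1)] fullB[OF conjunct2[OF c] ij(2)]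
    show "X $$ (i,j) = cdet_on {0..<n} (col_repl AA i (dB_full j)) i / (detA * detB)"
      "X $$ (i,j) = rdet_on {0..<p} (row_repl BB j (dA_full i)) j / (detA * detB)"
      using main[OF ij] by simp_all
  next
    fix i j assume c: "r1 = n \<and> r2 < p" and ij: "i < n" "j < p"
    note [simp] = fullA[OF conjunct1[OF c] ij(1)]
    show "X $$ (i,j) = cdet_on {0..<n} (col_repl AA i (dB_sum j)) i / (detA * sumB)"
      "X $$ (i,j) = (\<Sum>\<alpha>\<in>idx_sets_with r2 p j. rdet_on \<alpha> (row_repl BB j (dA_full i)) j) / (detA * sumB)"
      using main[OF ij] by simp_all
  next
    fix i j assume c: "r1 < n \<and> r2 = p" and ij: "i < n" "j < p"
    note [simp] = fullB[OF conjunct2[OF c] ij(2)]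
    show "X $$ (i,j) = rdet_on {0..<p} (row_repl BB j (dA_sum i)) j / (sumA * detB)"
      "X $$ (i,j) = (\<Sum>\<beta>\<in>idx_sets_with r1 n i. cdet_on \<beta> (col_repl AA i (dB_full j)) i) / (sumA * detB)"
      using main[OF ij] by simp_all
  qed (use main in auto)
qed

end
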